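(* Let $\mathrm{R}$ be a real closed field, $d \geq 2$, and let $\mathcal{P} \subset \mathrm{R}[X_1,\ldots,X_n]_{\leq d}$ and $\mathcal{P}_f, \mathcal{P}_g \subset \mathrm{R}[X_1,\ldots,X_n,Y]_{\leq d}$ be finite sets of polynomials. Let $A \subset \mathrm{R}^n$ be a closed $\mathcal{P}$-semi-algebraic set, and let $f,g: A \rightarrow \mathrm{R}$ be continuous semi-algebraic functions whose graphs are a $\mathcal{P}_f$-semi-algebraic set, respectively a $\mathcal{P}_g$-semi-algebraic set, and such that $f^{-1}(0) \subset g^{-1}(0)$. Then there exist $N = (8 d)^{2(n+7)}$ and a continuous semi-algebraic function $h:A \rightarrow \mathrm{R}$ such that $g^N = h f$ on $A$.
   Context: $\mathrm{R}[\ldots]_{\le d}$ denotes polynomials of degree at most $d$. For a finite set of polynomials $\mathcal{P}$, a $\mathcal{P}$-semi-algebraic set is the set of points satisfying a quantifier-free formula whose atoms are of the form $P=0$, $P>0$, $P<0$ with $P \in \mathcal{P}$. *)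

theory Defs
  imports "HOL-Library.Poly_Mapping" "HOL-Computational_Algebra.Polynomial"
begin

definition real_closed_field :: "'a::linordered_field itself \<Rightarrow> bool" where
  "real_closed_field _ \<longleftrightarrow>
     (\<forall>x::'a. 0 \<le> x \<longrightarrow> (\<exists>y. y * y = x)) \<and>
     (\<forall>p::'a poly. odd (degree p) \<longrightarrow> (\<exists>x. poly p x = 0))"

text \<open>Multivariate polynomials: finitely supported maps from monomials
(exponent vectors, variables indexed by nat: X_1,...,X_n are 0..n-1, Y is n) to coefficients.\<close>
type_synonym 'a mpoly = "(nat \<Rightarrow>\<^sub>0 nat) \<Rightarrow>\<^sub>0 'a"

definition mpoly_eval :: "'a::comm_ring_1 mpoly \<Rightarrow> (nat \<Rightarrow> 'a) \<Rightarrow> 'a" where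
  "mpoly_eval p x = (\<Sum>mon\<in>Poly_Mapping.keys p. Poly_Mapping.lookup p mon * (\<Prod>j\<in>Poly_Mapping.keys mon. x j ^ Poly_Mapping.lookup mon j))"

definition total_degree :: "'a::zero mpoly \<Rightarrow> nat" where
  "total_degree p = Max (insert 0 ((\<lambda>m. sum (Poly_Mapping.lookup m) (Poly_Mapping.keys m)) ` Poly_Mapping.keys p))"

definition vars_in :: "'a::zero mpoly \<Rightarrow> nat set \<Rightarrow> bool" where
  "vars_in p V \<longleftrightarrow> (\<forall>m\<in>Poly_Mapping.keys p. Poly_Mapping.keys m \<subseteq> V)"

definition polys_le :: "nat \<Rightarrow> nat \<Rightarrow> 'a::zero mpoly set" where
  "polys_le n d = {p. vars_in p {..<n} \<and> total_degree p \<le> d}"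

text \<open>R^n, represented as functions nat => R vanishing from index n on.\<close>
definition space :: "nat \<Rightarrow> (nat \<Rightarrow> 'a::zero) set" where
  "space n = {x. \<forall>i\<ge>n. x i = 0}"

definition trunc :: "nat \<Rightarrow> (nat \<Rightarrow> 'a::zero) \<Rightarrow> nat \<Rightarrow> 'a" where
  "trunc n x = (\<lambda>i. if i < n then x i else 0)"

datatype 'p qf_formula =
    AEq 'p | AGt 'p | ALt 'p
  | FNot "'p qf_formula" | FAnd "'p qf_formula" "'p qf_formula" | FOr "'p qf_formula" "'p qf_formula"

fun qf_polys :: "'p qf_formula \<Rightarrow> 'p set" where
  "qf_polys (AEq p) = {p}"
| "qf_polys (AGt p) = {p}"
| "qf_polys (ALt p) = {p}"
| "qf_polys (FNot f) = qf_polys f"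
| "qf_polys (FAnd f g) = qf_polys f \<union> qf_polys g"
| "qf_polys (FOr f g) = qf_polys f \<union> qf_polys g"

fun qf_sat :: "'a::linordered_idom mpoly qf_formula \<Rightarrow> (nat \<Rightarrow> 'a) \<Rightarrow> bool" where
  "qf_sat (AEq p) x = (mpoly_eval p x = 0)"
| "qf_sat (AGt p) x = (mpoly_eval p x > 0)"
| "qf_sat (ALt p) x = (mpoly_eval p x < 0)"
| "qf_sat (FNot f) x = (\<not> qf_sat f x)"
| "qf_sat (FAnd f g) x = (qf_sat f x \<and> qf_sat g x)"
| "qf_sat (FOr f g) x = (qf_sat f x \<or> qf_sat g x)"

definition P_semialg :: "'a::linordered_idom mpoly set \<Rightarrow> nat \<Rightarrow> (nat \<Rightarrow> 'a) set \<Rightarrow> bool" where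
  "P_semialg P n S \<longleftrightarrow> (\<exists>\<phi>. qf_polys \<phi> \<subseteq> P \<and> S = {x \<in> space n. qf_sat \<phi> x})"

definition semialg :: "nat \<Rightarrow> (nat \<Rightarrow> 'a::linordered_idom) set \<Rightarrow> bool" where
  "semialg n S \<longleftrightarrow> (\<exists>P. finite P \<and> (\<forall>p\<in>P. vars_in p {..<n}) \<and> P_semialg P n S)"

definition graph :: "nat \<Rightarrow> (nat \<Rightarrow> 'a::zero) set \<Rightarrow> ((nat \<Rightarrow> 'a) \<Rightarrow> 'a) \<Rightarrow> (nat \<Rightarrow> 'a) set" where
  "graph n A f = {x \<in> space (Suc n). trunc n x \<in> A \<and> x n = f (trunc n x)}"

definition sqdist :: "nat \<Rightarrow> (nat \<Rightarrow> 'a::linordered_idom) \<Rightarrow> (nat \<Rightarrow> 'a) \<Rightarrow> 'a" where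
  "sqdist n x y = (\<Sum>i<n. (x i - y i)^2)"

definition closed_in_Rn :: "nat \<Rightarrow> (nat \<Rightarrow> 'a::linordered_idom) set \<Rightarrow> bool" where
  "closed_in_Rn n A \<longleftrightarrow> A \<subseteq> space n \<and>
     (\<forall>x\<in>space n. (\<forall>\<delta>>0. \<exists>y\<in>A. sqdist n x y < \<delta>^2) \<longrightarrow> x \<in> A)"

definition cont_on_Rn :: "nat \<Rightarrow> (nat \<Rightarrow> 'a::linordered_idom) set \<Rightarrow> ((nat \<Rightarrow> 'a) \<Rightarrow> 'a) \<Rightarrow> bool" where
  "cont_on_Rn n A f \<longleftrightarrow>
     (\<forall>x\<in>A. \<forall>e>0. \<exists>\<delta>>0. \<forall>y\<in>A. sqdist n y x < \<delta>^2 \<longrightarrow> \<bar>f y - f x\<bar> < e)"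

end

theory Submission
  imports "HOL-Algebra.Algebraic_Closure_Type" "HOL-Analysis.Analysis" Defs
begin

hide_const (open) up_ring.coeff up_ring.monom Polynomials.degree Polynomials.lead_coeff module.smult
  Coset.order Sigma_Algebra.space Map.graph

text \<open>
  The function is \<open>h = g ^ N / f\<close> (0 where \<open>f\<close> vanishes, by the convention for division by 0); its continuity at the zeros of
  \<open>f\<close> and the semialgebraicity of its graph have to be shown. For polynomials of bounded shape the
  continuity is a first order statement about the coefficients, so quantifier elimination (for
  which the intermediate value property is derived from the axioms of a real closed field) transfers
  it from the reals; quantifier elimination also describes the graph of \<open>h\<close> without quantifiers.

  Over the reals one needs \<open>|g| ^ k \<le> C |f|\<close> near a zero of \<open>f\<close> for some \<open>k < N\<close>. Fix a small value
  \<open>t \<noteq> 0\<close> of \<open>g\<close> and minimise \<open>|u|\<close>, \<open>u = f(x)\<close>, over the points \<open>(x, u, t)\<close> with \<open>x\<close> in a ball. Among the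
  minimisers choose one at which a maximal set \<open>E\<close> of the given polynomials vanishes: then the
  minimisers with the same signs form a compact isolated set of minimisers of \<open>|u|\<close> on the zero set of
  \<open>F = \<Sum>p\<in>E. p\<^sup>2\<close>. For the perturbation \<open>F + \<delta> \<Sum>i. x\<^sub>i ^ (2 d + 2)\<close> the minimisers on a sublevel
  set \<open>\<le> s\<close> are critical points with respect to \<open>x\<close> of value \<open>s\<close>. Modulo the critical
  equations every monomial reduces to one of degree at most \<open>2 d\<close> in each \<open>x\<^sub>i\<close>, so counting
  monomials gives a nonzero polynomial \<open>R(t, u, s)\<close> of bounded degree that vanishes at these points.
  Letting \<open>\<delta> \<rightarrow> 0\<close> and then \<open>s \<rightarrow> 0\<close> one obtains a nonzero \<open>Q(t, u)\<close>, one of finitely many,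
  that vanishes at the minimum, and dividing by a power of \<open>u\<close> turns this into \<open>|t| ^ k \<le> C |u|\<close>.
\<close>

section \<open>The intermediate value property of real closed fields\<close>

text \<open>A sum of squares \<open>F\<close> has zero gradient at each of its zeros, so the
  critical equations of \<open>F\<close> itself carry no information. The perturbation repairs this:
  its exponent is even, so it never lowers values, and each critical equation can be solved for
  x_i^(2 d + 1) by a polynomial of degree at most 2 d - 1. Elimination thus becomes linear algebra,
  without resultants. The price is that R depends on \<delta>; scaling its coefficients keeps the
  limit nonzero. That limit depends on \<open>E\<close> only, not on t, the minimiser or its
  neighbourhood, and there are finitely many \<open>E\<close>: hence one exponent and one constant
  for all small t.

  Quantifier elimination is organised without a syntax of formulas. A relation \<open>det2\<close>
  between predicates over two fields says that the signs of the same finitely many integer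
  polynomials decide both. For two different fields it transfers sentences; for one field taken
  twice it eliminates quantifiers. The exponent obtained is 9 (2 d + 2) (2 d + 1)^n, well below
  \<open>N\<close>.\<close>

definition poly_ivt :: "'a::linordered_field itself \<Rightarrow> bool" where
  "poly_ivt _ \<longleftrightarrow> (\<forall>(p::'a poly) a b. a < b \<longrightarrow> poly p a * poly p b < 0 \<longrightarrow>
      (\<exists>c. a < c \<and> c < b \<and> poly p c = 0))"

section \<open>Subfields, power sums and symmetric functions of roots\<close>

definition subfield_set :: "'k::field_char_0 set \<Rightarrow> bool" where
  "subfield_set R \<longleftrightarrow> 1 \<in> R \<and> (\<forall>x\<in>R. \<forall>y\<in>R. x + y \<in> R \<and> x * y \<in> R) \<and>
     (\<forall>x\<in>R. - x \<in> R \<and> inverse x \<in> R)"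

lemma subfield_set_ops:
  assumes "subfield_set R"
  shows "1 \<in> R" "0 \<in> R" "x \<in> R \<Longrightarrow> y \<in> R \<Longrightarrow> x + y \<in> R" "x \<in> R \<Longrightarrow> y \<in> R \<Longrightarrow> x * y \<in> R"
    "x \<in> R \<Longrightarrow> - x \<in> R" "x \<in> R \<Longrightarrow> inverse x \<in> R" "x \<in> R \<Longrightarrow> y \<in> R \<Longrightarrow> x - y \<in> R"
    "x \<in> R \<Longrightarrow> y \<in> R \<Longrightarrow> x / y \<in> R" "of_nat n \<in> R"
proof -
  have R: "1 \<in> R" "\<And>x y. x \<in> R \<Longrightarrow> y \<in> R \<Longrightarrow> x + y \<in> R"
    "\<And>x y. x \<in> R \<Longrightarrow> y \<in> R \<Longrightarrow> x * y \<in> R"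
    "\<And>x. x \<in> R \<Longrightarrow> - x \<in> R" "\<And>x. x \<in> R \<Longrightarrow> inverse x \<in> R"
    using assms by (auto simp: subfield_set_def)
  note one = R(1) and add = R(2) and mult = R(3) and neg = R(4) and inv = R(5)
  show "1 \<in> R" "x \<in> R \<Longrightarrow> y \<in> R \<Longrightarrow> x + y \<in> R" "x \<in> R \<Longrightarrow> y \<in> R \<Longrightarrow> x * y \<in> R"
    "x \<in> R \<Longrightarrow> - x \<in> R" "x \<in> R \<Longrightarrow> inverse x \<in> R"
    using R by auto
  show zero: "0 \<in> R"
    using add[OF one neg[OF one]] by simp
  show "x \<in> R \<Longrightarrow> y \<in> R \<Longrightarrow> x - y \<in> R"
    using add[of x "- y"] neg by simp
  show "x \<in> R \<Longrightarrow> y \<in> R \<Longrightarrow> x / y \<in> R"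
    using mult[of x "inverse y"] inv by (simp add: divide_inverse)
  show "of_nat n \<in> R"
    by (induction n) (auto intro: zero add one)
qed

lemma subfield_set_sum:
  assumes "subfield_set R" "\<And>i. i \<in> I \<Longrightarrow> f i \<in> R"
  shows "(\<Sum>i\<in>I. f i) \<in> R"
  using assms(2) by (induction I rule: infinite_finite_induct)
    (auto intro: subfield_set_ops[OF assms(1)])

definition power_sum :: "'k::comm_ring_1 list \<Rightarrow> nat \<Rightarrow> 'k" where
  "power_sum xs k = (\<Sum>x\<leftarrow>xs. x ^ k)"

text \<open>Newton's identities, read off from the logarithmic derivative of
  \<open>\<Prod>(1 - y X)\<close>.\<close>

lemma newton_identity:
  fixes ys :: "'k::field_char_0 list"
  defines "P \<equiv> fps_of_poly (\<Prod>y\<leftarrow>ys. [:1, - y:])"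
  shows "of_nat (Suc k) * fps_nth P (Suc k) =
    - (\<Sum>i\<le>k. fps_nth P (k - i) * power_sum ys (Suc i))"
proof -
  have *: "fps_deriv (fps_of_poly (\<Prod>y\<leftarrow>ys. [:1, - y:])) =
      - (Abs_fps (\<lambda>n. power_sum ys (Suc n)) * fps_of_poly (\<Prod>y\<leftarrow>ys. [:1, - y:]))"
  proof (induction ys)
    case Nil
    show ?case by (simp add: power_sum_def fps_zero_def[symmetric])
  next
    case (Cons y ys)
    let ?Q = "fps_of_poly (\<Prod>y\<leftarrow>ys. [:1, - y:])"
    let ?L = "1 - fps_const y * fps_X"
    let ?G = "Abs_fps (\<lambda>n. y ^ Suc n)"
    let ?S = "Abs_fps (\<lambda>n. power_sum ys (Suc n))"
    have lin: "fps_of_poly [:1, - y:] = ?L"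
      by (simp add: fps_of_poly_pCons fps_const_neg[symmetric] algebra_simps del: fps_const_neg)
    have G: "?L * ?G = fps_const y"
    proof (rule fps_ext)
      fix n show "fps_nth (?L * ?G) n = fps_nth (fps_const y) n"
        by (cases n) (simp_all add: algebra_simps mult.assoc)
    qed
    have S: "Abs_fps (\<lambda>n. power_sum (y # ys) (Suc n)) = ?G + ?S"
      by (rule fps_ext) (simp add: power_sum_def)
    have "fps_deriv (?L * ?Q) = - fps_const y * ?Q + ?L * fps_deriv ?Q"
      by (simp add: algebra_simps)
    also have "\<dots> = - ((?L * ?G) * ?Q) - ?L * (?S * ?Q)"
      unfolding Cons G by simp
    also have "\<dots> = - ((?G + ?S) * (?L * ?Q))"
      by (simp add: algebra_simps)
    finally have "fps_deriv (?L * ?Q) = - ((?G + ?S) * (?L * ?Q))" .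
    moreover have "fps_of_poly (\<Prod>y\<leftarrow>y # ys. [:1, - y:]) = ?L * ?Q"
      by (simp only: list.map prod_list.Cons fps_of_poly_mult lin)
    ultimately show ?case by (simp only: S)
  qed
  have "of_nat (Suc k) * fps_nth P (Suc k) = fps_nth (fps_deriv P) k"
    by simp
  also have "\<dots> = - (\<Sum>i\<le>k. power_sum ys (Suc i) * fps_nth P (k - i))"
    unfolding P_def by (subst *) (simp add: fps_mult_nth atLeast0AtMost)
  finally show ?thesis by (simp add: mult.commute)
qed

text \<open>Since the product has constant coefficient 1, Newton's identity can be solved for the
  next power sum without dividing.\<close>

lemma power_sums_in_subfield:
  fixes ys :: "'k::field_char_0 list"
  assumes R: "subfield_set R" and c: "\<And>k. coeff (\<Prod>y\<leftarrow>ys. [:1, - y:]) k \<in> R"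
  shows "power_sum ys k \<in> R"
proof (induction k rule: less_induct)
  case (less k)
  show ?case
  proof (cases k)
    case 0
    then show ?thesis
      by (simp add: power_sum_def sum_list_triv subfield_set_ops[OF R])
  next
    case (Suc m)
    define c where "c = coeff (\<Prod>y\<leftarrow>ys. [:1, - y:])"
    have c0: "c 0 = 1" unfolding c_def by (induction ys) (auto simp: coeff_mult)
    have "{..m} = insert m {..<m}" by auto
    then have "of_nat (Suc m) * c (Suc m) =
        - (power_sum ys (Suc m) + (\<Sum>i<m. c (m - i) * power_sum ys (Suc i)))"
      using newton_identity[of m ys] c0 unfolding c_def by simp
    then have "power_sum ys (Suc m) =
        - (of_nat (Suc m) * c (Suc m)) - (\<Sum>i<m. c (m - i) * power_sum ys (Suc i))"
      by (metis add.inverse_inverse add_diff_cancel_right')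
    moreover have "\<dots> \<in> R"
      by (intro subfield_set_ops[OF R] subfield_set_sum[OF R])
        (use less assms(2) Suc in \<open>auto simp: c_def intro: subfield_set_ops[OF R]\<close>)
    ultimately show ?thesis using Suc by simp
  qed
qed

text \<open>The same identity solved for the coefficient of index \<open>Suc m\<close>, which
  divides by \<open>Suc m\<close>: characteristic zero enters here.\<close>

lemma coeffs_in_subfield:
  fixes ys :: "'k::field_char_0 list"
  assumes R: "subfield_set R" and s: "\<And>k. power_sum ys k \<in> R"
  shows "coeff (\<Prod>y\<leftarrow>ys. [:1, - y:]) k \<in> R"
proof (induction k rule: less_induct)
  case (less k)
  define c where "c = coeff (\<Prod>y\<leftarrow>ys. [:1, - y:])"
  have c0: "c 0 = 1" unfolding c_def by (induction ys) (auto simp: coeff_mult)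
  show ?case
  proof (cases k)
    case 0
    then show ?thesis using c0 subfield_set_ops[OF R] by (simp add: c_def)
  next
    case (Suc m)
    have "of_nat (Suc m) * c (Suc m) = - (\<Sum>i\<le>m. c (m - i) * power_sum ys (Suc i))"
      using newton_identity[of m ys] unfolding c_def by simp
    then have "c (Suc m) = - (\<Sum>i\<le>m. c (m - i) * power_sum ys (Suc i)) / of_nat (Suc m)"
      by (metis nonzero_mult_div_cancel_left of_nat_eq_0_iff nat.distinct(1))
    moreover have "\<dots> \<in> R"
      by (intro subfield_set_ops[OF R] subfield_set_sum[OF R])
        (use less s Suc in \<open>auto simp: c_def\<close>)
    ultimately show ?thesis using Suc by (simp add: c_def)
  qed
qed

lemma reflect_prod_linear:
  "reflect_poly (\<Prod>y\<leftarrow>ys. [:- y, 1:]) = (\<Prod>y\<leftarrow>ys. [:1, - y::'k::field_char_0:])"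
proof (induction ys)
  case (Cons y ys)
  have "reflect_poly [:- y, 1:] = [:1, - y:]"
    by (cases "y = 0") (simp_all add: reflect_poly_def)
  then show ?case using Cons by (simp add: reflect_poly_mult del: mult_pCons_left)
qed simp

lemma prod_linear_nonzero: "(\<Prod>y\<leftarrow>ys. [:- y, 1::'k::field_char_0:]) \<noteq> 0"
  by (induction ys) (auto simp del: mult_pCons_left)

lemma degree_prod_linear: "degree (\<Prod>y\<leftarrow>ys. [:- y, 1::'k::field_char_0:]) = length ys"
  by (induction ys) (auto simp: degree_mult_eq prod_linear_nonzero simp del: mult_pCons_left)

text \<open>Newton's identities concern the product of the 1 - y X, while the roots belong to the
  monic product of the X - y. Reversal only rearranges coefficients; zero roots show up as a drop of
  the degree.\<close>

lemma coeff_reversed_iff: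
  fixes ys :: "'k::field_char_0 list"
  assumes R: "subfield_set R"
  shows "(\<forall>k. coeff (\<Prod>y\<leftarrow>ys. [:- y, 1:]) k \<in> R) \<longleftrightarrow> (\<forall>k. coeff (\<Prod>y\<leftarrow>ys. [:1, - y:]) k \<in> R)"
proof -
  let ?p = "\<Prod>y\<leftarrow>ys. [:- y, 1:]"
  have c: "coeff (\<Prod>y\<leftarrow>ys. [:1, - y:]) k = (if k > degree ?p then 0 else coeff ?p (degree ?p - k))" for k
    unfolding reflect_prod_linear[symmetric] by (rule coeff_reflect_poly)
  have "coeff ?p k \<in> R" if *: "\<And>k. coeff (\<Prod>y\<leftarrow>ys. [:1, - y:]) k \<in> R" for k
  proof (cases "k \<le> degree ?p")
    case True
    then show ?thesis using *[of "degree ?p - k"]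
      by (metis c diff_diff_cancel diff_le_self not_le)
  next
    case False
    then show ?thesis using subfield_set_ops[OF R] by (simp add: coeff_eq_0)
  qed
  then show ?thesis using subfield_set_ops(2)[OF R] by (auto simp: c)
qed

text \<open>Pairs of positions rather than of values: equal roots have to count with multiplicity,
  so that the number of pairs is a function of the degree.\<close>

fun list_pairs :: "'k list \<Rightarrow> ('k \<times> 'k) list" where
  "list_pairs [] = []"
| "list_pairs (x # xs) = map (Pair x) xs @ list_pairs xs"

lemma length_list_pairs: "2 * length (list_pairs xs) = length xs * (length xs - 1)"
  by (induction xs) (auto simp: algebra_simps diff_mult_distrib2 le_square)

lemma set_list_pairs: "set (list_pairs xs) \<subseteq> set xs \<times> set xs"
  by (induction xs) auto

lemma sum_list_pairs:
  fixes \<phi> :: "'k \<Rightarrow> 'k \<Rightarrow> 'l::comm_ring_1"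
  assumes "\<And>a b. \<phi> a b = \<phi> b a"
  shows "2 * (\<Sum>(a, b)\<leftarrow>list_pairs xs. \<phi> a b) = (\<Sum>a\<leftarrow>xs. \<Sum>b\<leftarrow>xs. \<phi> a b) - (\<Sum>a\<leftarrow>xs. \<phi> a a)"
proof (induction xs)
  case (Cons x xs)
  have "(\<Sum>a\<leftarrow>xs. \<phi> a x) = (\<Sum>a\<leftarrow>xs. \<phi> x a)" by (simp add: assms)
  moreover have "(\<Sum>p\<leftarrow>map (Pair x) xs. case p of (a, b) \<Rightarrow> \<phi> a b) = (\<Sum>a\<leftarrow>xs. \<phi> x a)"
    by (simp add: comp_def)
  ultimately show ?case using Cons
    by (simp add: sum_list_addf algebra_simps)
qed simp

text \<open>Stands in for the theorem on symmetric polynomials. Expanding one factor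
  \<open>a + b + l * a * b\<close> at a time ends in products of two power sums; the exponents
  \<open>p\<close> and \<open>q\<close> are free because every expansion raises them.\<close>

lemma double_sums_in_subfield:
  fixes xs :: "'k::field_char_0 list"
  assumes R: "subfield_set R" and s: "\<And>k. power_sum xs k \<in> R" and l: "l \<in> R"
  shows "(\<Sum>a\<leftarrow>xs. \<Sum>b\<leftarrow>xs. a ^ p * b ^ q * (a + b + l * a * b) ^ m) \<in> R"
proof (induction m arbitrary: p q)
  case 0
  have "(\<Sum>a\<leftarrow>xs. \<Sum>b\<leftarrow>xs. a ^ p * b ^ q) = power_sum xs p * power_sum xs q"
    by (simp add: power_sum_def sum_list_const_mult sum_list_mult_const)
  then show ?case using s subfield_set_ops[OF R] by simp
next
  case (Suc m)
  have "(\<Sum>a\<leftarrow>xs. \<Sum>b\<leftarrow>xs. a ^ p * b ^ q * (a + b + l * a * b) ^ Suc m) =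
     (\<Sum>a\<leftarrow>xs. \<Sum>b\<leftarrow>xs. a ^ Suc p * b ^ q * (a + b + l * a * b) ^ m) +
     (\<Sum>a\<leftarrow>xs. \<Sum>b\<leftarrow>xs. a ^ p * b ^ Suc q * (a + b + l * a * b) ^ m) +
     l * (\<Sum>a\<leftarrow>xs. \<Sum>b\<leftarrow>xs. a ^ Suc p * b ^ Suc q * (a + b + l * a * b) ^ m)"
    by (simp add: sum_list_addf[symmetric] sum_list_const_mult[symmetric] algebra_simps)
  also have "\<dots> \<in> R" by (intro subfield_set_ops(3,4)[OF R] Suc l)
  finally show ?case .
qed

lemma diagonal_sums_in_subfield:
  fixes xs :: "'k::field_char_0 list"
  assumes R: "subfield_set R" and s: "\<And>k. power_sum xs k \<in> R" and l: "l \<in> R"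
  shows "(\<Sum>a\<leftarrow>xs. a ^ p * (a + a + l * a * a) ^ m) \<in> R"
proof (induction m arbitrary: p)
  case 0
  then show ?case using s[of p] by (simp add: power_sum_def)
next
  case (Suc m)
  have "(\<Sum>a\<leftarrow>xs. a ^ p * (a + a + l * a * a) ^ Suc m) =
     (\<Sum>a\<leftarrow>xs. a ^ Suc p * (a + a + l * a * a) ^ m) + (\<Sum>a\<leftarrow>xs. a ^ Suc p * (a + a + l * a * a) ^ m) +
     l * (\<Sum>a\<leftarrow>xs. a ^ Suc (Suc p) * (a + a + l * a * a) ^ m)"
    by (simp add: sum_list_addf[symmetric] sum_list_const_mult[symmetric] algebra_simps)
  also have "\<dots> \<in> R" by (intro subfield_set_ops(3,4)[OF R] Suc l)
  finally show ?case .
qed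

text \<open>The power sums of the pair values are half of the double sum minus the diagonal, so
  membership in \<open>R\<close> passes from the coefficients of one polynomial through power sums
  to those of the other.\<close>

lemma pair_polynomial_in_subfield:
  fixes xs :: "'k::field_char_0 list"
  assumes R: "subfield_set R" and c: "\<And>k. coeff (\<Prod>x\<leftarrow>xs. [:- x, 1:]) k \<in> R" and l: "l \<in> R"
  shows "coeff (\<Prod>y\<leftarrow>map (\<lambda>(a, b). a + b + l * a * b) (list_pairs xs). [:- y, 1:]) k \<in> R"
proof -
  let ?ys = "map (\<lambda>(a, b). a + b + l * a * b) (list_pairs xs)"
  have s: "power_sum xs k \<in> R" for k
    using power_sums_in_subfield[OF R] c coeff_reversed_iff[OF R] by blast
  have "power_sum ?ys k \<in> R" for k
  proof -
    have "2 * power_sum ?ys k = 2 * (\<Sum>(a, b)\<leftarrow>list_pairs xs. (a + b + l * a * b) ^ k)"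
      by (simp add: power_sum_def comp_def case_prod_unfold)
    also have "\<dots> = (\<Sum>a\<leftarrow>xs. \<Sum>b\<leftarrow>xs. a ^ 0 * b ^ 0 * (a + b + l * a * b) ^ k) -
        (\<Sum>a\<leftarrow>xs. a ^ 0 * (a + a + l * a * a) ^ k)"
      by (subst sum_list_pairs) (auto simp: algebra_simps)
    also have "\<dots> \<in> R"
      by (intro subfield_set_ops(7)[OF R] double_sums_in_subfield diagonal_sums_in_subfield R s l)
    finally have "2 * power_sum ?ys k / of_nat 2 \<in> R"
      using subfield_set_ops(8,9)[OF R] by blast
    then show ?thesis by simp
  qed
  then show ?thesis
    using coeffs_in_subfield[OF R] coeff_reversed_iff[OF R] by blast
qed

lemma subfield_range_to_ac: "subfield_set (range (to_ac :: 'a::field_char_0 \<Rightarrow> _))"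
  unfolding subfield_set_def
  by (auto simp flip: to_ac_add to_ac_mult to_ac_minus to_ac_inverse to_ac_1)

section \<open>The extension by a square root of -1\<close>

context
  fixes T :: "'a::linordered_field itself"
  assumes rcf: "real_closed_field TYPE('a)"
begin

definition imag_unit :: "'a alg_closure" where
  "imag_unit = (SOME z. z * z = - 1)"

lemma imag_unit_sq: "imag_unit * imag_unit = - 1"
proof -
  obtain z :: "'a alg_closure" where "z ^ 2 = - 1"
    using nth_root_exists[of 2 "- 1 :: 'a alg_closure"] by auto
  then have "z * z = - 1" by (simp add: power2_eq_square)
  then show ?thesis unfolding imag_unit_def by (rule someI)
qed

text \<open>The analogue of the complex numbers over the ordered field, taken inside its algebraic
  closure: roots exist beforehand and only their membership has to be shown.\<close>

definition gauss :: "'a alg_closure set" where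
  "gauss = {to_ac a + imag_unit * to_ac b | a b. True}"

lemma gaussI: "z = to_ac a + imag_unit * to_ac b \<Longrightarrow> z \<in> gauss"
  unfolding gauss_def by blast

lemma gauss_real: "to_ac a \<in> gauss"
  by (rule gaussI[of _ a 0]) simp

lemma gauss_add: "x \<in> gauss \<Longrightarrow> y \<in> gauss \<Longrightarrow> x + y \<in> gauss"
proof -
  assume "x \<in> gauss" "y \<in> gauss"
  then obtain a b c d where "x = to_ac a + imag_unit * to_ac b" "y = to_ac c + imag_unit * to_ac d"
    unfolding gauss_def by blast
  then show ?thesis by (intro gaussI[of _ "a + c" "b + d"]) (simp add: algebra_simps)
qed

lemma gauss_mult: "x \<in> gauss \<Longrightarrow> y \<in> gauss \<Longrightarrow> x * y \<in> gauss"
proof -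
  assume "x \<in> gauss" "y \<in> gauss"
  then obtain a b c d where xy: "x = to_ac a + imag_unit * to_ac b" "y = to_ac c + imag_unit * to_ac d"
    unfolding gauss_def by blast
  have "x * y = to_ac a * to_ac c + imag_unit * imag_unit * (to_ac b * to_ac d) +
      imag_unit * (to_ac a * to_ac d + to_ac b * to_ac c)"
    unfolding xy by (simp only: algebra_simps)
  then show ?thesis unfolding imag_unit_sq
    by (intro gaussI[of _ "a * c - b * d" "a * d + b * c"]) simp
qed

lemma gauss_diff: "x \<in> gauss \<Longrightarrow> y \<in> gauss \<Longrightarrow> x - y \<in> gauss"
  using gauss_add[of x "to_ac (- 1) * y"] gauss_mult[OF gauss_real[of "- 1"], of y] by simp

lemma rcf_sqrt: "0 \<le> (x::'a) \<Longrightarrow> \<exists>y. 0 \<le> y \<and> y * y = x"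
  using rcf unfolding real_closed_field_def
  by (metis abs_ge_zero abs_mult_self_eq)

text \<open>The formula for complex square roots: with \<open>m\<close> the modulus, the squares of
  the two parts are \<open>(m + a) / 2\<close> and \<open>(m - a) / 2\<close>, both nonnegative, and
  \<open>s\<close> is the relative sign that makes twice their product equal to
  \<open>b\<close>.\<close>

lemma gauss_sqrt:
  assumes "x \<in> gauss"
  shows "\<exists>w\<in>gauss. w * w = x"
proof -
  obtain a b where x: "x = to_ac a + imag_unit * to_ac b"
    using assms unfolding gauss_def by blast
  obtain m where m: "0 \<le> m" "m * m = a * a + b * b"
    using rcf_sqrt[of "a * a + b * b"] by auto
  have "\<bar>a\<bar> \<le> m"
  proof (rule ccontr)
    assume "\<not> \<bar>a\<bar> \<le> m"
    then have "m * m < \<bar>a\<bar> * \<bar>a\<bar>" using m(1) by (intro mult_strict_mono') auto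
    then have "m * m < a * a" by simp
    moreover have "0 \<le> b * b" by simp
    ultimately show False using m(2) by linarith
  qed
  then have "0 \<le> (m + a) / 2" "0 \<le> (m - a) / 2" by (auto simp: abs_le_iff)
  then obtain c d where c: "0 \<le> c" "c * c = (m + a) / 2" and d: "0 \<le> d" "d * d = (m - a) / 2"
    using rcf_sqrt by blast
  have "(2 * c * d) * (2 * c * d) = 4 * ((c * c) * (d * d))" by (simp only: algebra_simps)
  also have "\<dots> = (m * m - a * a)" unfolding c d by (simp add: field_simps)
  finally have "(2 * c * d) * (2 * c * d) = b * b" using m by simp
  then have "2 * c * d = b \<or> 2 * c * d = - b"
    by (simp only: square_eq_iff)
  then obtain s where s: "s * s = 1" "2 * c * (s * d) = b"
  proof
    assume "2 * c * d = b" then show thesis by (intro that[of 1]) auto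
  next
    assume "2 * c * d = - b" then show thesis by (intro that[of "- 1"]) auto
  qed
  define w where "w = to_ac c + imag_unit * to_ac (s * d)"
  have "w * w = to_ac (c * c) + imag_unit * imag_unit * to_ac ((s * s) * (d * d)) +
     imag_unit * to_ac (2 * c * (s * d))"
    unfolding w_def by (simp only: to_ac_mult to_ac_add to_ac_numeral) (simp add: algebra_simps)
  also have "\<dots> = to_ac (c * c) + - to_ac (d * d) + imag_unit * to_ac b"
    unfolding imag_unit_sq s by simp
  also have "\<dots> = to_ac (c * c - d * d) + imag_unit * to_ac b" by simp
  also have "c * c - d * d = a" unfolding c d by (simp add: field_simps)
  finally have "w * w = x" using x by simp
  moreover have "w \<in> gauss" unfolding w_def by (rule gaussI[OF refl])
  ultimately show ?thesis by blast
qed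

text \<open>Quadratic formula: \<open>a - b\<close> is a square root of the discriminant, which is
  an expression in \<open>a + b\<close> and \<open>a * b\<close>.\<close>

lemma gauss_quadratic:
  assumes "a + b \<in> gauss" "a * b \<in> gauss"
  shows "a \<in> gauss"
proof -
  have "(a + b) * (a + b) - to_ac 4 * (a * b) \<in> gauss"
    by (intro gauss_diff gauss_mult gauss_real assms)
  then obtain w where w: "w \<in> gauss" "w * w = (a + b) * (a + b) - to_ac 4 * (a * b)"
    using gauss_sqrt by blast
  have "w * w = (a - b) * (a - b)" unfolding w by (simp add: algebra_simps)
  then have "a - b = w \<or> a - b = to_ac (- 1) * w"
    by (auto simp: square_eq_iff)
  then have "a - b \<in> gauss" using w(1) gauss_mult[OF gauss_real[of "- 1"], of w] by auto
  then have "to_ac (1 / 2) * ((a + b) + (a - b)) \<in> gauss"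
    by (intro gauss_mult gauss_real gauss_add assms)
  also have "to_ac (1 / 2) * ((a + b) + (a - b)) = a" by simp
  finally show ?thesis .
qed

text \<open>Laplace's argument: induction on the 2-adic valuation of the degree.\<close>

lemma root_in_gauss:
  fixes p :: "'a poly"
  assumes "degree p = 2 ^ v * m" "odd m"
  shows "\<exists>z\<in>gauss. poly (map_poly to_ac p) z = 0"
  using assms
proof (induction v arbitrary: p m)
  case 0
  then obtain x where "poly p x = 0"
    using rcf unfolding real_closed_field_def by auto
  moreover have "poly (map_poly to_ac p) (to_ac x) = to_ac (poly p x)"
    by (simp add: poly_altdef degree_map_poly coeff_map_poly to_ac_sum)
  ultimately show ?case using gauss_real by (metis to_ac_0)
next
  case (Suc v)
  let ?R = "range (to_ac :: 'a \<Rightarrow> _)"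
  let ?p = "map_poly to_ac p"
  have deg: "degree ?p = degree p" by (simp add: degree_map_poly)
  have "p \<noteq> 0" using Suc.prems by (auto elim: oddE)
  then have p0: "?p \<noteq> 0" by (simp add: map_poly_eq_0_iff)
  obtain xs where xs: "length xs = degree p" "?p = smult (lead_coeff ?p) (\<Prod>x\<leftarrow>xs. [:- x, 1:])"
  proof -
    obtain A where A: "size A = degree ?p" "?p = smult (lead_coeff ?p) (\<Prod>x\<in>#A. [:-x, 1:])"
      using alg_closed_imp_factorization[OF p0] by blast
    obtain xs where "mset xs = A" using ex_mset by blast
    then show thesis using A deg
      by (intro that[of xs]) (auto simp flip: prod_mset_prod_list simp: prod_mset_prod_list size_mset)
  qed
  have lc: "lead_coeff ?p \<noteq> 0" "lead_coeff ?p \<in> ?R" using p0 by (simp_all only: leading_coeff_0_iff) (simp_all add: coeff_map_poly)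
  have cR: "coeff (\<Prod>x\<leftarrow>xs. [:- x, 1:]) k \<in> ?R" for k
  proof -
    have "coeff ?p k = lead_coeff ?p * coeff (\<Prod>x\<leftarrow>xs. [:- x, 1:]) k"
      by (subst xs(2)) simp
    then have "coeff (\<Prod>x\<leftarrow>xs. [:- x, 1:]) k = coeff ?p k / lead_coeff ?p"
      using lc by (simp add: field_simps)
    moreover have "coeff ?p k \<in> ?R" by (simp add: coeff_map_poly)
    ultimately show ?thesis using lc subfield_set_ops(8)[OF subfield_range_to_ac] by metis
  qed
  have "\<exists>q\<in>set (list_pairs xs). fst q + snd q + of_nat l * fst q * snd q \<in> gauss" for l :: nat
  proof -
    define ys where "ys = map (\<lambda>(a, b). a + b + of_nat l * a * b) (list_pairs xs)"
    define P where "P = (\<Prod>y\<leftarrow>ys. [:- y, 1:])"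
    have PR: "coeff P k \<in> ?R" for k
      unfolding P_def ys_def
      by (intro pair_polynomial_in_subfield subfield_range_to_ac cR subfield_set_ops(9))
    define q where "q = map_poly of_ac P"
    have q: "map_poly to_ac q = P"
      unfolding q_def by (rule poly_eqI) (simp add: coeff_map_poly to_ac_of_ac PR)
    have "degree q = length ys"
    proof -
      have "degree q = degree (map_poly to_ac q)" by (simp add: degree_map_poly)
      then show ?thesis unfolding q P_def by (simp add: degree_prod_linear)
    qed
    also have "\<dots> = length (list_pairs xs)" by (simp add: ys_def)
    also have "\<dots> = 2 ^ v * (m * (2 ^ Suc v * m - 1))"
      using length_list_pairs[of xs] unfolding xs(1) Suc.prems(1) by simp
    finally have dq: "degree q = 2 ^ v * (m * (2 ^ Suc v * m - 1))" .
    \<comment> \<open>The last factor is an even number minus one, so passing from the roots to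
      their pairs lowers the power of 2 in the degree by exactly one.\<close>
    have "0 < 2 ^ Suc v * m" using Suc.prems by (auto elim: oddE)
    then have "odd (m * (2 ^ Suc v * m - 1))" using Suc.prems by auto
    from Suc.IH[OF dq this] obtain z where z: "z \<in> gauss" "poly P z = 0"
      using q by auto
    then have "z \<in> set ys" unfolding P_def by (induction ys) auto
    then show ?thesis using z(1) unfolding ys_def by (auto simp: case_prod_unfold)
  qed
  then obtain c where c: "\<And>l. c l \<in> set (list_pairs xs)"
    "\<And>l. fst (c l) + snd (c l) + of_nat l * fst (c l) * snd (c l) \<in> gauss"
    by metis
  \<comment> \<open>There are infinitely many \<open>l\<close> and finitely many pairs, so two
    values of \<open>l\<close> share a pair; the two resulting elements of \<open>gauss\<close>
    determine \<open>a * b\<close> and \<open>a + b\<close>.\<close>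
  have "\<not> inj c"
    using finite_imageD[of c UNIV] finite_subset[of "range c" "set (list_pairs xs)"] c(1) by auto
  then obtain l k where lk: "c l = c k" "l \<noteq> k" unfolding inj_def by blast
  obtain a b where ab: "c l = (a, b)" by fastforce
  have 1: "a + b + of_nat l * a * b \<in> gauss" "a + b + of_nat k * a * b \<in> gauss"
    using c(2)[of l] c(2)[of k] unfolding lk(1)[symmetric] ab by auto
  define r :: 'a where "r = of_nat l - of_nat k"
  have r: "r \<noteq> 0" using lk by (simp add: r_def)
  have "to_ac (1 / r) * ((a + b + of_nat l * a * b) - (a + b + of_nat k * a * b)) \<in> gauss"
    by (intro gauss_mult gauss_real gauss_diff 1)
  also have "(a + b + of_nat l * a * b) - (a + b + of_nat k * a * b) = to_ac r * (a * b)"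
    unfolding r_def by (simp add: algebra_simps)
  also have "to_ac (1 / r) * (to_ac r * (a * b)) = a * b" using r by simp
  finally have ab_g: "a * b \<in> gauss" .
  have "(a + b + of_nat l * a * b) - to_ac (of_nat l) * (a * b) \<in> gauss"
    by (intro gauss_diff gauss_mult gauss_real ab_g 1)
  then have "a + b \<in> gauss" by (simp add: algebra_simps)
  with ab_g have "a \<in> gauss" by (rule gauss_quadratic[rotated])
  moreover have "a \<in> set xs" using c(1)[of l] ab set_list_pairs[of xs] by auto
  then have "poly (\<Prod>x\<leftarrow>xs. [:- x, 1:]) a = 0" by (induction xs) auto
  then have "poly ?p a = 0" by (subst xs(2)) simp
  ultimately show ?case by blast
qed

text \<open>The quadratic is (X - a)^2 + b^2, which vanishes at the root a + i b; it divides
  \<open>p\<close> because a nonzero remainder of degree at most one cannot vanish at a point with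
  \<open>b \<noteq> 0\<close>.\<close>

lemma real_factor:
  fixes p :: "'a poly"
  assumes "degree p > 0"
  shows "(\<exists>c. [:- c, 1:] dvd p) \<or> (\<exists>a b. b \<noteq> 0 \<and> [:a * a + b * b, - 2 * a, 1:] dvd p)"
proof -
  have "degree p \<noteq> 0" using assms by simp
  then obtain m where "degree p = 2 ^ multiplicity 2 (degree p) * m" "\<not> 2 dvd m"
    using multiplicity_decompose'[of "degree p" 2] by auto
  then obtain z where z: "z \<in> gauss" "poly (map_poly to_ac p) z = 0"
    using root_in_gauss by blast
  then obtain a b where ab: "z = to_ac a + imag_unit * to_ac b" unfolding gauss_def by blast
  have ev: "poly (map_poly to_ac q) (to_ac x) = to_ac (poly q x)" for q :: "'a poly" and x
    by (simp add: poly_altdef degree_map_poly coeff_map_poly to_ac_sum)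
  show ?thesis
  proof (cases "b = 0")
    case True
    then have "to_ac (poly p a) = 0" using z ab ev by simp
    then show ?thesis by (auto simp: poly_eq_0_iff_dvd)
  next
    case False
    define Q where "Q = [:a * a + b * b, - 2 * a, 1:]"
    have iu: "imag_unit * (imag_unit * x) = - x" for x
      using imag_unit_sq by (simp flip: mult.assoc)
    have Qz: "poly (map_poly to_ac Q) z = 0"
      unfolding Q_def ab by (simp add: map_poly_pCons algebra_simps iu)
    have hom: "poly (map_poly to_ac (q + r * s)) z =
        poly (map_poly to_ac q) z + poly (map_poly to_ac r) z * poly (map_poly to_ac s) z"
      for q r s :: "'a poly"
    proof -
      have "map_poly to_ac (q + r * s) = map_poly to_ac q + map_poly to_ac r * map_poly to_ac s"
        by (rule poly_eqI) (simp add: coeff_map_poly coeff_mult to_ac_sum)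
      then show ?thesis by simp
    qed
    have Q0: "Q \<noteq> 0" "degree Q = 2" by (auto simp: Q_def)
    define r where "r = p mod Q"
    have dr: "degree r < 2"
      using degree_mod_less[of Q p] Q0 by (auto simp: r_def)
    have "poly (map_poly to_ac (p mod Q + p div Q * Q)) z = 0" using z by simp
    then have rz: "poly (map_poly to_ac r) z = 0" unfolding hom Qz r_def by simp
    obtain r0 r1 where r: "r = [:r0, r1:]"
    proof
      show "r = [:coeff r 0, coeff r 1:]"
        using dr by (intro poly_eqI) (auto simp: coeff_pCons coeff_eq_0 split: nat.split)
    qed
    have "to_ac r0 + to_ac r1 * z = 0"
      using rz unfolding r by (simp add: map_poly_pCons algebra_simps)
    \<comment> \<open>Independence of 1 and the imaginary unit is obtained by squaring, which
      produces a vanishing sum of two squares in the ordered field.\<close>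
    then have *: "to_ac (r0 + r1 * a) = - imag_unit * to_ac (r1 * b)"
      unfolding ab by (simp add: algebra_simps eq_neg_iff_add_eq_0)
    then have "to_ac (r0 + r1 * a) * to_ac (r0 + r1 * a) = (imag_unit * imag_unit) * (to_ac (r1 * b) * to_ac (r1 * b))"
      by (simp only: *) (simp add: algebra_simps)
    then have "to_ac ((r0 + r1 * a) * (r0 + r1 * a)) = to_ac (- ((r1 * b) * (r1 * b)))"
      unfolding imag_unit_sq by simp
    then have "(r0 + r1 * a) * (r0 + r1 * a) + (r1 * b) * (r1 * b) = 0"
      unfolding to_ac_eq_iff by simp
    then have "r0 + r1 * a = 0" "r1 * b = 0"
      by (auto simp: sum_squares_eq_zero_iff)
    then have "r = 0" using False by (simp add: r)
    then have "Q dvd p" unfolding r_def by (simp add: mod_eq_0_iff_dvd)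
    then show ?thesis using False unfolding Q_def by blast
  qed
qed

end

text \<open>Dividing out a factor without a root between \<open>a\<close> and \<open>b\<close> keeps
  the sign change: the quadratics are positive everywhere, and such a linear factor has the same
  sign at both ends. So the degree can be lowered until a root inside turns up.\<close>

lemma rcf_imp_poly_ivt:
  assumes "real_closed_field TYPE('a::linordered_field)"
  shows "poly_ivt TYPE('a)"
proof -
  have "\<exists>c. a < c \<and> c < b \<and> poly p c = 0"
    if "a < b" "poly p a * poly p b < 0" for p :: "'a poly" and a b
    using that
  proof (induction "degree p" arbitrary: p rule: less_induct)
    case less
    show ?case
    proof (cases "degree p = 0")
      case True
      then obtain c where "p = [:c:]" by (rule degree_eq_zeroE)
      then have "c * c < 0" using less.prems by simp
      then show ?thesis by (simp add: not_less[symmetric] mult_less_0_iff)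
    next
      case False
      have p0: "p \<noteq> 0" using less.prems by auto
      from False consider c where "[:- c, 1:] dvd p" | u v where "v \<noteq> 0" "[:u * u + v * v, - 2 * u, 1:] dvd p"
        using real_factor[OF assms, of p] by auto
      then show ?thesis
      proof cases
        case 1
        then obtain q where q: "p = [:- c, 1:] * q" by (rule dvdE)
        have pq: "poly p x = (x - c) * poly q x" for x unfolding q by (simp add: algebra_simps)
        show ?thesis
        proof (cases "a < c \<and> c < b")
          case True
          then show ?thesis using pq[of c] by auto
        next
          case False
          moreover have "a \<noteq> c" "b \<noteq> c" using less.prems pq by auto
          ultimately have "0 < (a - c) * (b - c)"
            using less.prems(1) by (cases "c < a") (auto simp: zero_less_mult_iff)
          moreover have "poly p a * poly p b = ((a - c) * (b - c)) * (poly q a * poly q b)"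
            unfolding pq by (simp add: algebra_simps)
          ultimately have "poly q a * poly q b < 0"
            using less.prems(2) by (metis mult_less_0_iff order_less_asym)
          moreover have "degree q < degree p"
            using p0 q by (subst q, subst degree_mult_eq) auto
          ultimately show ?thesis using less.hyps[of q] less.prems(1) pq by auto
        qed
      next
        case 2
        then obtain q where q: "p = [:u * u + v * v, - 2 * u, 1:] * q" by (metis dvdE)
        have pq: "poly p x = ((x - u) * (x - u) + v * v) * poly q x" for x
          unfolding q by (simp add: algebra_simps)
        have pos: "0 < (x - u) * (x - u) + v * v" for x
          using 2 by (intro add_nonneg_pos) (auto simp: zero_less_mult_iff)
        have "poly p a * poly p b =
            (((a - u) * (a - u) + v * v) * ((b - u) * (b - u) + v * v)) * (poly q a * poly q b)"
          unfolding pq by (simp only: ac_simps)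
        then have "poly q a * poly q b < 0"
          using less.prems(2) mult_pos_pos[OF pos[of a] pos[of b]] by (metis mult_less_0_iff order_less_asym)
        moreover have "degree q < degree p"
          using p0 q by (subst q, subst degree_mult_eq) auto
        ultimately show ?thesis using less.hyps[of q] less.prems(1) pq by auto
      qed
    qed
  qed
  then show ?thesis unfolding poly_ivt_def by blast
qed

lemma poly_ivt_real: "poly_ivt TYPE(real)"
  unfolding poly_ivt_def
proof (intro allI impI)
  fix p :: "real poly" and a b :: real
  assume "a < b" "poly p a * poly p b < 0"
  then show "\<exists>c. a < c \<and> c < b \<and> poly p c = 0"
    using poly_IVT_pos[of a b p] poly_IVT_neg[of a b p] unfolding mult_less_0_iff by blast
qed

section \<open>Matching the sign diagrams of two lists of polynomials\<close>

lemma poly_no_root_same_sign: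
  fixes p :: "'a::linordered_field poly"
  assumes "poly_ivt TYPE('a)" "a < b" "\<And>x. a < x \<Longrightarrow> x < b \<Longrightarrow> poly p x \<noteq> 0"
    "poly p a \<noteq> 0" "poly p b \<noteq> 0"
  shows "0 < poly p a * poly p b"
proof (rule ccontr)
  assume "\<not> 0 < poly p a * poly p b"
  then have "poly p a * poly p b < 0" using assms(4,5) by (simp add: not_less order_le_less)
  then show False using assms unfolding poly_ivt_def by blast
qed

lemma pderiv_two_powers:
  fixes A B q :: "'a::linordered_field poly"
  assumes "pderiv A = 1" "pderiv B = 1"
  shows "pderiv (A ^ Suc m * (B ^ Suc n * q)) = A ^ m * (B ^ n *
    (smult (of_nat (Suc m)) (B * q) + smult (of_nat (Suc n)) (A * q) + A * B * pderiv q))"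
proof -
  have "A ^ Suc m * (B ^ Suc n * dq + q * (smult t (B ^ n) * 1)) + B ^ Suc n * q * (smult s (A ^ m) * 1) =
    A ^ m * (B ^ n * (smult s (B * q) + smult t (A * q) + A * B * dq))" for s t and dq :: "'a poly"
    by (simp add: algebra_simps smult_add_right)
  then show ?thesis by (simp only: pderiv_mult pderiv_power_Suc assms)
qed

text \<open>An algebraic proof without extrema. Removing the full multiplicities at both ends leaves
  \<open>q\<close> with equal signs there, and after removing them from the derivative the cofactor
  \<open>g\<close> has opposite signs at \<open>a\<close> and \<open>b\<close>.\<close>

lemma poly_rolle_consecutive:
  fixes p :: "'a::linordered_field poly"
  assumes ivt: "poly_ivt TYPE('a)" and ab: "a < b" and pa: "poly p a = 0" and pb: "poly p b = 0"
    and p0: "p \<noteq> 0" and nr: "\<And>x. a < x \<Longrightarrow> x < b \<Longrightarrow> poly p x \<noteq> 0"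
  shows "\<exists>c. a < c \<and> c < b \<and> poly (pderiv p) c = 0"
proof -
  let ?A = "[:- a, 1:]" and ?B = "[:- b, 1:]"
  obtain q1 where q1: "p = ?A ^ order a p * q1" "\<not> ?A dvd q1"
    using order_decomp[OF p0] by blast
  have "order a p \<noteq> 0" using pa p0 order_root by blast
  then obtain m where m: "order a p = Suc m" by (cases "order a p") auto
  have q10: "q1 \<noteq> 0" using q1 p0 by auto
  have "poly q1 b = 0" using pb ab by (subst (asm) q1(1)) (auto simp: poly_power)
  obtain q where q: "q1 = ?B ^ order b q1 * q" "\<not> ?B dvd q"
    using order_decomp[OF q10] by blast
  have "order b q1 \<noteq> 0" using \<open>poly q1 b = 0\<close> q10 order_root by blast
  then obtain n where n: "order b q1 = Suc n" by (cases "order b q1") auto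
  have p: "p = ?A ^ Suc m * (?B ^ Suc n * q)" using q1 q m n by simp
  have qb: "poly q b \<noteq> 0" using q(2) by (simp add: poly_eq_0_iff_dvd)
  have qa: "poly q a \<noteq> 0"
  proof
    assume "poly q a = 0"
    then have "poly q1 a = 0" by (subst q(1)) simp
    then show False using q1(2) by (simp add: poly_eq_0_iff_dvd)
  qed
  have pp: "poly p x = (x - a) ^ Suc m * ((x - b) ^ Suc n * poly q x)" for x
    unfolding p poly_mult poly_power by simp
  have "0 < poly q a * poly q b"
    using nr unfolding pp by (intro poly_no_root_same_sign[OF ivt ab] qa qb) auto
  define g where "g = smult (of_nat (Suc m)) (?B * q) + smult (of_nat (Suc n)) (?A * q) + ?A * ?B * pderiv q"
  have "poly g a = of_nat (Suc m) * ((a - b) * poly q a)" "poly g b = of_nat (Suc n) * ((b - a) * poly q b)"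
    by (simp_all add: g_def algebra_simps)
  then have "poly g a * poly g b =
      - ((of_nat (Suc m) * of_nat (Suc n)) * ((b - a) * (b - a)) * (poly q a * poly q b))"
  proof -
    have "(s * ((a - b) * x)) * (t * ((b - a) * y)) = - ((s * t) * ((b - a) * (b - a)) * (x * y))" for s t x y
      by (simp add: algebra_simps)
    then show "poly g a = of_nat (Suc m) * ((a - b) * poly q a) \<Longrightarrow>
        poly g b = of_nat (Suc n) * ((b - a) * poly q b) \<Longrightarrow> ?thesis" by simp
  qed
  moreover have "0 < (of_nat (Suc m) * of_nat (Suc n)) * ((b - a) * (b - a)) * (poly q a * poly q b)"
    using \<open>0 < poly q a * poly q b\<close> ab
    by (intro mult_pos_pos[OF mult_pos_pos[OF mult_pos_pos mult_pos_pos]])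
      (simp_all only: of_nat_0_less_iff zero_less_Suc diff_gt_0_iff_gt)
  ultimately have "poly g a * poly g b < 0" by linarith
  then obtain c where c: "a < c" "c < b" "poly g c = 0"
    using ivt ab unfolding poly_ivt_def by blast
  have "pderiv p = ?A ^ m * (?B ^ n * g)"
    unfolding p g_def by (rule pderiv_two_powers) (simp_all add: pderiv_pCons)
  then have "poly (pderiv p) c = 0" using c by simp
  then show ?thesis using c by blast
qed

lemma poly_rolle:
  fixes p :: "'a::linordered_field poly"
  assumes ivt: "poly_ivt TYPE('a)" and ab: "a < b" and pa: "poly p a = 0" and pb: "poly p b = 0"
  shows "\<exists>c. a < c \<and> c < b \<and> poly (pderiv p) c = 0"
proof (cases "p = 0")
  case True
  then show ?thesis using ab dense by fastforce
next
  case False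
  define W where "W = {x. poly p x = 0} \<inter> {x. a < x \<and> x \<le> b}"
  have fin: "finite W" unfolding W_def using poly_roots_finite[OF False] by auto
  have ne: "W \<noteq> {}" using ab pb by (auto simp: W_def)
  have M: "Min W \<in> W" using fin ne by (rule Min_in)
  have "\<exists>c. a < c \<and> c < Min W \<and> poly (pderiv p) c = 0"
  proof (rule poly_rolle_consecutive[OF ivt _ pa _ False])
    show "a < Min W" "poly p (Min W) = 0" using M by (auto simp: W_def)
    show "poly p x \<noteq> 0" if "a < x" "x < Min W" for x
      using that Min_le[OF fin, of x] M by (auto simp: W_def)
  qed
  then show ?thesis using M by (auto simp: W_def intro: order_less_le_trans)
qed

text \<open>The arguments live in different fields, so their signs are compared by equivalences and
  not by an equation between \<open>sgn\<close> values.\<close>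

definition sgneq :: "'a::linordered_field \<Rightarrow> 'b::linordered_field \<Rightarrow> bool" where
  "sgneq x y \<longleftrightarrow> (0 < x \<longleftrightarrow> 0 < y) \<and> (x < 0 \<longleftrightarrow> y < 0)"

lemma sgneq_sym: "sgneq x y \<Longrightarrow> sgneq y x"
  by (auto simp: sgneq_def)

lemma sgneq_zero: "sgneq x y \<Longrightarrow> x = 0 \<longleftrightarrow> y = 0"
  unfolding sgneq_def by (metis linorder_neqE_linordered_idom less_irrefl)

lemma sgneq_00: "sgneq 0 0"
  by (simp add: sgneq_def)

lemma sgneq_of_int: "sgneq (of_int k) (of_int k)"
  by (simp add: sgneq_def)

lemma sgneq_mult: "sgneq a b \<Longrightarrow> sgneq c d \<Longrightarrow> sgneq (a * c) (b * d)"
  unfolding sgneq_def zero_less_mult_iff mult_less_0_iff by blast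

lemma sgneq_cancel:
  assumes "sgneq a b" "a \<noteq> 0" "sgneq (a * c) (b * d)"
  shows "sgneq c d"
proof -
  have "0 < a \<or> a < 0" using assms(2) by auto
  then show ?thesis using assms(1,3) unfolding sgneq_def zero_less_mult_iff mult_less_0_iff
    by (metis less_asym)
qed

lemma sgneq_pos_mult:
  assumes "sgneq a b" "0 < a * c" "0 < b * d"
  shows "sgneq c d"
  using assms unfolding sgneq_def zero_less_mult_iff by (metis less_asym)

text \<open>A finite order isomorphism between points of two fields. The condition applies to two
  pairs in either order, so matched points determine each other.\<close>

definition order_matching :: "('a::linordered_field \<times> 'b::linordered_field) set \<Rightarrow> bool" where
  "order_matching M \<longleftrightarrow> finite M \<and> (\<forall>(x, x')\<in>M. \<forall>(y, y')\<in>M. x < y \<longleftrightarrow> x' < y')"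

text \<open>The matched points cut both lines into points and open intervals; related arguments lie
  in corresponding pieces.\<close>

definition samepos :: "('a::linordered_field \<times> 'b::linordered_field) set \<Rightarrow> 'a \<Rightarrow> 'b \<Rightarrow> bool" where
  "samepos M y y' \<longleftrightarrow> (\<forall>(x, x')\<in>M. (x < y \<longleftrightarrow> x' < y') \<and> (y < x \<longleftrightarrow> y' < x'))"

lemma order_matching_converse: "order_matching M \<Longrightarrow> order_matching (M\<inverse>)"
  unfolding order_matching_def by fastforce

lemma samepos_converse: "samepos M y y' \<Longrightarrow> samepos (M\<inverse>) y' y"
  unfolding samepos_def by fastforce

lemma sameposD:
  assumes "samepos M y y'" "(x, x') \<in> M"
  shows "x < y \<longleftrightarrow> x' < y'" "y < x \<longleftrightarrow> y' < x'" "y = x \<longleftrightarrow> y' = x'"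
proof -
  show 1: "x < y \<longleftrightarrow> x' < y'" and 2: "y < x \<longleftrightarrow> y' < x'"
    using assms unfolding samepos_def by blast+
  show "y = x \<longleftrightarrow> y' = x'"
    using 1 2 by (metis less_irrefl linorder_neqE_linordered_idom)
qed

lemma finite_separation:
  fixes L U :: "'a::linordered_field set"
  assumes "finite L" "finite U" "\<And>l u. l \<in> L \<Longrightarrow> u \<in> U \<Longrightarrow> l < u"
  shows "\<exists>z. (\<forall>l\<in>L. l < z) \<and> (\<forall>u\<in>U. z < u)"
proof (cases "L = {} \<or> U = {}")
  case True
  then consider "L = {}" | "U = {}" by blast
  then show ?thesis
  proof cases
    case 1
    obtain z where "\<And>u. u \<in> insert 0 U \<Longrightarrow> z < u"
      using Min_le[of "insert 0 U"] assms(2) lt_ex[of "Min (insert 0 U)"]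
      by (metis finite_insert order_less_le_trans)
    then show ?thesis using 1 by auto
  next
    case 2
    obtain z where "\<And>u. u \<in> insert 0 L \<Longrightarrow> u < z"
      using Max_ge[of "insert 0 L"] assms(1) gt_ex[of "Max (insert 0 L)"]
      by (metis finite_insert order_le_less_trans)
    then show ?thesis using 2 by auto
  qed
next
  case False
  then have "Max L < Min U" using assms by simp
  then obtain z where "Max L < z" "z < Min U" using dense by blast
  then show ?thesis using assms False by (auto simp: Max_less_iff Min_gr_iff)
qed

text \<open>The extension step of a back-and-forth argument: ordered fields are dense without end
  points, so every piece has a nonempty counterpart.\<close>

lemma samepos_exists:
  assumes "order_matching M"
  shows "\<exists>y'. samepos M y y'"
proof (cases "\<exists>y'. (y, y') \<in> M")
  case True
  then obtain y' where "(y, y') \<in> M" by blast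
  then have "samepos M y y'" using assms unfolding samepos_def order_matching_def by fastforce
  then show ?thesis by blast
next
  case False
  let ?L = "snd ` {(x, x') \<in> M. x < y}" and ?U = "snd ` {(x, x') \<in> M. y < x}"
  have "finite M" using assms by (simp add: order_matching_def)
  then have "finite ?L" "finite ?U" by (auto intro: finite_subset[of _ "snd ` M"])
  moreover have "l < u" if "l \<in> ?L" "u \<in> ?U" for l u
    using that assms unfolding order_matching_def by (force dest: less_trans)
  ultimately obtain z where z: "\<forall>l\<in>?L. l < z" "\<forall>u\<in>?U. z < u"
    using finite_separation[of ?L ?U] by blast
  have "samepos M y z"
    unfolding samepos_def
  proof (intro ballI, clarify)
    fix x x' assume xx: "(x, x') \<in> M"
    have "x < y \<Longrightarrow> x' < z" "y < x \<Longrightarrow> z < x'" using z xx by force+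
    moreover have "x < y \<or> y < x" using False xx by (metis linorder_neqE_linordered_idom)
    ultimately show "(x < y \<longleftrightarrow> x' < z) \<and> (y < x \<longleftrightarrow> z < x')" by (metis less_asym)
  qed
  then show ?thesis by blast
qed

text \<open>The field may be non-Archimedean, so the behaviour at infinity is proved algebraically.
  The positive bound \<open>c\<close> is carried along because the next Horner step multiplies it by
  a large \<open>x\<close>.\<close>

lemma poly_bounded_below_large:
  fixes p :: "'a::linordered_field poly"
  assumes "0 < lead_coeff p"
  shows "\<exists>B c. 0 < c \<and> (\<forall>x\<ge>B. c \<le> poly p x)"
  using assms
proof (induction p)
  case (pCons a q)
  show ?case
  proof (cases "q = 0")
    case True
    then show ?thesis using pCons.prems by (intro exI[of _ 0] exI[of _ a]) auto
  next
    case False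
    then obtain B c where c: "0 < c" "\<And>x. x \<ge> B \<Longrightarrow> c \<le> poly q x"
      using pCons by auto
    have "1 \<le> poly (pCons a q) x" if "x \<ge> max 0 (max B ((1 - a) / c))" for x
    proof -
      have x: "0 \<le> x" "B \<le> x" "(1 - a) / c \<le> x" using that by auto
      have "1 - a \<le> x * c" using x(3) c(1) by (simp add: divide_le_eq)
      also have "\<dots> \<le> x * poly q x" using x c(2) by (intro mult_left_mono) auto
      finally show ?thesis by (simp add: algebra_simps)
    qed
    then show ?thesis by (intro exI[of _ "max 0 (max B ((1 - a) / c))"] exI[of _ 1]) auto
  qed
qed simp

lemma poly_sign_large:
  fixes p :: "'a::linordered_field poly"
  assumes "p \<noteq> 0"
  shows "\<exists>x>z. 0 < lead_coeff p * poly p x"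
proof -
  have "0 < lead_coeff (smult (lead_coeff p) p)"
    using assms leading_coeff_0_iff[of p]
    by (simp only: lead_coeff_smult zero_less_mult_iff) (metis linorder_neqE_linordered_idom)
  from poly_bounded_below_large[OF this] obtain B c where
    "0 < c" "\<And>x. x \<ge> B \<Longrightarrow> c \<le> lead_coeff p * poly p x" by auto
  then have "0 < lead_coeff p * poly p (max B (z + 1))" by (meson max.cobounded1 order_less_le_trans)
  then show ?thesis by (intro exI[of _ "max B (z + 1)"]) (auto simp: less_max_iff_disj)
qed

lemma poly_sign_small:
  fixes p :: "'a::linordered_field poly"
  assumes "p \<noteq> 0"
  shows "\<exists>x<z. 0 < (lead_coeff p * (- 1) ^ degree p) * poly p x"
proof -
  let ?q = "pcompose p [:0, - 1:]"
  have lc: "lead_coeff ?q = lead_coeff p * (- 1) ^ degree p"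
    by (subst lead_coeff_comp) auto
  have "?q \<noteq> 0" using assms lc by (metis leading_coeff_0_iff mult_eq_0_iff power_not_zero neg_equal_0_iff_equal zero_neq_one)
  then obtain x where x: "x > - z" "0 < lead_coeff ?q * poly ?q x"
    using poly_sign_large by blast
  have "0 < (lead_coeff p * (- 1) ^ degree p) * poly p (- x)"
    using x(2) unfolding lc by (simp add: poly_pcompose)
  then show ?thesis using x(1) by (intro exI[of _ "- x"]) auto
qed

context
  fixes M :: "('a::linordered_field \<times> 'b::linordered_field) set"
    and p :: "'a poly" and P :: "'b poly"
  assumes M: "order_matching M"
    and deg: "degree p = degree P"
    and lc: "sgneq (lead_coeff p) (lead_coeff P)" and p0: "p \<noteq> 0"
    and sg: "\<And>x x'. (x, x') \<in> M \<Longrightarrow> sgneq (poly p x) (poly P x')"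
begin

lemma nonzero_other_side: "P \<noteq> 0"
  using p0 sgneq_zero[OF lc] by auto

text \<open>The end \<open>l\<close> is the nearest matched point below \<open>y\<close>, where
  signs agree by assumption, or a point so far to the left that the leading coefficients and the
  common degree decide the sign.\<close>

lemma bracket_below:
  assumes yy: "samepos M y y'"
  shows "\<exists>l l'. l < y \<and> l' < y' \<and> sgneq (poly p l) (poly P l') \<and>
    (\<forall>(x, x')\<in>M. x < y \<longrightarrow> x \<le> l \<and> x' \<le> l')"
proof -
  let ?L = "{(x, x') \<in> M. x < y}"
  have fin: "finite ?L" using M unfolding order_matching_def by (auto intro: finite_subset[of _ M])
  show ?thesis
  proof (cases "?L = {}")
    case True
    obtain l l' where l: "l < y" "0 < (lead_coeff p * (- 1) ^ degree p) * poly p l"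
      "l' < y'" "0 < (lead_coeff P * (- 1) ^ degree P) * poly P l'"
      using poly_sign_small[OF p0] poly_sign_small[OF nonzero_other_side] by metis
    have "sgneq ((- 1 :: 'a) ^ degree p) ((- 1 :: 'b) ^ degree P)"
      unfolding deg by (cases "even (degree P)") (simp_all add: sgneq_def)
    from sgneq_pos_mult[OF sgneq_mult[OF lc this] l(2) l(4)]
    have "sgneq (poly p l) (poly P l')" .
    then show ?thesis using l True by blast
  next
    case False
    then have "Max (fst ` ?L) \<in> fst ` ?L" using fin by (intro Max_in) auto
    then obtain l l' where l: "(l, l') \<in> M" "l < y" "l = Max (fst ` ?L)" by auto
    have "x \<le> l \<and> x' \<le> l'" if xx: "(x, x') \<in> M" "x < y" for x x'
    proof -
      have "x \<le> l" unfolding l(3) using fin xx by (intro Max_ge) force+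
      then have "\<not> l < x" by simp
      then have "\<not> l' < x'" using M l xx unfolding order_matching_def by blast
      then show ?thesis using \<open>x \<le> l\<close> by simp
    qed
    moreover have "l' < y'" using sameposD[OF yy l(1)] l by simp
    ultimately show ?thesis using l sg by blast
  qed
qed

lemma bracket_above:
  assumes yy: "samepos M y y'"
  shows "\<exists>u u'. y < u \<and> y' < u' \<and> sgneq (poly p u) (poly P u') \<and>
    (\<forall>(x, x')\<in>M. y < x \<longrightarrow> u \<le> x \<and> u' \<le> x')"
proof -
  let ?L = "{(x, x') \<in> M. y < x}"
  have fin: "finite ?L" using M unfolding order_matching_def by (auto intro: finite_subset[of _ M])
  show ?thesis
  proof (cases "?L = {}")
    case True
    obtain l l' where l: "y < l" "0 < lead_coeff p * poly p l"
      "y' < l'" "0 < lead_coeff P * poly P l'"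
      using poly_sign_large[OF p0] poly_sign_large[OF nonzero_other_side] by metis
    from sgneq_pos_mult[OF lc l(2) l(4)] have "sgneq (poly p l) (poly P l')" .
    then show ?thesis using l True by blast
  next
    case False
    then have "Min (fst ` ?L) \<in> fst ` ?L" using fin by (intro Min_in) auto
    then obtain l l' where l: "(l, l') \<in> M" "y < l" "l = Min (fst ` ?L)" by auto
    have "l \<le> x \<and> l' \<le> x'" if xx: "(x, x') \<in> M" "y < x" for x x'
    proof -
      have "l \<le> x" unfolding l(3) using fin xx by (intro Min_le) force+
      then have "\<not> x < l" by simp
      then have "\<not> x' < l'" using M l xx unfolding order_matching_def by blast
      then show ?thesis using \<open>l \<le> x\<close> by simp
    qed
    moreover have "y' < l'" using sameposD[OF yy l(1)] l by simp
    ultimately show ?thesis using l sg by blast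
  qed
qed

text \<open>No root of the derivative lies strictly inside the piece around \<open>r\<close>. By
  Rolle \<open>r\<close> is the only root up to the ends and is simple, so \<open>p\<close> changes
  sign across the piece. The signs at the ends carry over to \<open>P\<close>, where the
  intermediate value property supplies \<open>r'\<close>.\<close>

lemma root_transfer:
  assumes ivt: "poly_ivt TYPE('a)" "poly_ivt TYPE('b)"
    and dr: "\<And>x. poly (pderiv p) x = 0 \<Longrightarrow> x \<in> fst ` M"
    and r: "poly p r = 0" "r \<notin> fst ` M"
  shows "\<exists>r'. poly P r' = 0 \<and> samepos M r r'"
proof -
  obtain r0 where r0: "samepos M r r0" using samepos_exists[OF M] by blast
  obtain l l' where l: "l < r" "l' < r0" "sgneq (poly p l) (poly P l')"
    "\<And>x x'. (x, x') \<in> M \<Longrightarrow> x < r \<Longrightarrow> x \<le> l \<and> x' \<le> l'"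
    using bracket_below[OF r0] by blast
  obtain u u' where u: "r < u" "r0 < u'" "sgneq (poly p u) (poly P u')"
    "\<And>x x'. (x, x') \<in> M \<Longrightarrow> r < x \<Longrightarrow> u \<le> x \<and> u' \<le> x'"
    using bracket_above[OF r0] by blast
  have noM: "x \<notin> fst ` M" if "l < x" "x < u" for x
  proof
    assume "x \<in> fst ` M"
    then obtain x' where "(x, x') \<in> M" by auto
    then show False using that l(4)[of x x'] u(4)[of x x'] r(2) \<open>x \<in> fst ` M\<close>
      by (metis linorder_neqE_linordered_idom not_le)
  qed
  obtain q where q: "p = [:- r, 1:] * q" using r(1) by (metis poly_eq_0_iff_dvd dvdE)
  have pq: "poly p x = (x - r) * poly q x" for x unfolding q by (simp add: algebra_simps)
  have qn: "poly q x \<noteq> 0" if x: "l \<le> x" "x \<le> u" for x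
  proof
    assume *: "poly q x = 0"
    consider "x = r" | "x < r" | "r < x" by fastforce
    then show False
    proof cases
      case 1
      have "poly (pderiv p) r = poly q r" unfolding q pderiv_mult by (simp add: pderiv_pCons)
      then show False using * 1 dr r(2) by auto
    next
      case 2
      have "poly p x = 0" using * pq by simp
      then obtain c where "x < c" "c < r" "poly (pderiv p) c = 0"
        using poly_rolle[OF ivt(1) 2 _ r(1)] by blast
      then show False using dr noM[of c] x u(1) by auto
    next
      case 3
      have "poly p x = 0" using * pq by simp
      then obtain c where "r < c" "c < x" "poly (pderiv p) c = 0"
        using poly_rolle[OF ivt(1) 3 r(1)] by blast
      then show False using dr noM[of c] x l(1) by auto
    qed
  qed
  have lu: "l < u" using l u by auto
  have "0 < poly q l * poly q u"
    using qn lu by (intro poly_no_root_same_sign[OF ivt(1) lu]) auto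
  moreover have "(l - r) * (u - r) < 0" using l(1) u(1) by (simp add: mult_less_0_iff)
  ultimately have "((l - r) * (u - r)) * (poly q l * poly q u) < 0" by (rule mult_neg_pos[rotated])
  then have "poly p l * poly p u < 0" unfolding pq by (simp only: ac_simps)
  then have "poly P l' * poly P u' < 0" using sgneq_mult[OF l(3) u(3)] by (simp add: sgneq_def)
  moreover have "l' < u'" using l u by auto
  ultimately obtain r' where r': "l' < r'" "r' < u'" "poly P r' = 0"
    using ivt(2) unfolding poly_ivt_def by blast
  have "samepos M r r'"
    unfolding samepos_def
  proof (intro ballI, clarify)
    fix x x' assume xx: "(x, x') \<in> M"
    have "x \<noteq> r" using xx r(2) by force
    then show "(x < r \<longleftrightarrow> x' < r') \<and> (r < x \<longleftrightarrow> r' < x')"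
      using l(4)[OF xx] u(4)[OF xx] r' by (metis linorder_neqE_linordered_idom not_less order_le_less_trans order_less_le_trans less_asym)
  qed
  then show ?thesis using r' by blast
qed

end

text \<open>Between two roots of \<open>p\<close> lies a root of its derivative, which is already
  matched. So each piece contains at most one new root on either side, and pairing the roots of
  corresponding pieces respects the order. Afterwards the sign inside a piece is constant and can be
  read off at an end that is not a root.\<close>

lemma extend_matching:
  fixes M :: "('a::linordered_field \<times> 'b::linordered_field) set"
  assumes ivt: "poly_ivt TYPE('a)" "poly_ivt TYPE('b)"
    and M: "order_matching M"
    and deg: "degree p = degree P" and lc: "sgneq (lead_coeff p) (lead_coeff P)" and p0: "p \<noteq> 0"
    and sg: "\<And>x x'. (x, x') \<in> M \<Longrightarrow> sgneq (poly p x) (poly P x')"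
    and dr: "\<And>x. poly (pderiv p) x = 0 \<Longrightarrow> x \<in> fst ` M"
    and dR: "\<And>x. poly (pderiv P) x = 0 \<Longrightarrow> x \<in> snd ` M"
  defines "M' \<equiv> M \<union> {(r, r'). poly p r = 0 \<and> poly P r' = 0 \<and> samepos M r r'}"
  shows "order_matching M'" "\<And>x. poly p x = 0 \<Longrightarrow> x \<in> fst ` M'" "\<And>x. poly P x = 0 \<Longrightarrow> x \<in> snd ` M'"
    "\<And>y y'. samepos M' y y' \<Longrightarrow> sgneq (poly p y) (poly P y')"
proof -
  have P0: "P \<noteq> 0" using p0 sgneq_zero[OF lc] by auto
  have conv: "fst ` (M\<inverse>) = snd ` M" by force
  have fin: "finite M'"
  proof -
    have "finite ({r. poly p r = 0} \<times> {r. poly P r = 0})"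
      using poly_roots_finite[OF p0] poly_roots_finite[OF P0] by blast
    then show ?thesis unfolding M'_def using M
      by (auto simp: order_matching_def intro: finite_subset[rotated])
  qed
  have new_lt: "r2 < s2" if as: "poly p r = 0" "poly p s = 0" "samepos M r r2" "samepos M s s2" "r < s" for r s r2 s2
  proof -
    obtain c where c: "r < c" "c < s" "poly (pderiv p) c = 0"
      using poly_rolle[OF ivt(1) as(5) as(1,2)] by blast
    then obtain c' where "(c, c') \<in> M" using dr by force
    then have "r2 < c'" "c' < s2" using c sameposD[OF as(3)] sameposD[OF as(4)] by blast+
    then show ?thesis by (rule less_trans)
  qed
  have new_lt': "r < s" if as: "poly P r2 = 0" "poly P s2 = 0" "samepos M r r2" "samepos M s s2" "r2 < s2" for r s r2 s2
  proof -
    obtain c where c: "r2 < c" "c < s2" "poly (pderiv P) c = 0"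
      using poly_rolle[OF ivt(2) as(5) as(1,2)] by blast
    then obtain c' where "(c', c) \<in> M" using dR by force
    then have "r < c'" "c' < s" using c sameposD[OF as(3)] sameposD[OF as(4)] by blast+
    then show ?thesis by (rule less_trans)
  qed
  show om: "order_matching M'"
    unfolding order_matching_def
  proof (intro conjI fin ballI, clarify)
    fix x x' y y' assume xx: "(x, x') \<in> M'" and yy: "(y, y') \<in> M'"
    consider "(x, x') \<in> M" "(y, y') \<in> M" | "(x, x') \<in> M" "samepos M y y'" | "samepos M x x'" "(y, y') \<in> M"
      | "poly p x = 0" "poly P x' = 0" "samepos M x x'" "poly p y = 0" "poly P y' = 0" "samepos M y y'"
      using xx yy unfolding M'_def by blast
    then show "x < y \<longleftrightarrow> x' < y'"
    proof cases
      case 1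
      then show ?thesis using M unfolding order_matching_def by blast
    next
      case 2
      then show ?thesis using sameposD by blast
    next
      case 3
      then show ?thesis using sameposD by blast
    next
      case 4
      then show ?thesis using new_lt new_lt' by blast
    qed
  qed
  show rp: "x \<in> fst ` M'" if x: "poly p x = 0" for x
  proof (cases "x \<in> fst ` M")
    case False
    then obtain x' where "poly P x' = 0" "samepos M x x'"
      using root_transfer[OF M deg lc p0 sg ivt dr x] by blast
    then have "(x, x') \<in> M'" using x unfolding M'_def by blast
    then show ?thesis by force
  qed (auto simp: M'_def)
  show rP: "x \<in> snd ` M'" if x: "poly P x = 0" for x
  proof (cases "x \<in> snd ` M")
    case False
    have "\<exists>r'. poly p r' = 0 \<and> samepos (M\<inverse>) x r'"
    proof (rule root_transfer[OF order_matching_converse[OF M] deg[symmetric] sgneq_sym[OF lc] P0 _ ivt(2,1) _ x])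
      show "sgneq (poly P u) (poly p u')" if "(u, u') \<in> M\<inverse>" for u u' using that sg sgneq_sym by blast
      show "u \<in> fst ` (M\<inverse>)" if "poly (pderiv P) u = 0" for u using that dR conv by simp
      show "x \<notin> fst ` (M\<inverse>)" using False conv by simp
    qed
    then obtain x' where "poly p x' = 0" "samepos M x' x"
      using samepos_converse by fastforce
    then have "(x', x) \<in> M'" using x unfolding M'_def by blast
    then show ?thesis by force
  qed (auto simp: M'_def)
  have sg': "sgneq (poly p x) (poly P x')" if "(x, x') \<in> M'" for x x'
    using that sg unfolding M'_def by (auto simp: sgneq_00)
  fix y y' assume yy: "samepos M' y y'"
  show "sgneq (poly p y) (poly P y')"
  proof (cases "y \<in> fst ` M'")
    case True
    then obtain x' where x': "(y, x') \<in> M'" by auto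
    then have "y' = x'" using sameposD(3)[OF yy x'] by simp
    then show ?thesis using sg' x' by blast
  next
    case False
    obtain l l' where l: "l < y" "l' < y'" "sgneq (poly p l) (poly P l')"
      "\<And>x x'. (x, x') \<in> M' \<Longrightarrow> x < y \<Longrightarrow> x \<le> l \<and> x' \<le> l'"
      using bracket_below[OF om deg lc p0 sg' yy] by blast
    obtain u u' where u: "y < u" "y' < u'" "sgneq (poly p u) (poly P u')"
      "\<And>x x'. (x, x') \<in> M' \<Longrightarrow> y < x \<Longrightarrow> u \<le> x \<and> u' \<le> x'"
      using bracket_above[OF om deg lc p0 sg' yy] by blast
    have noM: "x \<notin> fst ` M'" if "l < x" "x < u" for x
    proof
      assume *: "x \<in> fst ` M'"
      then obtain x' where "(x, x') \<in> M'" by auto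
      then show False using that l(4)[of x x'] u(4)[of x x'] False *
        by (metis linorder_neqE_linordered_idom not_le)
    qed
    have noM': "x' \<notin> snd ` M'" if "l' < x'" "x' < u'" for x'
    proof
      assume "x' \<in> snd ` M'"
      then obtain x where x: "(x, x') \<in> M'" by auto
      then have "x \<noteq> y" using False by force
      then show False using that l(4)[OF x] u(4)[OF x]
        by (metis linorder_neqE_linordered_idom not_le)
    qed
    have py: "poly p x \<noteq> 0" if "l < x" "x < u" for x using that noM rp by blast
    have Py: "poly P x \<noteq> 0" if "l' < x" "x < u'" for x using that noM' rP by blast
    \<comment> \<open>Roots at both ends would force a root of the derivative, hence a matched
      point, inside the piece.\<close>
    have "poly p l \<noteq> 0 \<or> poly p u \<noteq> 0"
    proof (rule ccontr)
      assume "\<not> ?thesis"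
      then obtain c where c: "l < c" "c < u" "poly (pderiv p) c = 0"
        using poly_rolle[OF ivt(1), of l u p] l u by auto
      then have "c \<in> fst ` M'" using dr unfolding M'_def by blast
      then show False using noM c by blast
    qed
    then show ?thesis
    proof
      assume pl: "poly p l \<noteq> 0"
      then have Pl: "poly P l' \<noteq> 0" using sgneq_zero[OF l(3)] by simp
      have "0 < poly p l * poly p y"
        using l u pl py by (intro poly_no_root_same_sign[OF ivt(1)]) auto
      moreover have "0 < poly P l' * poly P y'"
        using l u Pl Py by (intro poly_no_root_same_sign[OF ivt(2)]) auto
      ultimately show ?thesis by (rule sgneq_pos_mult[OF l(3)])
    next
      assume pl: "poly p u \<noteq> 0"
      then have Pl: "poly P u' \<noteq> 0" using sgneq_zero[OF u(3)] by simp
      have "0 < poly p y * poly p u"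
        using l u pl py by (intro poly_no_root_same_sign[OF ivt(1)]) auto
      moreover have "0 < poly P y' * poly P u'"
        using l u Pl Py by (intro poly_no_root_same_sign[OF ivt(2)]) auto
      ultimately show ?thesis using sgneq_pos_mult[OF u(3)] by (simp add: mult.commute)
    qed
  qed
qed

section \<open>Quantifier elimination\<close>

text \<open>Integer coefficients give an expression a meaning in every field, so the same one can be
  evaluated on both sides.\<close>

datatype iexp = IC int | IV nat | IAdd iexp iexp | IMul iexp iexp

fun ieval :: "iexp \<Rightarrow> (nat \<Rightarrow> 'a::comm_ring_1) \<Rightarrow> 'a" where
  "ieval (IC k) e = of_int k"
| "ieval (IV i) e = e i"
| "ieval (IAdd s t) e = ieval s e + ieval t e"
| "ieval (IMul s t) e = ieval s e * ieval t e"

text \<open>A list of expressions stands for the univariate polynomial with these coefficients,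
  lowest degree first.\<close>

definition ipoly :: "(nat \<Rightarrow> 'a::comm_ring_1) \<Rightarrow> iexp list \<Rightarrow> 'a poly" where
  "ipoly e L = Poly (map (\<lambda>c. ieval c e) L)"

lemma coeff_ipoly: "coeff (ipoly e L) k = (if k < length L then ieval (L ! k) e else 0)"
  by (simp add: ipoly_def nth_default_def)

lemma ipoly_Nil: "ipoly e [] = 0"
  by (simp add: ipoly_def)

lemma ipoly_Cons: "ipoly e (c # L) = pCons (ieval c e) (ipoly e L)"
  by (simp add: ipoly_def)

definition ideriv :: "iexp list \<Rightarrow> iexp list" where
  "ideriv L = map (\<lambda>k. IMul (IC (int (Suc k))) (L ! Suc k)) [0..<length L - 1]"

lemma length_ideriv: "length (ideriv L) = length L - 1"
  by (simp add: ideriv_def)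

lemma ipoly_ideriv: "ipoly e (ideriv L) = pderiv (ipoly e L)"
  by (rule poly_eqI) (auto simp: coeff_ipoly coeff_pderiv ideriv_def)

lemma ipoly_butlast:
  assumes "L \<noteq> []" "ieval (last L) e = 0"
  shows "ipoly e (butlast L) = ipoly e L"
proof (rule poly_eqI)
  fix k
  show "coeff (ipoly e (butlast L)) k = coeff (ipoly e L) k"
    using assms by (cases "k = length L - 1") (auto simp: coeff_ipoly nth_butlast last_conv_nth)
qed

text \<open>One step of pseudo-division, lc(q) p - lc(p) X^k q. The top entry, which cancels
  identically, is left out, so the list gets shorter whatever the values of the parameters.\<close>

definition ired :: "iexp list \<Rightarrow> iexp list \<Rightarrow> iexp list" where
  "ired p q = map (\<lambda>k. IAdd (IMul (last q) (p ! k)) (IMul (IC (- 1)) (IMul (last p)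
     (if k + length q < length p then IC 0 else q ! (k + length q - length p))))) [0..<length p - 1]"

lemma length_ired: "length (ired p q) = length p - 1"
  by (simp add: ired_def)

lemma ipoly_ired:
  assumes "q \<noteq> []" "length q \<le> length p"
  shows "ipoly e (ired p q) = smult (ieval (last q) e) (ipoly e p) -
     smult (ieval (last p) e) (monom 1 (length p - length q) * ipoly e q)"
proof (rule poly_eqI)
  fix k
  have p: "p \<noteq> []" using assms by auto
  consider "k < length p - 1" | "k = length p - 1" | "k \<ge> length p" by linarith
  then show "coeff (ipoly e (ired p q)) k = coeff (smult (ieval (last q) e) (ipoly e p) -
     smult (ieval (last p) e) (monom 1 (length p - length q) * ipoly e q)) k"
  proof cases
    case 1
    have "k + length q - length p = k - (length p - length q)" using assms(2) by simp
    then show ?thesis using 1 assms p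
      by (auto simp: coeff_ipoly ired_def coeff_monom_mult)
  next
    case 2
    then have "k - (length p - length q) = length q - 1" using assms p by (cases p; cases q) auto
    moreover have "k < length p" "length p - length q \<le> k" using 2 assms p by (cases p; cases q; auto)+
    ultimately show ?thesis using 2 assms p
      by (auto simp: coeff_ipoly ired_def coeff_monom_mult last_conv_nth)
  next
    case 3
    then show ?thesis using assms p
      by (auto simp: coeff_ipoly ired_def coeff_monom_mult)
  qed
qed

function iprem :: "iexp list \<Rightarrow> iexp list \<Rightarrow> iexp list" where
  "iprem p q = (if q = [] \<or> length p < length q then p else iprem (ired p q) q)"
  by auto
termination
proof (relation "Wellfounded.measure (length \<circ> fst)")
  fix p q :: "iexp list"
  assume "\<not> (q = [] \<or> length p < length q)"
  then have "0 < length p" by (cases p) auto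
  then show "((ired p q, q), p, q) \<in> Wellfounded.measure (length \<circ> fst)" by (simp add: length_ired)
qed auto

declare iprem.simps [simp del]

lemma length_iprem: "q \<noteq> [] \<Longrightarrow> length (iprem p q) < length q"
proof (induction p q rule: iprem.induct)
  case (1 p q)
  then show ?case by (subst iprem.simps) auto
qed

text \<open>At a root of \<open>q\<close> each division step just multiplies the value of
  \<open>p\<close> by the leading coefficient of \<open>q\<close>, whose sign is known and
  nonzero.\<close>

lemma sgneq_iprem:
  fixes e :: "nat \<Rightarrow> 'a::linordered_field" and e' :: "nat \<Rightarrow> 'b::linordered_field"
  assumes lc: "sgneq (ieval (last q) e) (ieval (last q) e')" "ieval (last q) e \<noteq> 0"
    and r: "poly (ipoly e q) x = 0" "poly (ipoly e' q) x' = 0"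
    and "sgneq (poly (ipoly e (iprem p q)) x) (poly (ipoly e' (iprem p q)) x')"
  shows "sgneq (poly (ipoly e p) x) (poly (ipoly e' p) x')"
  using assms
proof (induction p q rule: iprem.induct)
  case (1 p q)
  show ?case
  proof (cases "q = [] \<or> length p < length q")
    case True
    then show ?thesis using "1.prems" by (subst (asm) (1 2) iprem.simps) simp
  next
    case False
    have eq: "poly (ipoly e (ired p q)) x = ieval (last q) e * poly (ipoly e p) x"
      "poly (ipoly e' (ired p q)) x' = ieval (last q) e' * poly (ipoly e' p) x'"
      using False "1.prems"(3,4) by (auto simp: ipoly_ired)
    have "sgneq (poly (ipoly e (ired p q)) x) (poly (ipoly e' (ired p q)) x')"
      using "1.IH"[OF False "1.prems"(1-4)] "1.prems"(5) False by (simp add: iprem.simps[of p q])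
    then show ?thesis unfolding eq by (rule sgneq_cancel[OF "1.prems"(1,2)])
  qed
qed

text \<open>Lists are treated from the end to the front. When \<open>p\<close> is reached, its
  derivative supplies the separating points, \<open>butlast p\<close> replaces it if the leading
  coefficient is zero, and the remainders give its signs at the roots of the polynomials already
  treated.\<close>

fun deriv_rem_closed :: "iexp list list \<Rightarrow> bool" where
  "deriv_rem_closed [] = True"
| "deriv_rem_closed (p # L) \<longleftrightarrow> deriv_rem_closed L \<and> (2 \<le> length p \<longrightarrow> ideriv p \<in> set L \<and> butlast p \<in> set L \<and>
     (\<forall>q\<in>set L. 2 \<le> length q \<longrightarrow> iprem p q \<in> set L))"

text \<open>The last clause records for every matched point a polynomial that vanishes there and has
  a nonzero leading coefficient; pseudo-remainders by it give the sign of a new polynomial at this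
  point.\<close>

definition diagram_matching ::
  "(nat \<Rightarrow> 'a::linordered_field) \<Rightarrow> (nat \<Rightarrow> 'b::linordered_field) \<Rightarrow> iexp list set \<Rightarrow> ('a \<times> 'b) set \<Rightarrow> bool" where
  "diagram_matching e e' S M \<longleftrightarrow> order_matching M \<and>
    (\<forall>p\<in>S. \<forall>y y'. samepos M y y' \<longrightarrow> sgneq (poly (ipoly e p) y) (poly (ipoly e' p) y')) \<and>
    (\<forall>p\<in>S. ipoly e p \<noteq> 0 \<longrightarrow> (\<forall>x. poly (ipoly e p) x = 0 \<longrightarrow> x \<in> fst ` M)) \<and>
    (\<forall>p\<in>S. ipoly e' p \<noteq> 0 \<longrightarrow> (\<forall>x. poly (ipoly e' p) x = 0 \<longrightarrow> x \<in> snd ` M)) \<and>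
    (\<forall>(x, x')\<in>M. \<exists>q\<in>S. 2 \<le> length q \<and> ieval (last q) e \<noteq> 0 \<and>
        poly (ipoly e q) x = 0 \<and> poly (ipoly e' q) x' = 0)"

lemma samepos_mono: "M \<subseteq> M' \<Longrightarrow> samepos M' y y' \<Longrightarrow> samepos M y y'"
  unfolding samepos_def by blast

lemma samepos_self: "order_matching M \<Longrightarrow> (x, x') \<in> M \<Longrightarrow> samepos M x x'"
  unfolding samepos_def order_matching_def by fastforce

lemma diagram_matching_insert:
  assumes "diagram_matching e e' S M"
    and "\<And>y y'. samepos M y y' \<Longrightarrow> sgneq (poly (ipoly e p) y) (poly (ipoly e' p) y')"
    and "\<And>x. ipoly e p \<noteq> 0 \<Longrightarrow> poly (ipoly e p) x = 0 \<Longrightarrow> x \<in> fst ` M"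
    and "\<And>x. ipoly e' p \<noteq> 0 \<Longrightarrow> poly (ipoly e' p) x = 0 \<Longrightarrow> x \<in> snd ` M"
  shows "diagram_matching e e' (insert p S) M"
  using assms unfolding diagram_matching_def by (auto; fastforce)

lemma degree_ipoly:
  assumes "p \<noteq> []" "ieval (last p) e \<noteq> 0"
  shows "degree (ipoly e p) = length p - 1" "lead_coeff (ipoly e p) = ieval (last p) e"
proof -
  have c: "coeff (ipoly e p) (length p - 1) = ieval (last p) e"
    using assms(1) by (simp add: coeff_ipoly last_conv_nth)
  have "degree (ipoly e p) \<le> length p - 1"
    by (rule degree_le) (auto simp: coeff_ipoly)
  moreover have "length p - 1 \<le> degree (ipoly e p)"
    using c assms(2) by (intro le_degree) simp
  ultimately show "degree (ipoly e p) = length p - 1" by simp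
  then show "lead_coeff (ipoly e p) = ieval (last p) e" using c by simp
qed

text \<open>The sign diagram method of Cohen and Hoermander, run on both fields at once: only the
  signs of the leading entries decide which case occurs, so both sides always take the same
  branch.\<close>

lemma closed_diagram_matching:
  fixes e :: "nat \<Rightarrow> 'a::linordered_field" and e' :: "nat \<Rightarrow> 'b::linordered_field"
  assumes ivt: "poly_ivt TYPE('a)" "poly_ivt TYPE('b)"
    and "deriv_rem_closed L" "\<And>p. p \<in> set L \<Longrightarrow> p \<noteq> [] \<Longrightarrow> sgneq (ieval (last p) e) (ieval (last p) e')"
  shows "\<exists>M. diagram_matching e e' (set L) M"
  using assms(3,4)
proof (induction L)
  case Nil
  show ?case by (intro exI[of _ "{}"]) (simp add: diagram_matching_def order_matching_def)
next
  case (Cons p L)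
  then obtain M where M: "diagram_matching e e' (set L) M" by auto
  note dm = M[unfolded diagram_matching_def]
  have sgL: "sgneq (poly (ipoly e q) y) (poly (ipoly e' q) y')" if "q \<in> set L" "samepos M y y'" for q y y'
    using dm that by blast
  have rootsL: "ipoly e q \<noteq> 0 \<Longrightarrow> poly (ipoly e q) x = 0 \<Longrightarrow> x \<in> fst ` M"
    and rootsL': "ipoly e' q \<noteq> 0 \<Longrightarrow> poly (ipoly e' q) x' = 0 \<Longrightarrow> x' \<in> snd ` M" if "q \<in> set L" for q x x'
    using dm that by blast+
  show ?case
  proof (cases "p = []")
    case True
    have "diagram_matching e e' (insert p (set L)) M"
      by (rule diagram_matching_insert[OF M]) (auto simp: True ipoly_Nil sgneq_00)
    then show ?thesis by auto
  next
    case False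
    then have lc: "sgneq (ieval (last p) e) (ieval (last p) e')" using Cons.prems(2)[of p] by simp
    show ?thesis
    proof (cases "length p = 1")
      case True
      then obtain c where c: "p = [c]" by (metis length_0_conv length_Suc_conv One_nat_def)
      have "diagram_matching e e' (insert p (set L)) M"
        using lc by (intro diagram_matching_insert[OF M]) (auto simp: c ipoly_Cons ipoly_Nil)
      then show ?thesis by auto
    next
      case False
      then have len: "2 \<le> length p" using \<open>p \<noteq> []\<close> by (cases p rule: list.exhaust) (auto simp: Suc_le_eq)
      then have cl: "ideriv p \<in> set L" "butlast p \<in> set L"
        "\<And>q. q \<in> set L \<Longrightarrow> 2 \<le> length q \<Longrightarrow> iprem p q \<in> set L"
        using Cons.prems(1) by auto
      show ?thesis
      proof (cases "ieval (last p) e = 0")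
        case True
        have eq: "ipoly e p = ipoly e (butlast p)" "ipoly e' p = ipoly e' (butlast p)"
          using ipoly_butlast[OF \<open>p \<noteq> []\<close>, of e] ipoly_butlast[OF \<open>p \<noteq> []\<close>, of e'] True sgneq_zero[OF lc]
          by auto
        have "diagram_matching e e' (insert p (set L)) M"
          using sgL[OF cl(2)] rootsL[OF cl(2)] rootsL'[OF cl(2)]
          by (intro diagram_matching_insert[OF M]) (auto simp: eq)
        then show ?thesis by auto
      next
        case False
        then have False': "ieval (last p) e' \<noteq> 0" using sgneq_zero[OF lc] by simp
        note deg = degree_ipoly[OF \<open>p \<noteq> []\<close> False] degree_ipoly[OF \<open>p \<noteq> []\<close> False']
        have dpos: "degree (ipoly e p) > 0" "degree (ipoly e' p) > 0" using deg len by auto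
        then have p0: "ipoly e p \<noteq> 0" by auto
        have dn: "pderiv (ipoly e p) \<noteq> 0" "pderiv (ipoly e' p) \<noteq> 0"
          using dpos by (auto simp: pderiv_eq_0_iff)
        have om: "order_matching M" using dm by blast
        have sg: "sgneq (poly (ipoly e p) x) (poly (ipoly e' p) x')" if xx: "(x, x') \<in> M" for x x'
        proof -
          obtain q where q: "q \<in> set L" "2 \<le> length q" "ieval (last q) e \<noteq> 0"
            "poly (ipoly e q) x = 0" "poly (ipoly e' q) x' = 0"
            using dm xx by blast
          have "q \<noteq> []" using q by auto
          then have "sgneq (ieval (last q) e) (ieval (last q) e')" using q(1) Cons.prems(2)[of q] by simp
          from sgneq_iprem[OF this q(3,4,5) sgL[OF cl(3)[OF q(1,2)] samepos_self[OF om xx]]]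
          show ?thesis .
        qed
        have dr: "x \<in> fst ` M" if "poly (pderiv (ipoly e p)) x = 0" for x
          using rootsL[OF cl(1)] dn that by (simp add: ipoly_ideriv)
        have dR: "x \<in> snd ` M" if "poly (pderiv (ipoly e' p)) x = 0" for x
          using rootsL'[OF cl(1)] dn that by (simp add: ipoly_ideriv)
        define M' where "M' = M \<union> {(r, r'). poly (ipoly e p) r = 0 \<and> poly (ipoly e' p) r' = 0 \<and> samepos M r r'}"
        have degeq: "degree (ipoly e p) = degree (ipoly e' p)" using deg by simp
        have lceq: "sgneq (lead_coeff (ipoly e p)) (lead_coeff (ipoly e' p))" using deg lc by simp
        note ext = extend_matching[OF ivt om degeq lceq p0 sg dr dR, folded M'_def]
        have sub: "M \<subseteq> M'" by (auto simp: M'_def)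
        have "diagram_matching e e' (set (p # L)) M'"
          unfolding diagram_matching_def
        proof (intro conjI ballI allI impI)
          show "order_matching M'" by (rule ext(1))
          show "sgneq (poly (ipoly e q) y) (poly (ipoly e' q) y')" if "q \<in> set (p # L)" "samepos M' y y'" for q y y'
            using that ext(4) sgL samepos_mono[OF sub] by auto
          show "x \<in> fst ` M'" if "q \<in> set (p # L)" "ipoly e q \<noteq> 0" "poly (ipoly e q) x = 0" for q x
            using that ext(2) rootsL[of q x] image_mono[OF sub, of fst] by auto
          show "x \<in> snd ` M'" if "q \<in> set (p # L)" "ipoly e' q \<noteq> 0" "poly (ipoly e' q) x = 0" for q x
            using that ext(3) rootsL'[of q x] image_mono[OF sub, of snd] by auto
          show "case z of (x, x') \<Rightarrow> \<exists>q\<in>set (p # L). 2 \<le> length q \<and> ieval (last q) e \<noteq> 0 \<and>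
              poly (ipoly e q) x = 0 \<and> poly (ipoly e' q) x' = 0" if "z \<in> M'" for z
          proof (cases "z \<in> M")
            case True
            then show ?thesis using dm by fastforce
          next
            case no: False
            then show ?thesis using that len False unfolding M'_def by auto
          qed
        qed
        then show ?thesis by blast
      qed
    qed
  qed
qed

definition closed_from :: "nat \<Rightarrow> iexp list set \<Rightarrow> bool" where
  "closed_from l S \<longleftrightarrow> (\<forall>p\<in>S. max l 2 \<le> length p \<longrightarrow> ideriv p \<in> S \<and> butlast p \<in> S) \<and>
    (\<forall>p\<in>S. \<forall>q\<in>S. max l 2 \<le> length q \<longrightarrow> length q \<le> length p \<longrightarrow> iprem p q \<in> S)"

text \<open>Lowering the threshold to \<open>l\<close> adds only lists shorter than
  \<open>l\<close>: derivatives, truncations and remainders by lists of length \<open>l\<close>. The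
  longer lists therefore stay closed, and the set stays finite.\<close>

lemma closed_from_0_exists:
  "finite S \<Longrightarrow> closed_from l S \<Longrightarrow> \<exists>S'. finite S' \<and> S \<subseteq> S' \<and> closed_from 0 S'"
proof (induction l arbitrary: S)
  case 0
  then show ?case by blast
next
  case (Suc l)
  define N where "N = {iprem p q | p q. p \<in> S \<and> q \<in> S \<and> length q = l \<and> 2 \<le> l} \<union>
    {ideriv p | p. p \<in> S \<and> length p = l \<and> 2 \<le> l} \<union> {butlast p | p. p \<in> S \<and> length p = l \<and> 2 \<le> l}"
  have "N \<subseteq> (\<lambda>(p, q). iprem p q) ` (S \<times> S) \<union> ideriv ` S \<union> butlast ` S" unfolding N_def by auto
  then have fin: "finite N" by (rule finite_subset) (use Suc.prems in auto)
  have short: "length p < l" if "p \<in> N" for p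
  proof -
    have "length (iprem p q) < l" if "length q = l" "2 \<le> l" for p q
      using length_iprem[of q p] that by (cases q) auto
    then show ?thesis using that unfolding N_def by (auto simp: length_ideriv)
  qed
  have "closed_from l (S \<union> N)"
    unfolding closed_from_def
  proof (intro conjI ballI impI)
    fix p assume p: "p \<in> S \<union> N" "max l 2 \<le> length p"
    then have pS: "p \<in> S" using short[of p] by auto
    show "ideriv p \<in> S \<union> N" "butlast p \<in> S \<union> N"
      using pS p(2) Suc.prems(2) unfolding closed_from_def N_def
      by (cases "length p = l"; auto simp: max_def split: if_splits)+
  next
    fix p q assume pq: "p \<in> S \<union> N" "q \<in> S \<union> N" "max l 2 \<le> length q" "length q \<le> length p"
    then have S: "p \<in> S" "q \<in> S" using short[of p] short[of q] by auto
    show "iprem p q \<in> S \<union> N"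
    proof (cases "length q = l")
      case True
      then show ?thesis using S pq unfolding N_def by auto
    next
      case False
      then have "max (Suc l) 2 \<le> length q" using pq by auto
      then show ?thesis using S pq Suc.prems(2) unfolding closed_from_def by blast
    qed
  qed
  then obtain S' where "finite S'" "S \<union> N \<subseteq> S'" "closed_from 0 S'"
    using Suc.IH[of "S \<union> N"] Suc.prems(1) fin by auto
  then show ?case by auto
qed

text \<open>A longest list goes to the front. What is derived from it is strictly shorter; for the
  remainder by \<open>q\<close>, it is shorter than \<open>q\<close>, which is no longer than
  \<open>p\<close>. Closure of \<open>T\<close> under shorter elements of \<open>S\<close> survives
  the removal of \<open>p\<close>.\<close>

lemma lower_set_closed_list:
  assumes cl: "closed_from 0 S"
  shows "finite T \<Longrightarrow> T \<subseteq> S \<Longrightarrow> (\<And>p q. p \<in> T \<Longrightarrow> q \<in> S \<Longrightarrow> length q < length p \<Longrightarrow> q \<in> T) \<Longrightarrow>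
    \<exists>L. set L = T \<and> deriv_rem_closed L"
proof (induction "card T" arbitrary: T)
  case 0
  then show ?case by (intro exI[of _ "[]"]) auto
next
  case (Suc k)
  have "T \<noteq> {}" using Suc.hyps by auto
  then obtain p where p: "p \<in> T" "\<And>q. q \<in> T \<Longrightarrow> length q \<le> length p"
    using Max_in[of "length ` T"] Max_ge[of "length ` T"] Suc.prems(1)
    by (metis (no_types, lifting) finite_imageI image_iff image_is_empty)
  have "\<exists>L. set L = T - {p} \<and> deriv_rem_closed L"
  proof (rule Suc.hyps(1))
    show "k = card (T - {p})" "finite (T - {p})" "T - {p} \<subseteq> S" using Suc p by auto
    show "q \<in> T - {p}" if "p' \<in> T - {p}" "q \<in> S" "length q < length p'" for p' q
      using that Suc.prems(3)[of p' q] p(2)[of p'] by auto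
  qed
  then obtain L where L: "set L = T - {p}" "deriv_rem_closed L" by blast
  have "deriv_rem_closed (p # L)"
  proof -
    have "ideriv p \<in> T - {p}" "butlast p \<in> T - {p}" if "2 \<le> length p"
    proof -
      have "ideriv p \<in> S" "butlast p \<in> S" using cl p(1) Suc.prems(2) that unfolding closed_from_def by auto
      moreover have "length (ideriv p) < length p" "length (butlast p) < length p"
        using that by (auto simp: length_ideriv)
      ultimately show "ideriv p \<in> T - {p}" "butlast p \<in> T - {p}"
        using Suc.prems(3)[OF p(1)] by (metis DiffI less_irrefl singletonD)+
    qed
    moreover have "iprem p q \<in> T - {p}" if "q \<in> T - {p}" "2 \<le> length q" for q
    proof -
      have "length q \<le> length p" using p that by auto
      moreover have "iprem p q \<in> S"
        using cl p(1) Suc.prems(2) that calculation unfolding closed_from_def by auto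
      moreover have "length (iprem p q) < length q" using that by (intro length_iprem) auto
      ultimately have "length (iprem p q) < length p" by simp
      then show ?thesis using Suc.prems(3)[OF p(1) \<open>iprem p q \<in> S\<close>] by auto
    qed
    ultimately show ?thesis using L by simp
  qed
  moreover have "set (p # L) = T" using L p(1) by auto
  ultimately show ?case by blast
qed

lemma closed_superset_exists:
  assumes "finite S"
  shows "\<exists>L. S \<subseteq> set L \<and> deriv_rem_closed L"
proof -
  have "finite (length ` S)" using assms by simp
  then obtain m where "\<And>p. p \<in> S \<Longrightarrow> length p < m"
    by (metis finite_nat_set_iff_bounded image_eqI)
  then have "closed_from m S" unfolding closed_from_def by fastforce
  then obtain S' where "finite S'" "S \<subseteq> S'" "closed_from 0 S'"
    using closed_from_0_exists assms by blast
  then show ?thesis using lower_set_closed_list[of S' S'] by auto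
qed

section \<open>Expressions as polynomials in one of their variables\<close>

fun ipadd :: "iexp list \<Rightarrow> iexp list \<Rightarrow> iexp list" where
  "ipadd [] ys = ys"
| "ipadd xs [] = xs"
| "ipadd (x # xs) (y # ys) = IAdd x y # ipadd xs ys"

fun ipmul :: "iexp list \<Rightarrow> iexp list \<Rightarrow> iexp list" where
  "ipmul [] ys = []"
| "ipmul (x # xs) ys = ipadd (map (IMul x) ys) (IC 0 # ipmul xs ys)"

lemma ipoly_ipadd: "ipoly e (ipadd xs ys) = ipoly e xs + ipoly e ys"
  by (induction xs ys rule: ipadd.induct) (auto simp: ipoly_Nil ipoly_Cons)

lemma ipoly_map_IMul: "ipoly e (map (IMul x) ys) = smult (ieval x e) (ipoly e ys)"
  by (induction ys) (auto simp: ipoly_Nil ipoly_Cons)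

lemma ipoly_ipmul: "ipoly e (ipmul xs ys) = ipoly e xs * ipoly e ys"
  by (induction xs ys rule: ipmul.induct) (auto simp: ipoly_Nil ipoly_Cons ipoly_ipadd ipoly_map_IMul)

text \<open>View an expression as a polynomial in variable 0; the other variables move down by one.\<close>

fun as_poly :: "iexp \<Rightarrow> iexp list" where
  "as_poly (IC k) = [IC k]"
| "as_poly (IV 0) = [IC 0, IC 1]"
| "as_poly (IV (Suc i)) = [IV i]"
| "as_poly (IAdd s t) = ipadd (as_poly s) (as_poly t)"
| "as_poly (IMul s t) = ipmul (as_poly s) (as_poly t)"

lemma poly_as_poly: "poly (ipoly e (as_poly t)) y = ieval t (case_nat y e)"
  by (induction t rule: as_poly.induct)
    (auto simp: ipoly_Nil ipoly_Cons ipoly_ipadd ipoly_ipmul)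

definition agree :: "iexp set \<Rightarrow> (nat \<Rightarrow> 'a::linordered_field) \<Rightarrow> (nat \<Rightarrow> 'b::linordered_field) \<Rightarrow> bool" where
  "agree Q e e' \<longleftrightarrow> (\<forall>q\<in>Q. sgneq (ieval q e) (ieval q e'))"

text \<open>The truth values of \<open>S\<close> and \<open>S'\<close> depend in the same way on the signs
  of finitely many polynomials with integer coefficients.\<close>

definition det2 :: "((nat \<Rightarrow> 'a::linordered_field) \<Rightarrow> bool) \<Rightarrow> ((nat \<Rightarrow> 'b::linordered_field) \<Rightarrow> bool) \<Rightarrow> bool" where
  "det2 S S' \<longleftrightarrow> (\<exists>Q. finite Q \<and> (\<forall>e e'. agree Q e e' \<longrightarrow> S e = S' e'))"

lemma det2_not: "det2 S S' \<Longrightarrow> det2 (\<lambda>e. \<not> S e) (\<lambda>e. \<not> S' e)"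
  unfolding det2_def by blast

lemma agree_Un: "agree (Q \<union> R) e e' \<longleftrightarrow> agree Q e e' \<and> agree R e e'"
  unfolding agree_def by blast

lemma det2_conj:
  assumes "det2 S S'" "det2 T T'"
  shows "det2 (\<lambda>e. S e \<and> T e) (\<lambda>e. S' e \<and> T' e)"
proof -
  obtain Q R where "finite Q" "\<forall>e e'. agree Q e e' \<longrightarrow> S e = S' e'"
    "finite R" "\<forall>e e'. agree R e e' \<longrightarrow> T e = T' e'"
    using assms unfolding det2_def by blast
  then show ?thesis unfolding det2_def by (intro exI[of _ "Q \<union> R"]) (auto simp: agree_Un)
qed

lemma det2_imp: "det2 S S' \<Longrightarrow> det2 T T' \<Longrightarrow> det2 (\<lambda>e. S e \<longrightarrow> T e) (\<lambda>e. S' e \<longrightarrow> T' e)"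
  using det2_not[OF det2_conj[OF _ det2_not], of S S' T T'] by simp

lemma det2_disj: "det2 S S' \<Longrightarrow> det2 T T' \<Longrightarrow> det2 (\<lambda>e. S e \<or> T e) (\<lambda>e. S' e \<or> T' e)"
  using det2_imp[OF det2_not, of S S' T T'] by (simp add: disj_imp)

text \<open>The last entries of a closed list are expressions in the remaining variables, and their
  signs fix the sign diagram. Points in corresponding pieces give all of \<open>Q\<close> equal
  signs, and each \<open>y\<close> has a partner on the other side.\<close>

lemma det2_ex_head:
  fixes S :: "(nat \<Rightarrow> 'a::linordered_field) \<Rightarrow> bool" and S' :: "(nat \<Rightarrow> 'b::linordered_field) \<Rightarrow> bool"
  assumes ivt: "poly_ivt TYPE('a)" "poly_ivt TYPE('b)" and S: "det2 S S'"
  shows "det2 (\<lambda>e. \<exists>y. S (case_nat y e)) (\<lambda>e. \<exists>y. S' (case_nat y e))"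
proof -
  obtain Q where Q: "finite Q" "\<And>e e'. agree Q e e' \<Longrightarrow> S e = S' e'"
    using S unfolding det2_def by blast
  obtain L where L: "as_poly ` Q \<subseteq> set L" "deriv_rem_closed L"
    using closed_superset_exists[of "as_poly ` Q"] Q(1) by auto
  define R where "R = last ` (set L)"
  have "(\<exists>y. S (case_nat y e)) = (\<exists>y. S' (case_nat y e'))" if R: "agree R e e'" for e e'
  proof -
    have sg: "sgneq (ieval (last p) e) (ieval (last p) e')" if "p \<in> set L" for p
      using R that unfolding agree_def R_def by blast
    obtain M where M: "diagram_matching e e' (set L) M"
      using closed_diagram_matching[OF ivt L(2) sg] by blast
    have eq: "S (case_nat y e) = S' (case_nat y' e')" if "samepos M y y'" for y y'
    proof (rule Q(2), unfold agree_def, intro ballI)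
      fix q assume "q \<in> Q"
      then have "as_poly q \<in> set L" using L by auto
      then show "sgneq (ieval q (case_nat y e)) (ieval q (case_nat y' e'))"
        using M that unfolding diagram_matching_def poly_as_poly[symmetric] by blast
    qed
    have om: "order_matching M" using M by (simp add: diagram_matching_def)
    have "\<exists>y'. samepos M y y'" for y using samepos_exists[OF om] .
    moreover have "\<exists>y. samepos M y y'" for y'
      using samepos_exists[OF order_matching_converse[OF om], of y'] samepos_converse by fastforce
    ultimately show ?thesis using eq by metis
  qed
  moreover have "finite R" by (simp add: R_def)
  ultimately show ?thesis unfolding det2_def by blast
qed

section \<open>Polynomial functions and elimination by counting\<close>

definition mon :: "nat \<Rightarrow> (nat \<Rightarrow> nat) \<Rightarrow> (nat \<Rightarrow> real) \<Rightarrow> real" where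
  "mon m \<alpha> z = (\<Prod>i<m. z i ^ \<alpha> i)"

definition expo :: "nat \<Rightarrow> nat \<Rightarrow> (nat \<Rightarrow> nat) set" where
  "expo m T = {\<alpha>. (\<forall>i\<ge>m. \<alpha> i = 0) \<and> (\<Sum>i<m. \<alpha> i) \<le> T}"

lemma expo_le: "\<alpha> \<in> expo m T \<Longrightarrow> \<alpha> i \<le> T"
  using member_le_sum[of i "{..<m}" \<alpha>] unfolding expo_def by (cases "i < m") auto

lemma finite_expo: "finite (expo m T)"
proof -
  have "expo m T \<subseteq> {f. \<forall>i. (i \<in> {..<m} \<longrightarrow> f i \<in> {..T}) \<and> (i \<notin> {..<m} \<longrightarrow> f i = 0)}"
    using expo_le by (auto simp: expo_def)
  then show ?thesis by (rule finite_subset) (rule finite_set_of_finite_funs; simp)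
qed

text \<open>The identity has to hold on \<open>C\<close> only. With \<open>C\<close> the set of
  critical points this expresses reduction modulo the critical equations without speaking of
  ideals.\<close>

definition lcomb :: "nat \<Rightarrow> (nat \<Rightarrow> nat) set \<Rightarrow> (nat \<Rightarrow> real) set \<Rightarrow> ((nat \<Rightarrow> real) \<Rightarrow> real) \<Rightarrow> bool" where
  "lcomb m B C p \<longleftrightarrow> (\<exists>c. \<forall>z\<in>C. p z = (\<Sum>\<alpha>\<in>B. c \<alpha> * mon m \<alpha> z))"

lemma lcomb_zero: "lcomb m B C (\<lambda>z. 0)"
  unfolding lcomb_def by (intro exI[of _ "\<lambda>_. 0"]) simp

lemma lcomb_add:
  assumes "lcomb m B C p" "lcomb m B C q"
  shows "lcomb m B C (\<lambda>z. p z + q z)"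
proof -
  obtain c d where "\<forall>z\<in>C. p z = (\<Sum>\<alpha>\<in>B. c \<alpha> * mon m \<alpha> z)" "\<forall>z\<in>C. q z = (\<Sum>\<alpha>\<in>B. d \<alpha> * mon m \<alpha> z)"
    using assms unfolding lcomb_def by blast
  then show ?thesis unfolding lcomb_def
    by (intro exI[of _ "\<lambda>\<alpha>. c \<alpha> + d \<alpha>"]) (simp add: algebra_simps sum.distrib)
qed

lemma lcomb_scale:
  assumes "lcomb m B C p"
  shows "lcomb m B C (\<lambda>z. k * p z)"
proof -
  obtain c where "\<forall>z\<in>C. p z = (\<Sum>\<alpha>\<in>B. c \<alpha> * mon m \<alpha> z)" using assms unfolding lcomb_def by blast
  then show ?thesis unfolding lcomb_def
    by (intro exI[of _ "\<lambda>\<alpha>. k * c \<alpha>"]) (simp add: algebra_simps sum_distrib_left)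
qed

lemma lcomb_sum: "(\<And>i. i \<in> I \<Longrightarrow> lcomb m B C (f i)) \<Longrightarrow> lcomb m B C (\<lambda>z. \<Sum>i\<in>I. f i z)"
  by (induction I rule: infinite_finite_induct) (auto intro: lcomb_zero lcomb_add)

lemma lcomb_mon: "finite B \<Longrightarrow> \<alpha> \<in> B \<Longrightarrow> lcomb m B C (mon m \<alpha>)"
  unfolding lcomb_def by (intro exI[of _ "\<lambda>\<beta>. if \<beta> = \<alpha> then 1 else 0"]) (simp add: if_distrib[of "\<lambda>x. x * _"] cong: if_cong)

lemma lcomb_mono:
  assumes "lcomb m B C p" "B \<subseteq> B'" "finite B'"
  shows "lcomb m B' C p"
proof -
  obtain c where c: "\<forall>z\<in>C. p z = (\<Sum>\<alpha>\<in>B. c \<alpha> * mon m \<alpha> z)" using assms unfolding lcomb_def by blast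
  have "(\<Sum>\<alpha>\<in>B. c \<alpha> * mon m \<alpha> z) = (\<Sum>\<alpha>\<in>B'. (if \<alpha> \<in> B then c \<alpha> else 0) * mon m \<alpha> z)" for z
    using assms by (intro sum.mono_neutral_cong_left) auto
  then show ?thesis using c unfolding lcomb_def by (intro exI[of _ "\<lambda>\<alpha>. if \<alpha> \<in> B then c \<alpha> else 0"]) simp
qed

lemma lcomb_cong: "(\<And>z. z \<in> C \<Longrightarrow> p z = q z) \<Longrightarrow> lcomb m B C q \<Longrightarrow> lcomb m B C p"
  unfolding lcomb_def by metis

definition polyf :: "nat \<Rightarrow> nat \<Rightarrow> ((nat \<Rightarrow> real) \<Rightarrow> real) \<Rightarrow> bool" where
  "polyf m T p \<longleftrightarrow> lcomb m (expo m T) UNIV p"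

lemma polyf_mono: "polyf m S p \<Longrightarrow> S \<le> T \<Longrightarrow> polyf m T p"
  unfolding polyf_def by (rule lcomb_mono[OF _ _ finite_expo]) (auto simp: expo_def)

lemma polyf_add: "polyf m T p \<Longrightarrow> polyf m T q \<Longrightarrow> polyf m T (\<lambda>z. p z + q z)"
  unfolding polyf_def by (rule lcomb_add)

lemma polyf_scale: "polyf m T p \<Longrightarrow> polyf m T (\<lambda>z. k * p z)"
  unfolding polyf_def by (rule lcomb_scale)

lemma polyf_sum: "(\<And>i. i \<in> I \<Longrightarrow> polyf m T (f i)) \<Longrightarrow> polyf m T (\<lambda>z. \<Sum>i\<in>I. f i z)"
  unfolding polyf_def by (rule lcomb_sum)

lemma polyf_mon: "\<alpha> \<in> expo m T \<Longrightarrow> polyf m T (mon m \<alpha>)"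
  unfolding polyf_def by (rule lcomb_mon[OF finite_expo])

lemma polyf_const: "polyf m T (\<lambda>z. k)"
proof -
  have "polyf m T (mon m (\<lambda>_. 0))" by (rule polyf_mon) (simp add: expo_def)
  from polyf_scale[OF this, of k] show ?thesis by (simp add: mon_def)
qed

lemma polyf_var: "i < m \<Longrightarrow> polyf m 1 (\<lambda>z. z i)"
proof -
  assume i: "i < m"
  have "polyf m 1 (mon m (\<lambda>j. if j = i then 1 else 0))"
    using i by (intro polyf_mon) (auto simp: expo_def)
  moreover have "mon m (\<lambda>j. if j = i then 1 else 0) = (\<lambda>z. z i)"
    using i by (simp add: mon_def fun_eq_iff if_distrib[of "\<lambda>k. _ ^ k"] cong: if_cong)
  ultimately show ?thesis by simp
qed

lemma mon_mult: "mon m \<alpha> z * mon m \<beta> z = mon m (\<lambda>i. \<alpha> i + \<beta> i) z"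
  by (simp add: mon_def power_add prod.distrib)

lemma polyf_mult:
  assumes "polyf m S p" "polyf m T q"
  shows "polyf m (S + T) (\<lambda>z. p z * q z)"
proof -
  obtain c d where c: "\<And>z. p z = (\<Sum>\<alpha>\<in>expo m S. c \<alpha> * mon m \<alpha> z)"
    and d: "\<And>z. q z = (\<Sum>\<alpha>\<in>expo m T. d \<alpha> * mon m \<alpha> z)"
    using assms unfolding polyf_def lcomb_def by blast
  have "p z * q z = (\<Sum>\<alpha>\<in>expo m S. \<Sum>\<beta>\<in>expo m T. (c \<alpha> * d \<beta>) * mon m (\<lambda>i. \<alpha> i + \<beta> i) z)" for z
    unfolding c d sum_product by (intro sum.cong refl) (simp add: mon_mult[symmetric])
  moreover have "polyf m (S + T) (\<lambda>z. \<Sum>\<alpha>\<in>expo m S. \<Sum>\<beta>\<in>expo m T. (c \<alpha> * d \<beta>) * mon m (\<lambda>i. \<alpha> i + \<beta> i) z)"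
    by (intro polyf_sum polyf_scale polyf_mon) (auto simp: expo_def sum.distrib)
  ultimately show ?thesis by simp
qed

lemma polyf_power: "polyf m T p \<Longrightarrow> polyf m (k * T) (\<lambda>z. p z ^ k)"
  by (induction k) (auto intro: polyf_const polyf_mult)

lemma polyf_prod:
  "finite I \<Longrightarrow> (\<And>i. i \<in> I \<Longrightarrow> polyf m (t i) (f i)) \<Longrightarrow> polyf m (\<Sum>i\<in>I. t i) (\<lambda>z. \<Prod>i\<in>I. f i z)"
  by (induction I rule: finite_induct) (auto intro: polyf_const polyf_mult)

lemma continuous_on_polyf:
  assumes "polyf m T p"
  shows "continuous_on A p"
proof -
  obtain c where "\<And>z. p z = (\<Sum>\<alpha>\<in>expo m T. c \<alpha> * mon m \<alpha> z)"
    using assms unfolding polyf_def lcomb_def by blast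
  then have "p = (\<lambda>z. \<Sum>\<alpha>\<in>expo m T. c \<alpha> * (\<Prod>i<m. z i ^ \<alpha> i))" by (simp add: mon_def fun_eq_iff)
  moreover have "continuous_on A (\<lambda>z. \<Sum>\<alpha>\<in>expo m T. c \<alpha> * (\<Prod>i<m. (z::nat\<Rightarrow>real) i ^ \<alpha> i))"
    by (intro continuous_intros continuous_on_subset[OF continuous_on_product_coordinates]) auto
  ultimately show ?thesis by simp
qed

lemma sum_decrease:
  fixes \<alpha> :: "nat \<Rightarrow> nat"
  assumes "i < m" "k \<le> \<alpha> i"
  shows "(\<Sum>j<m. (\<alpha>(i := \<alpha> i - k)) j) + k = (\<Sum>j<m. \<alpha> j)"
proof -
  have "(\<Sum>j\<in>{..<m} - {i}. (\<alpha>(i := \<alpha> i - k)) j) = (\<Sum>j\<in>{..<m} - {i}. \<alpha> j)"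
    by (rule sum.cong) auto
  then show ?thesis using assms by (simp add: sum.remove[of "{..<m}" i])
qed

lemma mon_deriv:
  assumes i: "i < m"
  shows "((\<lambda>s. mon m \<alpha> (z(i := s))) has_real_derivative
    real (\<alpha> i) * mon m (\<alpha>(i := \<alpha> i - 1)) z) (at (z i))"
proof -
  have split: "mon m \<beta> (z(i := s)) = s ^ \<beta> i * (\<Prod>j\<in>{..<m} - {i}. z j ^ \<beta> j)" for \<beta> s
  proof -
    have "mon m \<beta> (z(i := s)) = s ^ \<beta> i * (\<Prod>j\<in>{..<m} - {i}. (z(i := s)) j ^ \<beta> j)"
      unfolding mon_def using i by (subst prod.remove[of _ i]) auto
    also have "(\<Prod>j\<in>{..<m} - {i}. (z(i := s)) j ^ \<beta> j) = (\<Prod>j\<in>{..<m} - {i}. z j ^ \<beta> j)"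
      by (rule prod.cong) auto
    finally show ?thesis .
  qed
  have "mon m (\<alpha>(i := \<alpha> i - 1)) z = z i ^ (\<alpha> i - 1) * (\<Prod>j\<in>{..<m} - {i}. z j ^ \<alpha> j)"
    using split[of "\<alpha>(i := \<alpha> i - 1)" "z i"] by simp
  then show ?thesis
    unfolding split by (auto intro!: derivative_eq_intros)
qed

lemma polyf_deriv:
  assumes p: "polyf m T p" and i: "i < m"
  shows "\<exists>p'. polyf m (T - 1) p' \<and> (\<forall>z. ((\<lambda>s. p (z(i := s))) has_real_derivative p' z) (at (z i)))"
proof -
  obtain c where c: "\<And>z. p z = (\<Sum>\<alpha>\<in>expo m T. c \<alpha> * mon m \<alpha> z)"
    using assms unfolding polyf_def lcomb_def by blast
  define p' where "p' = (\<lambda>z. \<Sum>\<alpha>\<in>expo m T. c \<alpha> * (real (\<alpha> i) * mon m (\<alpha>(i := \<alpha> i - 1)) z))"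
  have "polyf m (T - 1) (\<lambda>z. c \<alpha> * (real (\<alpha> i) * mon m (\<alpha>(i := \<alpha> i - 1)) z))" if "\<alpha> \<in> expo m T" for \<alpha>
  proof (cases "\<alpha> i = 0")
    case True
    then show ?thesis by (simp add: polyf_const)
  next
    case False
    have "(\<Sum>j<m. (\<alpha>(i := \<alpha> i - 1)) j) + 1 = (\<Sum>j<m. \<alpha> j)"
      using i False by (intro sum_decrease) auto
    then have "\<alpha>(i := \<alpha> i - 1) \<in> expo m (T - 1)" using that i by (auto simp: expo_def)
    then show ?thesis by (intro polyf_scale polyf_mon)
  qed
  then have "polyf m (T - 1) p'" unfolding p'_def by (rule polyf_sum)
  moreover have "((\<lambda>s. p (z(i := s))) has_real_derivative p' z) (at (z i))" for z
    unfolding c p'_def by (intro DERIV_sum DERIV_cmult mon_deriv i)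
  ultimately show ?thesis by blast
qed

section \<open>Elimination by counting dimensions\<close>

lemma linear_dependence:
  fixes w :: "'j \<Rightarrow> 'i \<Rightarrow> real"
  assumes "finite I" "finite J" "card I < card J"
  shows "\<exists>c. (\<exists>j\<in>J. c j \<noteq> 0) \<and> (\<forall>i\<in>I. (\<Sum>j\<in>J. c j * w j i) = 0)"
  using assms
proof (induction I arbitrary: J w rule: finite_induct)
  case empty
  then have "J \<noteq> {}" by auto
  then show ?case by (intro exI[of _ "\<lambda>_. 1"]) auto
next
  case (insert i I)
  show ?case
  proof (cases "\<forall>j\<in>J. w j i = 0")
    case True
    have "card I < card J" using insert by simp
    then obtain c where "\<exists>j\<in>J. c j \<noteq> 0" "\<forall>k\<in>I. (\<Sum>j\<in>J. c j * w j k) = 0"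
      using insert.IH insert.prems(1) by blast
    then show ?thesis using True by (intro exI[of _ c]) auto
  next
    case False
    then obtain j0 where j0: "j0 \<in> J" "w j0 i \<noteq> 0" by blast
    let ?J = "J - {j0}"
    have "card I < card ?J" using insert j0 by simp
    then obtain c where c: "\<exists>j\<in>?J. c j \<noteq> 0"
      "\<forall>k\<in>I. (\<Sum>j\<in>?J. c j * (w j k - w j i / w j0 i * w j0 k)) = 0"
      using insert.IH[of ?J "\<lambda>j k. w j k - w j i / w j0 i * w j0 k"] insert.prems(1) by auto
    define c0 where "c0 = - (\<Sum>j\<in>?J. c j * w j i) / w j0 i"
    define c' where "c' = c(j0 := c0)"
    have sum: "(\<Sum>j\<in>J. c' j * w j k) = c0 * w j0 k + (\<Sum>j\<in>?J. c j * w j k)" for k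
      using insert.prems(1) j0(1) by (simp add: sum.remove[of J j0] c'_def)
    have "(\<Sum>j\<in>J. c' j * w j i) = 0" unfolding sum using j0 by (simp add: c0_def)
    moreover have "(\<Sum>j\<in>J. c' j * w j k) = 0" if "k \<in> I" for k
    proof -
      have "0 = (\<Sum>j\<in>?J. c j * (w j k - w j i / w j0 i * w j0 k))" using c(2) that by simp
      also have "\<dots> = (\<Sum>j\<in>?J. c j * w j k) - (\<Sum>j\<in>?J. c j * w j i) / w j0 i * w j0 k"
        by (simp add: right_diff_distrib sum_subtractf sum_distrib_right sum_divide_distrib mult.assoc)
      finally show ?thesis unfolding sum by (simp add: c0_def)
    qed
    moreover have "\<exists>j\<in>J. c' j \<noteq> 0" using c(1) by (auto simp: c'_def)
    ultimately show ?thesis by auto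
  qed
qed

text \<open>Coordinates \<open>0\<close> to \<open>n - 1\<close> are the x_i, coordinate
  \<open>n\<close> is u and \<open>n + 1\<close> is t. Only the x_i can be reduced; the exponents of
  u and t are limited by the total degree alone.\<close>

definition redexp :: "nat \<Rightarrow> nat \<Rightarrow> nat \<Rightarrow> (nat \<Rightarrow> nat) set" where
  "redexp n D T = {\<alpha> \<in> expo (n + 2) T. \<forall>i<n. \<alpha> i \<le> D}"

lemma finite_redexp: "finite (redexp n D T)"
  unfolding redexp_def using finite_expo by simp

lemma card_redexp: "card (redexp n D T) \<le> (D + 1) ^ n * (T + 1)\<^sup>2"
proof -
  let ?B = "\<lambda>i. if i < n then {..D} else {..T}"
  let ?r = "\<lambda>\<alpha>. restrict \<alpha> {..<n + 2}"
  have "inj_on ?r (redexp n D T)"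
  proof (rule inj_onI)
    fix \<alpha> \<beta> assume ab: "\<alpha> \<in> redexp n D T" "\<beta> \<in> redexp n D T" "?r \<alpha> = ?r \<beta>"
    show "\<alpha> = \<beta>"
    proof
      fix i show "\<alpha> i = \<beta> i"
      proof (cases "i < n + 2")
        case True
        then have "\<alpha> i = ?r \<alpha> i" "\<beta> i = ?r \<beta> i" by simp_all
        then show ?thesis unfolding ab(3) by simp
      next
        case False
        then show ?thesis using ab by (auto simp: redexp_def expo_def)
      qed
    qed
  qed
  moreover have "?r ` redexp n D T \<subseteq> PiE {..<n + 2} ?B"
  proof (intro image_subsetI PiE_I)
    fix \<alpha> i assume "\<alpha> \<in> redexp n D T" "i \<in> {..<n + 2}"
    then show "?r \<alpha> i \<in> ?B i" using expo_le[of \<alpha> "n + 2" T i] by (simp add: redexp_def)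
  qed auto
  moreover have "finite (PiE {..<n + 2} ?B)" by (rule finite_PiE) auto
  ultimately have "card (redexp n D T) \<le> card (PiE {..<n + 2} ?B)" by (rule card_inj_on_le)
  also have "\<dots> = (\<Prod>i<n + 2. card (?B i))" by (simp add: card_PiE)
  also have "\<dots> = (\<Prod>i<n. card (?B i)) * (T + 1)\<^sup>2"
    by (simp add: power2_eq_square algebra_simps)
  also have "(\<Prod>i<n. card (?B i)) = (\<Prod>i<n. D + 1)" by (rule prod.cong) auto
  also have "\<dots> = (D + 1) ^ n" by simp
  finally show ?thesis .
qed

text \<open>On \<open>C\<close> the power \<open>z i ^ (D + 1)\<close> equals a polynomial of degree
  at most \<open>D - 1\<close>, so replacing it lowers the total degree and the induction on
  \<open>T\<close> applies.\<close>

lemma reduce_polyf: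
  assumes dF: "\<And>i. i < n \<Longrightarrow> polyf (n + 2) (D - 1) (dF i)" and k: "\<kappa> \<noteq> 0"
    and C: "\<And>z i. z \<in> C \<Longrightarrow> i < n \<Longrightarrow> dF i z + \<kappa> * z i ^ (D + 1) = 0"
  shows "polyf (n + 2) T p \<Longrightarrow> lcomb (n + 2) (redexp n D T) C p"
proof (induction T arbitrary: p rule: less_induct)
  case (less T)
  have "lcomb (n + 2) (redexp n D T) C (mon (n + 2) \<alpha>)" if al: "\<alpha> \<in> expo (n + 2) T" for \<alpha>
  proof (cases "\<forall>i<n. \<alpha> i \<le> D")
    case True
    then show ?thesis using al by (intro lcomb_mon finite_redexp) (simp add: redexp_def)
  next
    case False
    then obtain i where i: "i < n" "D + 1 \<le> \<alpha> i" by (auto simp: not_le)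
    define \<beta> where "\<beta> = \<alpha>(i := \<alpha> i - (D + 1))"
    have T: "D + 1 \<le> T" using i expo_le[OF al, of i] by simp
    have "(\<Sum>j<n + 2. \<beta> j) + (D + 1) = (\<Sum>j<n + 2. \<alpha> j)"
      unfolding \<beta>_def using i by (intro sum_decrease) auto
    then have "\<beta> \<in> expo (n + 2) (T - (D + 1))"
      using al i by (auto simp: expo_def \<beta>_def)
    then have "polyf (n + 2) (T - (D + 1) + (D - 1)) (\<lambda>z. mon (n + 2) \<beta> z * (- 1 / \<kappa> * dF i z))"
      by (intro polyf_mult polyf_mon polyf_scale dF i)
    then have "polyf (n + 2) (T - 1) (\<lambda>z. mon (n + 2) \<beta> z * (- 1 / \<kappa> * dF i z))"
      by (rule polyf_mono) (use T in simp)
    then have "lcomb (n + 2) (redexp n D (T - 1)) C (\<lambda>z. mon (n + 2) \<beta> z * (- 1 / \<kappa> * dF i z))"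
      using less.IH[of "T - 1"] T by simp
    then have "lcomb (n + 2) (redexp n D T) C (\<lambda>z. mon (n + 2) \<beta> z * (- 1 / \<kappa> * dF i z))"
      by (rule lcomb_mono[OF _ _ finite_redexp]) (auto simp: redexp_def expo_def)
    then show ?thesis
    proof (rule lcomb_cong[rotated])
      fix z assume "z \<in> C"
      then have "\<kappa> * z i ^ (D + 1) = - dF i z" using C[of z i] i by simp
      then have zi: "z i ^ (D + 1) = - 1 / \<kappa> * dF i z" using k by (simp add: field_simps)
      have "(\<lambda>j. \<beta> j + (if j = i then D + 1 else 0)) = \<alpha>" using i by (auto simp: \<beta>_def)
      then have "mon (n + 2) \<alpha> z = mon (n + 2) \<beta> z * mon (n + 2) (\<lambda>j. if j = i then D + 1 else 0) z"
        unfolding mon_mult by simp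
      also have "mon (n + 2) (\<lambda>j. if j = i then D + 1 else 0) z = z i ^ (D + 1)"
        unfolding mon_def if_distrib[of "\<lambda>k. _ ^ k"] power_0 using i by (subst prod.delta) auto
      finally show "mon (n + 2) \<alpha> z = mon (n + 2) \<beta> z * (- 1 / \<kappa> * dF i z)" unfolding zi .
    qed
  qed
  moreover obtain c where "\<And>z. p z = (\<Sum>\<alpha>\<in>expo (n + 2) T. c \<alpha> * mon (n + 2) \<alpha> z)"
    using less.prems unfolding polyf_def lcomb_def by blast
  ultimately show ?case
    by (intro lcomb_cong[of C p, OF _ lcomb_sum[of "expo (n + 2) T", OF lcomb_scale]]) auto
qed

text \<open>With \<open>E0 = 9 (D + 1) ^ n\<close> and \<open>T1 = (D + 2) E0\<close> there are more monomials
  \<open>t ^ a u ^ b s ^ e\<close> (\<open>a, b \<le> T1\<close>, \<open>e \<le> E0\<close>) than reduced monomials of the degree they produce.\<close>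

definition elim_e :: "nat \<Rightarrow> nat \<Rightarrow> nat" where "elim_e n D = 9 * (D + 1) ^ n"
definition elim_t :: "nat \<Rightarrow> nat \<Rightarrow> nat" where "elim_t n D = (D + 2) * elim_e n D"
definition elim_box :: "nat \<Rightarrow> nat \<Rightarrow> (nat \<times> nat \<times> nat) set" where
  "elim_box n D = {..elim_t n D} \<times> {..elim_t n D} \<times> {..elim_e n D}"

text \<open>The degree in question, \<open>2 * elim_t n D + (D + 2) * elim_e n D\<close>, is three
  times \<open>elim_t n D\<close>. Tripling the range of the exponents of u and t costs a factor 9,
  and \<open>elim_e n D\<close> is chosen to absorb this factor together with
  \<open>(D + 1) ^ n\<close>.\<close>

lemma elim_count:
  "card (redexp n D (2 * elim_t n D + (D + 2) * elim_e n D)) < card (elim_box n D)"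
proof -
  let ?t = "elim_t n D" and ?r = "(D + 1) ^ n"
  have T: "2 * ?t + (D + 2) * elim_e n D + 1 \<le> 3 * (?t + 1)" by (simp add: elim_t_def)
  have "card (redexp n D (2 * ?t + (D + 2) * elim_e n D)) \<le> ?r * (2 * ?t + (D + 2) * elim_e n D + 1)\<^sup>2"
    by (rule card_redexp)
  also have "\<dots> \<le> ?r * (3 * (?t + 1))\<^sup>2" using T by (intro mult_le_mono2 power_mono) auto
  also have "\<dots> = 9 * ?r * (?t + 1)\<^sup>2" by (simp only: power_mult_distrib) simp
  also have "\<dots> < (elim_e n D + 1) * (?t + 1)\<^sup>2" unfolding elim_e_def by (intro mult_strict_right_mono) auto
  also have "\<dots> = card (elim_box n D)" by (simp add: elim_box_def card_cartesian_product power2_eq_square algebra_simps)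
  finally show ?thesis .
qed

text \<open>The exponent \<open>D + 2\<close> is even together with \<open>D\<close>, so for
  \<delta> \<ge> 0 the added term is nonnegative, and its derivative has a higher degree than those
  of a polynomial \<open>F\<close> of degree \<open>D\<close>.\<close>

definition pert :: "nat \<Rightarrow> nat \<Rightarrow> ((nat \<Rightarrow> real) \<Rightarrow> real) \<Rightarrow> real \<Rightarrow> (nat \<Rightarrow> real) \<Rightarrow> real" where
  "pert n D F \<delta> z = F z + \<delta> * (\<Sum>i<n. z i ^ (D + 2))"

definition elim_val :: "nat \<Rightarrow> nat \<Rightarrow> (nat \<times> nat \<times> nat \<Rightarrow> real) \<Rightarrow> real \<Rightarrow> real \<Rightarrow> real \<Rightarrow> real" where
  "elim_val n D c t u s = (\<Sum>(a, b, e)\<in>elim_box n D. c (a, b, e) * (t ^ a * u ^ b * s ^ e))"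

lemma polyf_pert: "polyf (n + 2) D F \<Longrightarrow> polyf (n + 2) (D + 2) (pert n D F \<delta>)"
  unfolding pert_def
  by (intro polyf_add polyf_scale polyf_sum)
    (use polyf_mono[of _ D] polyf_power[OF polyf_var, of _ "n + 2" "D + 2"] in auto)

text \<open>On the critical set the products of powers of t, u and the perturbed value reduce to
  fewer monomials than there are products; a linear dependence among them is the required
  polynomial. Scaling its coefficients to absolute sum 1 prevents limits of such vectors from being
  zero.\<close>

lemma elimination:
  assumes F: "polyf (n + 2) D F" and dF: "\<And>i. i < n \<Longrightarrow> polyf (n + 2) (D - 1) (dF i)" and d: "\<delta> \<noteq> 0"
  shows "\<exists>c. (\<forall>j. \<bar>c j\<bar> \<le> 1) \<and> (\<Sum>j\<in>elim_box n D. \<bar>c j\<bar>) = 1 \<and>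
    (\<forall>z. (\<forall>i<n. dF i z + \<delta> * (D + 2) * z i ^ (D + 1) = 0) \<longrightarrow>
      elim_val n D c (z (n + 1)) (z n) (pert n D F \<delta> z) = 0)"
proof -
  define C where "C = {z. \<forall>i<n. dF i z + \<delta> * (D + 2) * z i ^ (D + 1) = 0}"
  let ?J = "elim_box n D"
  let ?T = "2 * elim_t n D + (D + 2) * elim_e n D"
  let ?I = "redexp n D ?T"
  define w where "w = (\<lambda>(a, b, e) z. z (n + 1) ^ a * z n ^ b * pert n D F \<delta> z ^ e)"
  have finJ: "finite ?J" by (simp add: elim_box_def)
  have "lcomb (n + 2) ?I C (w j)" if j: "j \<in> ?J" for j
  proof -
    obtain a b e where abe: "j = (a, b, e)" "a \<le> elim_t n D" "b \<le> elim_t n D" "e \<le> elim_e n D"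
      using j by (auto simp: elim_box_def)
    have "polyf (n + 2) ((a * 1 + b * 1) + e * (D + 2)) (w j)"
      unfolding w_def abe(1) prod.case by (intro polyf_mult polyf_power polyf_var polyf_pert F) auto
    then have "polyf (n + 2) ?T (w j)"
      by (rule polyf_mono) (use abe mult_le_mono1[OF abe(4), of "D + 2"] in \<open>simp add: algebra_simps\<close>)
    then show ?thesis
      using reduce_polyf[where \<kappa> = "\<delta> * (D + 2)" and C = C and dF = dF, OF dF] d unfolding C_def by auto
  qed
  then have "\<forall>j\<in>?J. \<exists>a. \<forall>z\<in>C. w j z = (\<Sum>\<alpha>\<in>?I. a \<alpha> * mon (n + 2) \<alpha> z)" unfolding lcomb_def by blast
  then obtain A where A: "\<And>j z. j \<in> ?J \<Longrightarrow> z \<in> C \<Longrightarrow> w j z = (\<Sum>\<alpha>\<in>?I. A j \<alpha> * mon (n + 2) \<alpha> z)" by metis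
  obtain c where c: "\<exists>j\<in>?J. c j \<noteq> 0" "\<And>\<alpha>. \<alpha> \<in> ?I \<Longrightarrow> (\<Sum>j\<in>?J. c j * A j \<alpha>) = 0"
    using linear_dependence[OF finite_redexp finJ elim_count, of A] by blast
  define s where "s = (\<Sum>j\<in>?J. \<bar>c j\<bar>)"
  have s: "s > 0"
  proof -
    obtain j where "j \<in> ?J" "c j \<noteq> 0" using c(1) by blast
    then have "0 < \<bar>c j\<bar>" "\<bar>c j\<bar> \<le> s" unfolding s_def using finJ by (auto intro: member_le_sum)
    then show ?thesis by linarith
  qed
  \<comment> \<open>Zero outside the box, so that the whole coefficient family stays in a compact
    product of intervals.\<close>
  define c' where "c' = (\<lambda>j. if j \<in> ?J then c j / s else 0)"
  have "\<bar>c' j\<bar> \<le> 1" for j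
    using s finJ member_le_sum[of j ?J "\<lambda>j. \<bar>c j\<bar>"] by (auto simp: c'_def s_def abs_divide)
  moreover have "(\<Sum>j\<in>?J. \<bar>c' j\<bar>) = 1"
  proof -
    have "(\<Sum>j\<in>?J. \<bar>c' j\<bar>) = (\<Sum>j\<in>?J. \<bar>c j\<bar> / s)" using s by (intro sum.cong) (auto simp: c'_def abs_divide)
    also have "\<dots> = 1" using s by (simp add: sum_divide_distrib[symmetric] s_def[symmetric])
    finally show ?thesis .
  qed
  moreover have "elim_val n D c' (z (n + 1)) (z n) (pert n D F \<delta> z) = 0"
    if "\<forall>i<n. dF i z + \<delta> * (D + 2) * z i ^ (D + 1) = 0" for z
  proof -
    have z: "z \<in> C" using that by (simp add: C_def)
    have "elim_val n D c' (z (n + 1)) (z n) (pert n D F \<delta> z) = (\<Sum>j\<in>?J. c' j * w j z)"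
      unfolding elim_val_def w_def by (intro sum.cong) auto
    also have "\<dots> = (\<Sum>j\<in>?J. \<Sum>\<alpha>\<in>?I. (c j * A j \<alpha>) * (mon (n + 2) \<alpha> z / s))"
      using A z by (intro sum.cong) (auto simp: c'_def sum_distrib_left sum_divide_distrib mult.assoc)
    also have "\<dots> = (\<Sum>\<alpha>\<in>?I. (\<Sum>j\<in>?J. c j * A j \<alpha>) * (mon (n + 2) \<alpha> z / s))"
      by (subst sum.swap) (simp only: sum_distrib_right)
    also have "\<dots> = 0" using c(2) by simp
    finally show ?thesis .
  qed
  ultimately show ?thesis by blast
qed

text \<open>Tychonoff's theorem. Points and coefficient families are both functions with the product
  topology, so one lemma serves for either.\<close>

lemma compact_box:
  "compact {f :: 'i \<Rightarrow> real. \<forall>i. \<bar>f i\<bar> \<le> R i}"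
proof -
  have "compactin (product_topology (\<lambda>i. euclidean) UNIV) (PiE UNIV (\<lambda>i. {- R i..R i}))"
    by (simp add: compactin_PiE)
  moreover have "PiE UNIV (\<lambda>i. {- R i..R i}) = {f :: 'i \<Rightarrow> real. \<forall>i. \<bar>f i\<bar> \<le> R i}"
  proof -
    have "x \<in> {- r..r} \<longleftrightarrow> \<bar>x\<bar> \<le> r" for x r :: real by auto
    then show ?thesis by (simp only: PiE_UNIV_domain Pi_def) simp
  qed
  ultimately show ?thesis by (simp add: euclidean_product_topology)
qed

lemma tendsto_coordinate:
  "(f \<longlongrightarrow> l) G \<Longrightarrow> ((\<lambda>x. f x i) \<longlongrightarrow> (l i :: real)) G"
  using continuous_on_tendsto_compose[OF continuous_on_product_coordinates[of i]] by auto

text \<open>The normalised coefficient vectors have a convergent subsequence as \<delta> tends to 0,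
  and the normalisation passes to the limit. No point enters the choice of \<open>c0\<close>; this
  makes the later constants uniform.\<close>

lemma elimination_limit:
  assumes F: "polyf (n + 2) D F" and dF: "\<And>i. i < n \<Longrightarrow> polyf (n + 2) (D - 1) (dF i)"
  shows "\<exists>\<delta> c c0. (\<forall>k. \<delta> k > 0) \<and> \<delta> \<longlonglongrightarrow> 0 \<and> (\<forall>j. (\<lambda>k. c k j) \<longlonglongrightarrow> c0 j) \<and>
    (\<exists>j\<in>elim_box n D. c0 j \<noteq> 0) \<and>
    (\<forall>k z. (\<forall>i<n. dF i z + \<delta> k * (D + 2) * z i ^ (D + 1) = 0) \<longrightarrow>
      elim_val n D (c k) (z (n + 1)) (z n) (pert n D F (\<delta> k) z) = 0)"
proof -
  let ?J = "elim_box n D"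
  define d :: "nat \<Rightarrow> real" where "d = (\<lambda>k. inverse (real (Suc k)))"
  have d: "d k \<noteq> 0" "d k > 0" for k by (simp_all add: d_def)
  define G where "G = (\<lambda>k c. (\<forall>j. \<bar>c j\<bar> \<le> 1) \<and> (\<Sum>j\<in>?J. \<bar>c j\<bar>) = 1 \<and>
    (\<forall>z. (\<forall>i<n. dF i z + d k * (D + 2) * z i ^ (D + 1) = 0) \<longrightarrow>
      elim_val n D c (z (n + 1)) (z n) (pert n D F (d k) z) = 0))"
  have "\<forall>k. \<exists>c. G k c" unfolding G_def using elimination[OF F dF d(1)] by simp
  then obtain c where "\<forall>k. G k (c k)" by metis
  then have c: "\<And>k j. \<bar>c k j\<bar> \<le> 1" "\<And>k. (\<Sum>j\<in>?J. \<bar>c k j\<bar>) = 1"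
    "\<And>k z. (\<forall>i<n. dF i z + d k * (D + 2) * z i ^ (D + 1) = 0) \<Longrightarrow>
      elim_val n D (c k) (z (n + 1)) (z n) (pert n D F (d k) z) = 0"
    unfolding G_def by blast+
  have "seq_compact {f :: nat \<times> nat \<times> nat \<Rightarrow> real. \<forall>i. \<bar>f i\<bar> \<le> 1}"
    using compact_box[of "\<lambda>_. 1"] compact_imp_seq_compact by blast
  then obtain c0 r where r: "strict_mono r" "(c \<circ> r) \<longlonglongrightarrow> c0"
    using c(1) unfolding seq_compact_def by blast
  have lim: "(\<lambda>k. c (r k) j) \<longlonglongrightarrow> c0 j" for j
    using tendsto_coordinate[OF r(2)] by (simp add: comp_def)
  have "(\<lambda>k. \<Sum>j\<in>?J. \<bar>c (r k) j\<bar>) \<longlonglongrightarrow> (\<Sum>j\<in>?J. \<bar>c0 j\<bar>)"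
    by (intro tendsto_intros lim)
  then have "(\<Sum>j\<in>?J. \<bar>c0 j\<bar>) = 1" unfolding c(2) by (simp add: LIMSEQ_const_iff)
  then have "\<exists>j\<in>?J. c0 j \<noteq> 0" by (metis (no_types, lifting) abs_zero sum.neutral zero_neq_one)
  moreover have "(d \<circ> r) \<longlonglongrightarrow> 0"
    using LIMSEQ_subseq_LIMSEQ[OF LIMSEQ_inverse_real_of_nat r(1)] unfolding d_def by simp
  ultimately show ?thesis
    using lim d(2) c(3) by (intro exI[of _ "d \<circ> r"] exI[of _ "c \<circ> r"] exI[of _ c0]) (auto simp: comp_def)
qed

section \<open>A Lojasiewicz inequality on compact semialgebraic sets\<close>

lemma lowest_term_dominates:
  fixes r :: "nat \<Rightarrow> real"
  assumes "\<And>i. i < k \<Longrightarrow> r i = 0" "k \<le> m" "\<bar>x\<bar> \<le> 1"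
  shows "\<bar>(\<Sum>i\<le>m. r i * x ^ i) - r k * x ^ k\<bar> \<le> \<bar>x\<bar> ^ (k + 1) * (\<Sum>i\<le>m. \<bar>r i\<bar>)"
proof -
  have "(\<Sum>i\<le>m. r i * x ^ i) - r k * x ^ k = (\<Sum>i\<in>{..m} - {k}. r i * x ^ i)"
    using assms(2) by (simp add: sum.remove[of "{..m}" k])
  also have "\<bar>\<dots>\<bar> \<le> (\<Sum>i\<in>{..m} - {k}. \<bar>r i * x ^ i\<bar>)" by (rule sum_abs)
  also have "\<dots> \<le> (\<Sum>i\<in>{..m} - {k}. \<bar>x\<bar> ^ (k + 1) * \<bar>r i\<bar>)"
  proof (rule sum_mono)
    fix i assume "i \<in> {..m} - {k}"
    then consider "i < k" | "k + 1 \<le> i" by fastforce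
    then show "\<bar>r i * x ^ i\<bar> \<le> \<bar>x\<bar> ^ (k + 1) * \<bar>r i\<bar>"
    proof cases
      case 1
      then show ?thesis using assms(1) by simp
    next
      case 2
      then have "\<bar>x\<bar> ^ i \<le> \<bar>x\<bar> ^ (k + 1)" using assms(3) by (intro power_decreasing) auto
      then have "\<bar>r i\<bar> * \<bar>x\<bar> ^ i \<le> \<bar>r i\<bar> * \<bar>x\<bar> ^ (k + 1)" by (intro mult_left_mono) auto
      then show ?thesis by (simp only: abs_mult power_abs mult.commute)
    qed
  qed
  also have "\<dots> \<le> (\<Sum>i\<le>m. \<bar>x\<bar> ^ (k + 1) * \<bar>r i\<bar>)" by (rule sum_mono2) auto
  finally show ?thesis by (simp add: sum_distrib_left)
qed

text \<open>Let \<open>b0\<close> be the least power of u that occurs and \<open>k\<close> the least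
  power of t in its coefficient r(t). Dividing by \<open>u ^ b0\<close> bounds |r(t)| by B |u| for
  |u| \<le> 1, while for small t it is at least half of the absolute value of its lowest
  term.\<close>

lemma bivariate_root_bound:
  fixes q :: "nat \<Rightarrow> nat \<Rightarrow> real"
  assumes ne: "\<exists>a\<le>m. \<exists>b\<le>m. q a b \<noteq> 0"
  shows "\<exists>C t0. 0 < C \<and> 0 < t0 \<and> t0 \<le> 1 \<and> (\<forall>t u. \<bar>t\<bar> < t0 \<longrightarrow> u \<noteq> 0 \<longrightarrow>
    (\<Sum>a\<le>m. \<Sum>b\<le>m. q a b * (t ^ a * u ^ b)) = 0 \<longrightarrow> \<bar>t\<bar> ^ m \<le> C * \<bar>u\<bar>)"
proof -
  define b0 where "b0 = (LEAST b. b \<le> m \<and> (\<exists>a\<le>m. q a b \<noteq> 0))"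
  have b0: "b0 \<le> m" "\<exists>a\<le>m. q a b0 \<noteq> 0"
    using LeastI_ex[of "\<lambda>b. b \<le> m \<and> (\<exists>a\<le>m. q a b \<noteq> 0)"] ne unfolding b0_def by blast+
  have b0_min: "q a b = 0" if "b < b0" "a \<le> m" for a b
    using not_less_Least[of b "\<lambda>b. b \<le> m \<and> (\<exists>a\<le>m. q a b \<noteq> 0)"] that b0(1) unfolding b0_def by fastforce
  define k where "k = (LEAST a. a \<le> m \<and> q a b0 \<noteq> 0)"
  have k: "k \<le> m" "q k b0 \<noteq> 0"
    using LeastI_ex[of "\<lambda>a. a \<le> m \<and> q a b0 \<noteq> 0"] b0(2) unfolding k_def by blast+
  have k_min: "q a b0 = 0" if "a < k" for a
    using not_less_Least[of a "\<lambda>a. a \<le> m \<and> q a b0 \<noteq> 0"] that k(1) unfolding k_def by fastforce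
  define B where "B = (\<Sum>b\<le>m. \<Sum>a\<le>m. \<bar>q a b\<bar>)"
  have B: "0 \<le> B" unfolding B_def by (intro sum_nonneg) auto
  have Bb: "(\<Sum>a\<le>m. \<bar>q a b\<bar>) \<le> B" if "b \<le> m" for b
    unfolding B_def using that by (intro member_le_sum) (auto intro: sum_nonneg)
  define Q where "Q = \<bar>q k b0\<bar>"
  have Q: "0 < Q" using k by (simp add: Q_def)
  \<comment> \<open>Chosen so that the higher terms in t amount to at most half of the lowest one.
    In \<open>C\<close> the summand 1 takes care of |u| > 1.\<close>
  define t0 where "t0 = min 1 (Q / (2 * (B + 1)))"
  define C where "C = 1 + 2 * B / Q"
  have t0: "0 < t0" "t0 \<le> 1" using Q B by (auto simp: t0_def)
  have C: "1 \<le> C" using Q B by (simp add: C_def)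
  have "\<bar>t\<bar> ^ m \<le> C * \<bar>u\<bar>" if t: "\<bar>t\<bar> < t0" and u: "u \<noteq> 0"
    and 0: "(\<Sum>a\<le>m. \<Sum>b\<le>m. q a b * (t ^ a * u ^ b)) = 0" for t u
  proof -
    have t1: "\<bar>t\<bar> \<le> 1" using t t0 by simp
    have "\<bar>t\<bar> ^ m \<le> \<bar>t\<bar> ^ k" using t1 k by (intro power_decreasing) auto
    also have "\<bar>t\<bar> ^ k \<le> C * \<bar>u\<bar>"
    proof (cases "\<bar>u\<bar> \<le> 1")
      case False
      have "\<bar>t\<bar> ^ k \<le> 1" using t1 by (intro power_le_one) auto
      also have "1 \<le> C * \<bar>u\<bar>" using C False mult_mono[of 1 C 1 "\<bar>u\<bar>"] by simp
      finally show ?thesis .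
    next
      case True
      define r where "r = (\<lambda>b. \<Sum>a\<le>m. q a b * t ^ a)"
      have sum: "(\<Sum>b\<le>m. r b * u ^ b) = 0"
        using 0 unfolding r_def by (subst (asm) sum.swap) (simp add: sum_distrib_right mult.assoc)
      have "\<bar>(\<Sum>b\<le>m. r b * u ^ b) - r b0 * u ^ b0\<bar> \<le> \<bar>u\<bar> ^ (b0 + 1) * (\<Sum>b\<le>m. \<bar>r b\<bar>)"
        using True b0 b0_min by (intro lowest_term_dominates) (auto simp: r_def)
      then have "\<bar>u\<bar> ^ b0 * \<bar>r b0\<bar> \<le> \<bar>u\<bar> ^ b0 * (\<bar>u\<bar> * (\<Sum>b\<le>m. \<bar>r b\<bar>))"
        unfolding sum by (simp add: abs_mult power_abs ac_simps)
      then have "\<bar>r b0\<bar> \<le> \<bar>u\<bar> * (\<Sum>b\<le>m. \<bar>r b\<bar>)" using u by (simp add: mult_le_cancel_left_pos)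
      also have "(\<Sum>b\<le>m. \<bar>r b\<bar>) \<le> B"
        unfolding B_def
      proof (rule sum_mono)
        fix b
        have "\<bar>r b\<bar> \<le> (\<Sum>a\<le>m. \<bar>q a b * t ^ a\<bar>)" unfolding r_def by (rule sum_abs)
        also have "\<dots> \<le> (\<Sum>a\<le>m. \<bar>q a b\<bar>)"
        proof (rule sum_mono)
          fix a
          have "\<bar>t\<bar> ^ a \<le> 1" using t1 by (intro power_le_one) auto
          then show "\<bar>q a b * t ^ a\<bar> \<le> \<bar>q a b\<bar>" by (simp add: abs_mult power_abs mult_left_le)
        qed
        finally show "\<bar>r b\<bar> \<le> (\<Sum>a\<le>m. \<bar>q a b\<bar>)" .
      qed
      finally have r_le: "\<bar>r b0\<bar> \<le> \<bar>u\<bar> * B" by (simp add: mult_left_mono)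
      have "\<bar>r b0 - q k b0 * t ^ k\<bar> \<le> \<bar>t\<bar> ^ (k + 1) * (\<Sum>a\<le>m. \<bar>q a b0\<bar>)"
        unfolding r_def using t1 k k_min by (intro lowest_term_dominates) auto
      also have "\<dots> \<le> \<bar>t\<bar> ^ (k + 1) * B" using Bb[OF b0(1)] by (intro mult_left_mono) auto
      also have "\<dots> \<le> \<bar>t\<bar> ^ k * (Q / 2)"
      proof -
        have "\<bar>t\<bar> \<le> Q / (2 * (B + 1))" using t by (simp add: t0_def)
        then have "\<bar>t\<bar> * B \<le> Q / (2 * (B + 1)) * B" using B by (rule mult_right_mono)
        also have "\<dots> \<le> Q / 2" using Q B by (simp add: field_simps)
        finally have "\<bar>t\<bar> ^ k * (\<bar>t\<bar> * B) \<le> \<bar>t\<bar> ^ k * (Q / 2)" by (intro mult_left_mono) auto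
        then show ?thesis by (simp add: mult.assoc mult.left_commute)
      qed
      finally have "\<bar>q k b0 * t ^ k\<bar> - \<bar>r b0\<bar> \<le> \<bar>t\<bar> ^ k * (Q / 2)" by linarith
      then have "\<bar>t\<bar> ^ k * (Q / 2) \<le> \<bar>r b0\<bar>" by (simp add: Q_def abs_mult power_abs field_simps)
      then have "\<bar>t\<bar> ^ k * (Q / 2) \<le> \<bar>u\<bar> * B" using r_le by linarith
      then have "\<bar>t\<bar> ^ k \<le> 2 * B / Q * \<bar>u\<bar>" using Q by (simp add: field_simps)
      also have "\<dots> \<le> C * \<bar>u\<bar>" unfolding C_def by (intro mult_right_mono) auto
      finally show ?thesis .
    qed
    finally show ?thesis .
  qed
  then show ?thesis using t0 C by (intro exI[of _ C] exI[of _ t0]) auto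
qed

lemma continuous_on_fun_upd: "continuous_on A (\<lambda>s::real. (z::nat \<Rightarrow> real)(i := s))"
proof (rule continuous_on_coordinatewise_then_product)
  fix j show "continuous_on A (\<lambda>s. (z(i := s)) j)"
    by (cases "j = i") (auto intro: continuous_intros)
qed

lemma tendsto_fun_upd: "((\<lambda>s. z(i := s)) \<longlongrightarrow> (z::nat \<Rightarrow> real)) (nhds (z i))"
  using continuous_on_fun_upd[of UNIV z i]
  by (metis continuous_on_def UNIV_I fun_upd_triv tendsto_at_iff_tendsto_nhds)

lemma tendsto_elim_val:
  "(\<And>j. (f j \<longlongrightarrow> c j) G) \<Longrightarrow> (u \<longlongrightarrow> u0) G \<Longrightarrow> (s \<longlongrightarrow> s0) G \<Longrightarrow>
    ((\<lambda>k. elim_val n D (\<lambda>j. f j k) t (u k) (s k)) \<longlongrightarrow> elim_val n D c t u0 s0) G"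
  unfolding elim_val_def case_prod_unfold by (intro tendsto_intros) auto

lemma elim_val_triple:
  "elim_val n D c t u s = (\<Sum>a\<le>elim_t n D. \<Sum>b\<le>elim_t n D. \<Sum>e\<le>elim_e n D. c (a, b, e) * (t ^ a * u ^ b * s ^ e))"
  unfolding elim_val_def elim_box_def
  by (simp add: sum.cartesian_product case_prod_unfold)

section \<open>Critical points of the perturbation and their limits\<close>

context
  fixes n D :: nat and F :: "(nat \<Rightarrow> real) \<Rightarrow> real" and dF :: "nat \<Rightarrow> (nat \<Rightarrow> real) \<Rightarrow> real"
  assumes F: "polyf (n + 2) D F" and F_nonneg: "\<And>z. 0 \<le> F z" and D: "even D"
    and dF: "\<And>i z. i < n \<Longrightarrow> ((\<lambda>s. F (z(i := s))) has_real_derivative dF i z) (at (z i))"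
begin

lemma continuous_on_pert: "continuous_on A (pert n D F \<delta>)"
  using continuous_on_polyf[OF polyf_pert[OF F]] .

lemma pert_ge: "0 \<le> \<delta> \<Longrightarrow> F z \<le> pert n D F \<delta> z"
proof -
  assume "0 \<le> \<delta>"
  moreover have "0 \<le> (\<Sum>i<n. z i ^ (D + 2))" using D by (intro sum_nonneg zero_le_even_power) simp
  ultimately show ?thesis by (simp add: pert_def)
qed

lemma pert_deriv:
  assumes i: "i < n"
  shows "((\<lambda>s. pert n D F \<delta> (z(i := s))) has_real_derivative dF i z + \<delta> * (D + 2) * z i ^ (D + 1)) (at (z i))"
proof -
  have eq: "pert n D F \<delta> (z(i := s)) = F (z(i := s)) + \<delta> * (s ^ (D + 2) + (\<Sum>j\<in>{..<n} - {i}. z j ^ (D + 2)))" for s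
  proof -
    have "(\<Sum>j<n. (z(i := s)) j ^ (D + 2)) = s ^ (D + 2) + (\<Sum>j\<in>{..<n} - {i}. (z(i := s)) j ^ (D + 2))"
      using i by (simp add: sum.remove[of "{..<n}" i])
    also have "(\<Sum>j\<in>{..<n} - {i}. (z(i := s)) j ^ (D + 2)) = (\<Sum>j\<in>{..<n} - {i}. z j ^ (D + 2))"
      by (rule sum.cong) auto
    finally show ?thesis by (simp add: pert_def)
  qed
  show ?thesis unfolding eq
    by (rule derivative_eq_intros dF i refl)+ (simp add: algebra_simps)
qed

text \<open>If a derivative did not vanish one could first decrease the perturbed function and
  then decrease \<open>|u|\<close>.\<close>

lemma minimizer_critical:
  assumes U: "open U" and nb: "\<And>z i. z \<in> V \<inter> U \<Longrightarrow> i \<le> n \<Longrightarrow> \<forall>\<^sub>F s in nhds (z i). z(i := s) \<in> V"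
    and z: "z \<in> V \<inter> U" "pert n D F \<delta> z \<le> \<epsilon>" "z n \<noteq> 0"
    and min: "\<And>z'. z' \<in> V \<Longrightarrow> pert n D F \<delta> z' \<le> \<epsilon> \<Longrightarrow> \<bar>z n\<bar> \<le> \<bar>z' n\<bar>"
  shows "pert n D F \<delta> z = \<epsilon> \<and> (\<forall>i<n. dF i z + \<delta> * (D + 2) * z i ^ (D + 1) = 0)"
proof -
  have not_less: "\<not> pert n D F \<delta> y < \<epsilon>" if y: "y \<in> V \<inter> U" "y n = z n" for y
  proof
    assume less: "pert n D F \<delta> y < \<epsilon>"
    have "((\<lambda>s. pert n D F \<delta> (y(n := s))) \<longlongrightarrow> pert n D F \<delta> y) (nhds (y n))"
      using continuous_on_tendsto_compose[OF continuous_on_pert[of UNIV] tendsto_fun_upd] by simp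
    then have "\<forall>\<^sub>F s in nhds (y n). pert n D F \<delta> (y(n := s)) < \<epsilon>" using less by (rule order_tendstoD)
    with nb[OF y(1), of n] have "\<forall>\<^sub>F s in nhds (y n). y(n := s) \<in> V \<and> pert n D F \<delta> (y(n := s)) < \<epsilon>"
      by (simp add: eventually_conj_iff)
    then obtain d where d: "d > 0" "\<And>s. dist s (y n) < d \<Longrightarrow> y(n := s) \<in> V \<and> pert n D F \<delta> (y(n := s)) < \<epsilon>"
      unfolding eventually_nhds_metric by blast
    define h where "h = min (d / 2) (\<bar>y n\<bar> / 2)"
    define s where "s = y n - sgn (y n) * h"
    have yn: "y n \<noteq> 0" using y z by simp
    have h: "0 < h" "h < d" "h < \<bar>y n\<bar>" using d(1) yn by (auto simp: h_def)
    have "dist s (y n) < d" "\<bar>s\<bar> < \<bar>y n\<bar>"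
      using h yn by (auto simp: s_def dist_real_def sgn_if)
    then show False using d(2)[of s] min[of "y(n := s)"] y(2) by simp
  qed
  have eq: "pert n D F \<delta> z = \<epsilon>" using not_less[of z] z by simp
  have "dF i z + \<delta> * (D + 2) * z i ^ (D + 1) = 0" if i: "i < n" for i
  proof (rule ccontr)
    let ?l = "dF i z + \<delta> * (D + 2) * z i ^ (D + 1)"
    let ?f = "\<lambda>s. pert n D F \<delta> (z(i := s))"
    assume ne: "?l \<noteq> 0"
    have "\<forall>\<^sub>F s in nhds (z i). z(i := s) \<in> U"
      using topological_tendstoD[OF tendsto_fun_upd U] z by simp
    with nb[OF z(1), of i] i have "\<forall>\<^sub>F s in nhds (z i). z(i := s) \<in> V \<inter> U"
      by (simp add: eventually_conj_iff)
    then obtain d where d: "d > 0" "\<And>s. dist s (z i) < d \<Longrightarrow> z(i := s) \<in> V \<inter> U"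
      unfolding eventually_nhds_metric by blast
    have "\<exists>s. dist s (z i) < d \<and> ?f s < ?f (z i)"
    proof (cases "?l > 0")
      case True
      then obtain d' where d': "d' > 0" "\<And>h. 0 < h \<Longrightarrow> h < d' \<Longrightarrow> ?f (z i - h) < ?f (z i)"
        using DERIV_pos_inc_left[OF pert_deriv[OF i]] by blast
      show ?thesis using d'(2)[of "min d d' / 2"] d d'
        by (intro exI[of _ "z i - min d d' / 2"]) (auto simp: dist_real_def min_def)
    next
      case False
      then have "?l < 0" using ne by simp
      then obtain d' where d': "d' > 0" "\<And>h. 0 < h \<Longrightarrow> h < d' \<Longrightarrow> ?f (z i + h) < ?f (z i)"
        using DERIV_neg_dec_right[OF pert_deriv[OF i]] by blast
      show ?thesis using d'(2)[of "min d d' / 2"] d d'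
        by (intro exI[of _ "z i + min d d' / 2"]) (auto simp: dist_real_def min_def)
    qed
    then obtain s where "dist s (z i) < d" "?f s < ?f (z i)" by blast
    then show False using not_less[of "z(i := s)"] d(2)[of s] z(2) i by simp
  qed
  then show ?thesis using eq by blast
qed

text \<open>The compact set \<open>V\<close> lies in a slice of constant t, hence only coordinates
  up to \<open>n\<close> may be moved; in the open set \<open>U\<close> such moves stay in
  \<open>V\<close>. Up to subsequences the minimisers at level \<epsilon> converge as \<delta> tends
  to 0, and their limits converge as \<epsilon> tends to 0 to a zero of \<open>F\<close>, where
  \<open>iso\<close> forces |u| = \<open>us\<close>.\<close>

lemma vanishing_at_minimum:
  fixes \<delta> :: "nat \<Rightarrow> real"
  assumes \<delta>: "\<And>k. \<delta> k > 0" "\<delta> \<longlonglongrightarrow> 0" and c: "\<And>j. (\<lambda>k. c k j) \<longlonglongrightarrow> c0 j"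
    and el: "\<And>k z. (\<forall>i<n. dF i z + \<delta> k * (D + 2) * z i ^ (D + 1) = 0) \<Longrightarrow>
      elim_val n D (c k) (z (n + 1)) (z n) (pert n D F (\<delta> k) z) = 0"
    and e0: "e0 \<le> elim_e n D" "\<And>a b e. a \<le> elim_t n D \<Longrightarrow> b \<le> elim_t n D \<Longrightarrow> e < e0 \<Longrightarrow> c0 (a, b, e) = 0"
    and V: "compact V" and U: "open U"
    and nb: "\<And>z i. z \<in> V \<inter> U \<Longrightarrow> i \<le> n \<Longrightarrow> \<forall>\<^sub>F s in nhds (z i). z(i := s) \<in> V"
    and t: "\<And>z. z \<in> V \<Longrightarrow> z (n + 1) = t" and us: "us > 0"
    and zK: "zK \<in> V" "F zK = 0" "\<bar>zK n\<bar> = us"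
    and iso: "\<And>z. z \<in> V \<Longrightarrow> F z = 0 \<Longrightarrow> \<bar>z n\<bar> \<le> us \<Longrightarrow> z \<in> U \<and> \<bar>z n\<bar> = us"
  shows "\<exists>u. \<bar>u\<bar> = us \<and> (\<Sum>a\<le>elim_t n D. \<Sum>b\<le>elim_t n D. c0 (a, b, e0) * (t ^ a * u ^ b)) = 0"
proof -
  have contF: "continuous_on A F" for A by (rule continuous_on_polyf[OF F])
  have contn: "continuous_on A (\<lambda>z. \<bar>z n\<bar>)" for A :: "(nat \<Rightarrow> real) set"
    by (intro continuous_intros continuous_on_subset[OF continuous_on_product_coordinates]) auto
  \<comment> \<open>On the compact set \<open>V1\<close> of bad points \<open>F\<close> is positive
    by \<open>iso\<close>, so it is bounded below there by a positive number; a sublevel set under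
    that bound avoids \<open>V1\<close>.\<close>
  obtain \<epsilon>0 where \<epsilon>0: "\<epsilon>0 > 0" "\<And>z. z \<in> V \<Longrightarrow> F z \<le> \<epsilon>0 \<Longrightarrow> \<bar>z n\<bar> \<le> us \<Longrightarrow> z \<in> U \<and> z n \<noteq> 0"
  proof -
    define V1 where "V1 = V \<inter> ({z. \<bar>z n\<bar> \<le> us} \<inter> (- U \<union> {z. \<bar>z n\<bar> \<le> 0}))"
    have "compact V1" unfolding V1_def
      by (intro compact_Int_closed V closed_Int closed_Un closed_Collect_le contn continuous_on_const)
        (use U in \<open>auto simp: closed_def\<close>)
    show thesis
    proof (cases "V1 = {}")
      case True
      show ?thesis by (rule that[of 1]) (use True in \<open>auto simp: V1_def\<close>)
    next
      case False
      then obtain z1 where z1: "z1 \<in> V1" "\<And>z. z \<in> V1 \<Longrightarrow> F z1 \<le> F z"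
        using continuous_attains_inf[OF \<open>compact V1\<close> False contF] by blast
      have "F z1 \<noteq> 0" using z1(1) iso[of z1] us by (auto simp: V1_def)
      then have "F z1 > 0" using F_nonneg[of z1] by simp
      then show ?thesis
      proof (intro that[of "F z1 / 2"])
        fix z assume z: "z \<in> V" "F z \<le> F z1 / 2" "\<bar>z n\<bar> \<le> us"
        then have "z \<notin> V1" using z1(2)[of z] \<open>F z1 > 0\<close> by auto
        then show "z \<in> U \<and> z n \<noteq> 0" using z by (auto simp: V1_def)
      qed simp
    qed
  qed
  have seqV: "seq_compact V" using V compact_imp_seq_compact by blast
  have step: "\<exists>z\<in>V. F z \<le> \<epsilon> \<and> \<bar>z n\<bar> \<le> us \<and> elim_val n D c0 t (z n) \<epsilon> = 0" if \<epsilon>: "0 < \<epsilon>" "\<epsilon> \<le> \<epsilon>0" for \<epsilon>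
  proof -
    \<comment> \<open>The perturbed value at \<open>zK\<close> tends to 0, so \<open>zK\<close>
      eventually competes in the minimisation and the minimum of |u| is at most
      \<open>us\<close>.\<close>
    have "(\<lambda>k. \<delta> k * (\<Sum>i<n. zK i ^ (D + 2))) \<longlonglongrightarrow> 0 * (\<Sum>i<n. zK i ^ (D + 2))"
      by (intro tendsto_intros \<delta>)
    then have "\<forall>\<^sub>F k in sequentially. \<delta> k * (\<Sum>i<n. zK i ^ (D + 2)) < \<epsilon>"
      using \<epsilon> by (intro order_tendstoD) auto
    then obtain k0 where k0: "\<And>k. k \<ge> k0 \<Longrightarrow> pert n D F (\<delta> k) zK \<le> \<epsilon>"
      unfolding eventually_sequentially pert_def zK by (metis add.left_neutral less_imp_le)
    have "\<exists>z. z \<in> V \<and> F z \<le> \<epsilon> \<and> \<bar>z n\<bar> \<le> us \<and> elim_val n D (c k) t (z n) \<epsilon> = 0" if k: "k \<ge> k0" for k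
    proof -
      let ?W = "V \<inter> {z. pert n D F (\<delta> k) z \<le> \<epsilon>}"
      have "compact ?W"
        by (intro compact_Int_closed V closed_Collect_le continuous_on_pert continuous_on_const)
      moreover have zKW: "zK \<in> ?W" using zK k0[OF k] by simp
      ultimately obtain z where z: "z \<in> ?W" "\<And>y. y \<in> ?W \<Longrightarrow> \<bar>z n\<bar> \<le> \<bar>y n\<bar>"
        using continuous_attains_inf[of ?W "\<lambda>z. \<bar>z n\<bar>", OF _ _ contn] by blast
      have le: "\<bar>z n\<bar> \<le> us" using z(2)[OF zKW] zK by simp
      have "F z \<le> pert n D F (\<delta> k) z" using pert_ge \<delta>(1)[of k] by simp
      then have Fz: "F z \<le> \<epsilon>" using z(1) by simp
      then have zU: "z \<in> U" "z n \<noteq> 0" using \<epsilon>0(2)[of z] z(1) le \<epsilon> by auto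
      have crit: "pert n D F (\<delta> k) z = \<epsilon> \<and> (\<forall>i<n. dF i z + \<delta> k * (D + 2) * z i ^ (D + 1) = 0)"
        by (rule minimizer_critical[OF U nb]) (use z zU in auto)
      then have "elim_val n D (c k) t (z n) \<epsilon> = 0" using el[of z k] t[of z] z(1) by auto
      then show ?thesis using z Fz le by auto
    qed
    then have "\<forall>k. \<exists>z. z \<in> V \<and> F z \<le> \<epsilon> \<and> \<bar>z n\<bar> \<le> us \<and> elim_val n D (c (k + k0)) t (z n) \<epsilon> = 0" by simp
    then obtain z where z: "\<And>k. z k \<in> V" "\<And>k. F (z k) \<le> \<epsilon>" "\<And>k. \<bar>z k n\<bar> \<le> us"
      "\<And>k. elim_val n D (c (k + k0)) t (z k n) \<epsilon> = 0"
      using choice[of "\<lambda>k z. z \<in> V \<and> F z \<le> \<epsilon> \<and> \<bar>z n\<bar> \<le> us \<and> elim_val n D (c (k + k0)) t (z n) \<epsilon> = 0"] by blast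
    obtain l r where l: "l \<in> V" "strict_mono r" "(z \<circ> r) \<longlonglongrightarrow> l"
      using seqV z(1) unfolding seq_compact_def by blast
    have lim_n: "(\<lambda>k. z (r k) n) \<longlonglongrightarrow> l n" using tendsto_coordinate[OF l(3)] by (simp add: comp_def)
    have "(\<lambda>k. F ((z \<circ> r) k)) \<longlonglongrightarrow> F l"
      using continuous_on_tendsto_compose[OF contF[of UNIV] l(3)] by simp
    then have "F l \<le> \<epsilon>" using z(2) by (intro LIMSEQ_le_const2) auto
    moreover have "\<bar>l n\<bar> \<le> us" using z(3) tendsto_rabs[OF lim_n] by (intro LIMSEQ_le_const2) auto
    moreover have "elim_val n D c0 t (l n) \<epsilon> = 0"
    proof -
      have "(\<lambda>k. c (r k + k0) j) \<longlonglongrightarrow> c0 j" for j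
        using LIMSEQ_subseq_LIMSEQ[OF LIMSEQ_ignore_initial_segment[OF c[of j], of k0] l(2)] by (simp add: comp_def)
      then have "(\<lambda>k. elim_val n D (\<lambda>j. c (r k + k0) j) t (z (r k) n) \<epsilon>) \<longlonglongrightarrow> elim_val n D c0 t (l n) \<epsilon>"
        by (intro tendsto_elim_val lim_n tendsto_const)
      then show ?thesis unfolding z(4) by (simp add: LIMSEQ_const_iff)
    qed
    ultimately show ?thesis using l(1) by blast
  qed
  define \<epsilon> where "\<epsilon> = (\<lambda>j. \<epsilon>0 * inverse (real (Suc j)))"
  have \<epsilon>: "0 < \<epsilon> j" "\<epsilon> j \<le> \<epsilon>0" for j using \<epsilon>0(1) by (auto simp: \<epsilon>_def field_simps)
  have \<epsilon>_lim: "\<epsilon> \<longlonglongrightarrow> 0"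
    unfolding \<epsilon>_def using tendsto_mult_right_zero[OF LIMSEQ_inverse_real_of_nat] by blast
  have "\<forall>j. \<exists>z. z \<in> V \<and> F z \<le> \<epsilon> j \<and> \<bar>z n\<bar> \<le> us \<and> elim_val n D c0 t (z n) (\<epsilon> j) = 0" using step[OF \<epsilon>] by blast
  then obtain z where z: "\<And>k. z k \<in> V" "\<And>k. F (z k) \<le> \<epsilon> k" "\<And>k. \<bar>z k n\<bar> \<le> us"
    "\<And>k. elim_val n D c0 t (z k n) (\<epsilon> k) = 0"
    using choice[of "\<lambda>j z. z \<in> V \<and> F z \<le> \<epsilon> j \<and> \<bar>z n\<bar> \<le> us \<and> elim_val n D c0 t (z n) (\<epsilon> j) = 0"] by blast
  obtain l r where l: "l \<in> V" "strict_mono r" "(z \<circ> r) \<longlonglongrightarrow> l"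
    using seqV z(1) unfolding seq_compact_def by blast
  have lim_n: "(\<lambda>k. z (r k) n) \<longlonglongrightarrow> l n" using tendsto_coordinate[OF l(3)] by (simp add: comp_def)
  have lim_e: "(\<lambda>k. \<epsilon> (r k)) \<longlonglongrightarrow> 0" using LIMSEQ_subseq_LIMSEQ[OF \<epsilon>_lim l(2)] by (simp add: comp_def)
  have "(\<lambda>k. F ((z \<circ> r) k)) \<longlonglongrightarrow> F l"
    using continuous_on_tendsto_compose[OF contF[of UNIV] l(3)] by simp
  then have "F l \<le> 0" by (rule LIMSEQ_le[OF _ lim_e]) (use z(2) in auto)
  then have Fl: "F l = 0" using F_nonneg[of l] by simp
  have "\<bar>l n\<bar> \<le> us" using z(3) tendsto_rabs[OF lim_n] by (intro LIMSEQ_le_const2) auto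
  then have ln: "\<bar>l n\<bar> = us" using iso[OF l(1) Fl] by blast
  \<comment> \<open>The sum divided by \<open>s ^ e0\<close>, possible because the coefficients of
    lower powers of s vanish. Setting s = 0 afterwards leaves exactly the terms with
    \<open>e = e0\<close>.\<close>
  define G where "G = (\<lambda>u s. \<Sum>a\<le>elim_t n D. \<Sum>b\<le>elim_t n D. \<Sum>e\<le>elim_e n D.
    (if e < e0 then 0 else c0 (a, b, e) * (t ^ a * u ^ b * s ^ (e - e0))))"
  have "elim_val n D c0 t u s = s ^ e0 * G u s" for u s
    unfolding elim_val_triple G_def sum_distrib_left
  proof (intro sum.cong refl)
    fix a b e assume "a \<in> {..elim_t n D}" "b \<in> {..elim_t n D}"
    then show "c0 (a, b, e) * (t ^ a * u ^ b * s ^ e) =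
        s ^ e0 * (if e < e0 then 0 else c0 (a, b, e) * (t ^ a * u ^ b * s ^ (e - e0)))"
      using e0(2)[of a b e] power_add[of s e0 "e - e0"] by (cases "e < e0") auto
  qed
  then have "G (z k n) (\<epsilon> k) = 0" for k using z(4)[of k] \<epsilon>(1)[of k] by simp
  moreover have "(\<lambda>k. G (z (r k) n) (\<epsilon> (r k))) \<longlonglongrightarrow> G (l n) 0"
    unfolding G_def
  proof (intro tendsto_sum)
    fix a b e
    show "(\<lambda>k. if e < e0 then 0 else c0 (a, b, e) * (t ^ a * z (r k) n ^ b * \<epsilon> (r k) ^ (e - e0)))
      \<longlonglongrightarrow> (if e < e0 then 0 else c0 (a, b, e) * (t ^ a * l n ^ b * 0 ^ (e - e0)))"
      by (cases "e < e0") (auto intro!: tendsto_intros lim_n lim_e)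
  qed
  ultimately have "G (l n) 0 = 0" by (simp add: LIMSEQ_const_iff)
  moreover have "G (l n) 0 = (\<Sum>a\<le>elim_t n D. \<Sum>b\<le>elim_t n D. c0 (a, b, e0) * (t ^ a * l n ^ b))"
    unfolding G_def
  proof (intro sum.cong refl)
    fix a b
    have "(\<Sum>e\<le>elim_e n D. if e < e0 then 0 else c0 (a, b, e) * (t ^ a * l n ^ b * 0 ^ (e - e0))) =
        (\<Sum>e\<le>elim_e n D. if e = e0 then c0 (a, b, e0) * (t ^ a * l n ^ b) else 0)"
      by (intro sum.cong refl) auto
    also have "\<dots> = c0 (a, b, e0) * (t ^ a * l n ^ b)" using e0(1) by simp
    finally show "(\<Sum>e\<le>elim_e n D. if e < e0 then 0 else c0 (a, b, e) * (t ^ a * l n ^ b * 0 ^ (e - e0))) =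
        c0 (a, b, e0) * (t ^ a * l n ^ b)" .
  qed
  ultimately show ?thesis using ln by auto
qed

end

text \<open>The order of the quantifiers is the point: \<open>C\<close> and \<open>t0\<close> come
  from the limit polynomial belonging to \<open>F\<close> and are fixed before the slice, the sets
  \<open>V\<close> and \<open>U\<close> and the minimum \<open>us\<close>.\<close>

lemma isolated_min_bound:
  assumes F: "polyf (n + 2) D F" and F_nonneg: "\<And>z. 0 \<le> F z" and D: "even D"
  shows "\<exists>C t0. 0 < C \<and> 0 < t0 \<and> (\<forall>t us V U zK. \<bar>t\<bar> < t0 \<longrightarrow> us > 0 \<longrightarrow> compact V \<longrightarrow> open U \<longrightarrow>
    (\<forall>z\<in>V \<inter> U. \<forall>i\<le>n. \<forall>\<^sub>F s in nhds (z i). z(i := s) \<in> V) \<longrightarrow> (\<forall>z\<in>V. z (n + 1) = t) \<longrightarrow>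
    zK \<in> V \<longrightarrow> F zK = 0 \<longrightarrow> \<bar>zK n\<bar> = us \<longrightarrow>
    (\<forall>z\<in>V. F z = 0 \<longrightarrow> \<bar>z n\<bar> \<le> us \<longrightarrow> z \<in> U \<and> \<bar>z n\<bar> = us) \<longrightarrow> \<bar>t\<bar> ^ elim_t n D \<le> C * us)"
proof -
  have "\<forall>i. i < n \<longrightarrow> (\<exists>p'. polyf (n + 2) (D - 1) p' \<and> (\<forall>z. ((\<lambda>s. F (z(i := s))) has_real_derivative p' z) (at (z i))))"
    using polyf_deriv[OF F] by simp
  then obtain dF where dF: "\<And>i. i < n \<Longrightarrow> polyf (n + 2) (D - 1) (dF i)"
    "\<And>i z. i < n \<Longrightarrow> ((\<lambda>s. F (z(i := s))) has_real_derivative dF i z) (at (z i))"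
    by metis
  define L where "L = (\<lambda>(\<delta> :: nat \<Rightarrow> real) c c0. (\<forall>k. \<delta> k > 0) \<and> \<delta> \<longlonglongrightarrow> 0 \<and> (\<forall>j. (\<lambda>k. c k j) \<longlonglongrightarrow> c0 j) \<and>
    (\<exists>j\<in>elim_box n D. c0 j \<noteq> 0) \<and>
    (\<forall>k z. (\<forall>i<n. dF i z + \<delta> k * (D + 2) * z i ^ (D + 1) = 0) \<longrightarrow>
      elim_val n D (c k) (z (n + 1)) (z n) (pert n D F (\<delta> k) z) = 0))"
  have "\<exists>\<delta> c c0. L \<delta> c c0" unfolding L_def by (rule elimination_limit[OF F dF(1)])
  then obtain \<delta> c c0 where "L \<delta> c c0" by blast
  then have dc: "\<And>k. \<delta> k > 0" "\<delta> \<longlonglongrightarrow> 0" "\<And>j. (\<lambda>k. c k j) \<longlonglongrightarrow> c0 j"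
    "\<exists>j\<in>elim_box n D. c0 j \<noteq> 0"
    "\<And>k z. (\<forall>i<n. dF i z + \<delta> k * (D + 2) * z i ^ (D + 1) = 0) \<Longrightarrow>
      elim_val n D (c k) (z (n + 1)) (z n) (pert n D F (\<delta> k) z) = 0"
    unfolding L_def by blast+
  let ?T = "elim_t n D"
  let ?P = "\<lambda>e. e \<le> elim_e n D \<and> (\<exists>a\<le>?T. \<exists>b\<le>?T. c0 (a, b, e) \<noteq> 0)"
  \<comment> \<open>The lowest power of s that occurs in the limit polynomial; its coefficient is
    the nonzero polynomial in t and u.\<close>
  define e0 where "e0 = (LEAST e. ?P e)"
  have "\<exists>e. ?P e" using dc(4) by (auto simp: elim_box_def)
  then have e0: "?P e0" unfolding e0_def by (rule LeastI_ex)
  have e0_min: "c0 (a, b, e) = 0" if "a \<le> ?T" "b \<le> ?T" "e < e0" for a b e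
    using not_less_Least[of e ?P] that e0 unfolding e0_def by fastforce
  obtain C t0 where C: "0 < C" "0 < t0" "\<And>t u. \<bar>t\<bar> < t0 \<Longrightarrow> u \<noteq> 0 \<Longrightarrow>
    (\<Sum>a\<le>?T. \<Sum>b\<le>?T. c0 (a, b, e0) * (t ^ a * u ^ b)) = 0 \<Longrightarrow> \<bar>t\<bar> ^ ?T \<le> C * \<bar>u\<bar>"
    using bivariate_root_bound[of ?T "\<lambda>a b. c0 (a, b, e0)"] e0 by blast
  show ?thesis
  proof (rule exI[of _ C], rule exI[of _ t0], intro conjI C(1,2) allI impI)
    fix t us V U zK
    assume h: "\<bar>t\<bar> < t0" "us > 0" "compact V" "open U"
      "\<forall>z\<in>V \<inter> U. \<forall>i\<le>n. \<forall>\<^sub>F s in nhds (z i). z(i := s) \<in> V" "\<forall>z\<in>V. z (n + 1) = t"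
      "zK \<in> V" "F zK = 0" "\<bar>zK n\<bar> = us"
      "\<forall>z\<in>V. F z = 0 \<longrightarrow> \<bar>z n\<bar> \<le> us \<longrightarrow> z \<in> U \<and> \<bar>z n\<bar> = us"
    have "\<exists>u. \<bar>u\<bar> = us \<and> (\<Sum>a\<le>?T. \<Sum>b\<le>?T. c0 (a, b, e0) * (t ^ a * u ^ b)) = 0"
      by (rule vanishing_at_minimum[OF F F_nonneg D dF(2) dc(1,2,3,5) _ _ h(3,4) _ _ h(2,7,8,9)])
        (use h e0 e0_min in auto)
    then obtain u where u: "\<bar>u\<bar> = us" "(\<Sum>a\<le>?T. \<Sum>b\<le>?T. c0 (a, b, e0) * (t ^ a * u ^ b)) = 0" by blast
    then show "\<bar>t\<bar> ^ ?T \<le> C * us" using C(3)[OF h(1) _ u(2)] h(2) by auto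
  qed
qed

section \<open>From isolated minima to compact sets given by sign conditions\<close>

lemma open_sign_conditions:
  assumes "finite P" "\<And>p. p \<in> P \<Longrightarrow> continuous_on UNIV p"
  shows "open {z :: nat \<Rightarrow> real. (\<forall>i\<le>m. \<bar>z i\<bar> < R i) \<and> (\<forall>p\<in>P. c < \<sigma> p * (p z :: real))}"
proof -
  have "{z. (\<forall>i\<le>m. \<bar>z i\<bar> < R i) \<and> (\<forall>p\<in>P. c < \<sigma> p * p z)} =
      (\<Inter>i\<in>{..m}. {z. \<bar>z i\<bar> < R i}) \<inter> (\<Inter>p\<in>P. {z. c < \<sigma> p * p z})" by auto
  moreover have "open \<dots>"
    using assms by (intro open_Int open_INT ballI open_Collect_less continuous_intros continuous_on_product_coordinates) auto
  ultimately show ?thesis by simp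
qed

text \<open>Semialgebraicity enters through \<open>signs\<close>: membership depends on the signs of
  the polynomials in \<F>. The subset \<open>E\<close> that isolates the minimum varies with t, so
  the constants are combined over all subsets of \<F>.\<close>

lemma compact_lojasiewicz:
  fixes S :: "(nat \<Rightarrow> real) set" and \<F> :: "((nat \<Rightarrow> real) \<Rightarrow> real) set"
  assumes fin: "finite \<F>" and poly: "\<And>p. p \<in> \<F> \<Longrightarrow> polyf (n + 2) d p"
    and S: "compact S" "S \<subseteq> space (n + 2)"
    and signs: "\<And>z z'. z \<in> S \<Longrightarrow> z' \<in> space (n + 2) \<Longrightarrow> (\<And>p. p \<in> \<F> \<Longrightarrow> sgn (p z) = sgn (p z')) \<Longrightarrow> z' \<in> S"
    and zero: "\<And>z. z \<in> S \<Longrightarrow> z n = 0 \<Longrightarrow> z (n + 1) = 0"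
  shows "\<exists>C t0. 0 < C \<and> 0 < t0 \<and> (\<forall>z\<in>S. z (n + 1) \<noteq> 0 \<longrightarrow> \<bar>z (n + 1)\<bar> < t0 \<longrightarrow>
    \<bar>z (n + 1)\<bar> ^ elim_t n (2 * d) \<le> C * \<bar>z n\<bar>)"
proof -
  let ?T = "elim_t n (2 * d)"
  define F where "F = (\<lambda>E (z :: nat \<Rightarrow> real). \<Sum>p\<in>E. (p z)\<^sup>2 :: real)"
  have F_poly: "polyf (n + 2) (2 * d) (F E)" if "E \<subseteq> \<F>" for E
    unfolding F_def using that poly by (intro polyf_sum polyf_power) auto
  have F_nonneg: "0 \<le> F E z" for E z unfolding F_def by (intro sum_nonneg) auto
  define H where "H = (\<lambda>E C t0. 0 < C \<and> 0 < t0 \<and> (\<forall>t us V U zK. \<bar>t\<bar> < t0 \<longrightarrow> us > 0 \<longrightarrow> compact V \<longrightarrow> open U \<longrightarrow>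
    (\<forall>z\<in>V \<inter> U. \<forall>i\<le>n. \<forall>\<^sub>F s in nhds (z i). z(i := s) \<in> V) \<longrightarrow> (\<forall>z\<in>V. z (n + 1) = t) \<longrightarrow>
    zK \<in> V \<longrightarrow> F E zK = 0 \<longrightarrow> \<bar>zK n\<bar> = us \<longrightarrow>
    (\<forall>z\<in>V. F E z = 0 \<longrightarrow> \<bar>z n\<bar> \<le> us \<longrightarrow> z \<in> U \<and> \<bar>z n\<bar> = us) \<longrightarrow> \<bar>t\<bar> ^ ?T \<le> C * us))"
  have "\<exists>C t0. H E C t0" if "E \<subseteq> \<F>" for E
    unfolding H_def by (rule isolated_min_bound[OF F_poly[OF that] F_nonneg]) simp
  then obtain C t0 where H: "\<And>E. E \<subseteq> \<F> \<Longrightarrow> H E (C E) (t0 E)" by metis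
  have Cpos: "0 < C E" "0 < t0 E" if "E \<subseteq> \<F>" for E using H[OF that] by (auto simp: H_def)
  define C1 where "C1 = (\<Sum>E\<in>Pow \<F>. C E)"
  define t1 where "t1 = Min (t0 ` Pow \<F>)"
  have finP: "finite (Pow \<F>)" using fin by simp
  have C1: "0 < C1" unfolding C1_def using finP Cpos by (intro sum_pos) auto
  have t1: "0 < t1" unfolding t1_def using finP Cpos by (subst Min_gr_iff) auto
  have C_le: "C E \<le> C1" if "E \<subseteq> \<F>" for E
    unfolding C1_def using that finP Cpos by (intro member_le_sum) (auto intro: less_imp_le)
  have t_le: "t1 \<le> t0 E" if "E \<subseteq> \<F>" for E
    unfolding t1_def using that finP by (intro Min_le) auto
  have contp: "continuous_on A p" if "p \<in> \<F>" for p A using continuous_on_polyf[OF poly[OF that]] .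
  have contc: "continuous_on A (\<lambda>z. z i)" for i and A :: "(nat \<Rightarrow> real) set"
    by (rule continuous_on_subset[OF continuous_on_product_coordinates]) simp
  have "\<bar>zz (n + 1)\<bar> ^ ?T \<le> C1 * \<bar>zz n\<bar>" if zz: "zz \<in> S" "zz (n + 1) \<noteq> 0" "\<bar>zz (n + 1)\<bar> < t1" for zz
  proof -
    define t where "t = zz (n + 1)"
    define St where "St = S \<inter> {z. z (n + 1) = t}"
    have St: "compact St" unfolding St_def
      by (intro compact_Int_closed S closed_Collect_eq contc continuous_on_const)
    have zzSt: "zz \<in> St" using zz by (simp add: St_def t_def)
    then obtain zm where zm: "zm \<in> St" "\<And>z. z \<in> St \<Longrightarrow> \<bar>zm n\<bar> \<le> \<bar>z n\<bar>"
      using continuous_attains_inf[of St "\<lambda>z. \<bar>z n\<bar>", OF St _ continuous_on_rabs[OF contc]] by blast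
    define us where "us = \<bar>zm n\<bar>"
    have us: "us > 0" using zero[of zm] zm zz unfolding us_def St_def t_def by auto
    define M where "M = St \<inter> {z. \<bar>z n\<bar> = us}"
    have zmM: "zm \<in> M" using zm by (simp add: M_def us_def)
    define van where "van = (\<lambda>z. {p \<in> \<F>. p z = 0})"
    have van_fin: "finite (van z)" "card (van z) \<le> card \<F>" for z
      using fin by (auto simp: van_def intro: card_mono)
    obtain z0 where z0: "z0 \<in> M" "\<And>z. z \<in> M \<Longrightarrow> card (van z) \<le> card (van z0)"
      using ex_has_greatest_nat[of "\<lambda>z. z \<in> M" zm "\<lambda>z. card (van z)" "Suc (card \<F>)"] zmM van_fin(2)
      by (auto simp: less_Suc_eq_le)
    define E where "E = van z0"
    have E: "E \<subseteq> \<F>" by (auto simp: E_def van_def)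
    define \<sigma> where "\<sigma> = (\<lambda>p. sgn (p z0) :: real)"
    have \<sigma>: "\<sigma> p \<noteq> 0" if "p \<in> \<F> - E" for p using that by (auto simp: \<sigma>_def E_def van_def sgn_eq_0_iff)
    define K where "K = M \<inter> ((\<Inter>p\<in>E. {z. p z = 0}) \<inter> (\<Inter>p\<in>\<F> - E. {z. 0 \<le> \<sigma> p * p z}))"
    have "compact M" unfolding M_def
      by (intro compact_Int_closed St closed_Collect_eq continuous_on_rabs contc continuous_on_const)
    then have K: "compact K" unfolding K_def
      using E by (intro compact_Int_closed closed_Int closed_INT ballI closed_Collect_eq closed_Collect_le
        continuous_on_const continuous_on_mult contp) auto
    have z0K: "z0 \<in> K" using z0(1) by (auto simp: K_def E_def van_def \<sigma>_def sgn_if)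
    \<comment> \<open>A further polynomial vanishing at a point of \<open>K\<close> would contradict
      the maximality of \<open>E\<close>. Thus the weak inequalities in \<open>K\<close> are strict,
      and compactness keeps the values above some \<open>\<mu> > 0\<close>.\<close>
    have Kpos: "0 < \<sigma> p * p z" if z: "z \<in> K" and p: "p \<in> \<F> - E" for z p
    proof -
      have "p z \<noteq> 0"
      proof
        assume "p z = 0"
        then have "insert p E \<subseteq> van z" using z p E by (auto simp: K_def van_def)
        then have "card (insert p E) \<le> card (van z)" using van_fin by (intro card_mono)
        moreover have "card (insert p E) = Suc (card E)" using p van_fin(1)[of z0] by (simp add: E_def)
        ultimately show False using z0(2)[of z] z by (simp add: K_def E_def)
      qed
      then show ?thesis using z p \<sigma>[OF p] by (auto simp: K_def order_le_less)
    qed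
    have "\<exists>\<mu>>0. \<forall>z\<in>K. \<mu> \<le> \<sigma> p * p z" if p: "p \<in> \<F> - E" for p
    proof -
      have "continuous_on K (\<lambda>z. \<sigma> p * p z)" using p by (intro continuous_on_mult continuous_on_const contp) auto
      then obtain z1 where "z1 \<in> K" "\<And>z. z \<in> K \<Longrightarrow> \<sigma> p * p z1 \<le> \<sigma> p * p z"
        using continuous_attains_inf[of K "\<lambda>z. \<sigma> p * p z", OF K] z0K by blast
      then show ?thesis using Kpos p by blast
    qed
    then obtain \<mu>' where \<mu>': "\<And>p. p \<in> \<F> - E \<Longrightarrow> \<mu>' p > 0" "\<And>p z. p \<in> \<F> - E \<Longrightarrow> z \<in> K \<Longrightarrow> \<mu>' p \<le> \<sigma> p * p z"
      by metis
    define \<mu> where "\<mu> = Min (insert 1 (\<mu>' ` (\<F> - E)))"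
    have \<mu>: "\<mu> > 0" unfolding \<mu>_def using fin \<mu>' by (subst Min_gr_iff) auto
    have \<mu>_le: "\<mu> \<le> \<sigma> p * p z" if "p \<in> \<F> - E" "z \<in> K" for p z
    proof -
      have "\<mu> \<le> \<mu>' p" unfolding \<mu>_def using fin that by (intro Min_le) auto
      then show ?thesis using \<mu>'(2)[OF that] by simp
    qed
    have "\<exists>r. \<forall>z\<in>K. \<bar>z i\<bar> \<le> r" for i
    proof -
      obtain z1 where "\<And>z. z \<in> K \<Longrightarrow> \<bar>z i\<bar> \<le> \<bar>z1 i\<bar>"
        using continuous_attains_sup[of K "\<lambda>z. \<bar>z i\<bar>", OF K _ continuous_on_rabs[OF contc]] z0K by blast
      then show ?thesis by blast
    qed
    then obtain r where r: "\<And>i z. z \<in> K \<Longrightarrow> \<bar>z i\<bar> \<le> r i" by metis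
    \<comment> \<open>The box leaves room 1 around \<open>K\<close> in the coordinates up to
      \<open>n\<close> and forces 0 beyond \<open>n + 1\<close>. The sets \<open>U\<close> and
      \<open>V\<close> ask for half of the margin \<open>\<mu>\<close> only, so \<open>K\<close>
      lies inside both.\<close>
    define B where "B = (\<lambda>i. if i \<le> n then r i + 1 else if i = n + 1 then \<bar>t\<bar> else 0)"
    define U where "U = {z. (\<forall>i\<le>n. \<bar>z i\<bar> < r i + 1) \<and> (\<forall>p\<in>\<F> - E. \<mu> / 2 < \<sigma> p * p z)}"
    define V where "V = {z. \<forall>i. \<bar>z i\<bar> \<le> B i} \<inter> ({z. z (n + 1) = t} \<inter> (\<Inter>p\<in>\<F> - E. {z. \<mu> / 2 \<le> \<sigma> p * p z}))"
    have oU: "open U" unfolding U_def by (rule open_sign_conditions) (use fin contp in auto)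
    have cV: "compact V" unfolding V_def
      by (intro compact_Int_closed compact_box closed_Int closed_INT ballI closed_Collect_eq closed_Collect_le
        continuous_on_const continuous_on_mult contp contc) auto
    have nb: "\<forall>\<^sub>F s in nhds (z i). z(i := s) \<in> V" if z: "z \<in> V \<inter> U" and i: "i \<le> n" for z i
    proof -
      have "\<forall>\<^sub>F s in nhds (z i). z(i := s) \<in> U"
        using topological_tendstoD[OF tendsto_fun_upd oU] z by simp
      then show ?thesis
      proof (rule eventually_mono)
        fix s assume s: "z(i := s) \<in> U"
        have "\<bar>(z(i := s)) j\<bar> \<le> B j" for j
        proof (cases "j \<le> n")
          case True
          then have "\<bar>(z(i := s)) j\<bar> < r j + 1" using s unfolding U_def by blast
          then show ?thesis using True by (simp add: B_def)
        next
          case False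
          then have "(z(i := s)) j = z j" using i by auto
          then show ?thesis using z unfolding V_def by simp
        qed
        moreover have "(z(i := s)) (n + 1) = t" using z i unfolding V_def by auto
        ultimately show "z(i := s) \<in> V" using s unfolding V_def U_def by (auto intro: less_imp_le)
      qed
    qed
    have KV: "z \<in> V" if "z \<in> K" for z
    proof -
      have sp: "z \<in> S" "z (n + 1) = t" using that by (auto simp: K_def M_def St_def)
      have "\<bar>z i\<bar> \<le> B i" for i
      proof -
        consider "i \<le> n" | "i = n + 1" | "i \<ge> n + 2" by linarith
        then show ?thesis
        proof cases
          case 1
          then show ?thesis using r[OF \<open>z \<in> K\<close>, of i] by (simp add: B_def)
        next
          case 2
          then show ?thesis using sp(2) by (simp add: B_def)
        next
          case 3
          then show ?thesis using sp(1) S(2) by (auto simp: Defs.space_def B_def)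
        qed
      qed
      moreover have "\<mu> / 2 \<le> \<sigma> p * p z" if "p \<in> \<F> - E" for p using \<mu>_le[OF that \<open>z \<in> K\<close>] \<mu> by simp
      ultimately show ?thesis using sp by (simp add: V_def)
    qed
    \<comment> \<open>A zero of \<open>F E\<close> in \<open>V\<close> has the signs of
      \<open>z0\<close> on all of \<F>, so it belongs to \<open>S\<close>. Minimality of
      \<open>us\<close> gives equality, and the point lies in \<open>K\<close>, hence in
      \<open>U\<close>.\<close>
    have iso: "z \<in> U \<and> \<bar>z n\<bar> = us" if z: "z \<in> V" "F E z = 0" "\<bar>z n\<bar> \<le> us" for z
    proof -
      have finE: "finite E" using E fin finite_subset by blast
      have Ez: "p z = 0" if "p \<in> E" for p
        using z(2) that finE unfolding F_def by (simp add: sum_nonneg_eq_0_iff)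
      have posp: "0 < \<sigma> p * p z" if "p \<in> \<F> - E" for p
        using z(1) that \<mu> unfolding V_def by (fastforce intro: order_less_le_trans[of 0 "\<mu> / 2"])
      have "sgn (p z0) = sgn (p z)" if "p \<in> \<F>" for p
      proof (cases "p \<in> E")
        case True
        then have "p z0 = 0" by (simp add: E_def van_def)
        then show ?thesis using Ez[OF True] by simp
      next
        case False
        then have "0 < \<sigma> p * p z" using posp that by blast
        then show ?thesis unfolding \<sigma>_def by (auto simp: sgn_if zero_less_mult_iff split: if_splits)
      qed
      moreover have "z i = 0" if "i \<ge> n + 2" for i
      proof -
        have "\<bar>z i\<bar> \<le> B i" using z(1) by (simp add: V_def)
        then show ?thesis using that by (simp add: B_def)
      qed
      then have "z \<in> space (n + 2)" by (simp add: Defs.space_def)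
      moreover have "z0 \<in> S" using z0(1) by (simp add: M_def St_def)
      ultimately have "z \<in> S" using signs by blast
      then have "z \<in> St" using z(1) by (simp add: St_def V_def)
      then have eq: "\<bar>z n\<bar> = us" using zm(2)[of z] z(3) by (simp add: us_def)
      then have "z \<in> M" using \<open>z \<in> St\<close> by (simp add: M_def)
      then have zK: "z \<in> K" using Ez posp by (auto simp: K_def intro: less_imp_le)
      have "\<mu> / 2 < \<sigma> p * p z" if "p \<in> \<F> - E" for p using \<mu>_le[OF that zK] \<mu> by simp
      moreover have "\<bar>z i\<bar> < r i + 1" for i using r[OF zK, of i] by simp
      ultimately show ?thesis using eq by (simp add: U_def)
    qed
    have Fz0: "F E z0 = 0" unfolding F_def E_def van_def by simp
    have z0n: "\<bar>z0 n\<bar> = us" using z0(1) by (simp add: M_def)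
    have tV: "z (n + 1) = t" if "z \<in> V" for z using that by (simp add: V_def)
    have t_lt: "\<bar>t\<bar> < t0 E" using zz(3) t_le[OF E] by (simp add: t_def)
    have nb': "\<forall>z\<in>V \<inter> U. \<forall>i\<le>n. \<forall>\<^sub>F s in nhds (z i). z(i := s) \<in> V" using nb by blast
    have tV': "\<forall>z\<in>V. z (n + 1) = t" using tV by blast
    have iso': "\<forall>z\<in>V. F E z = 0 \<longrightarrow> \<bar>z n\<bar> \<le> us \<longrightarrow> z \<in> U \<and> \<bar>z n\<bar> = us" using iso by blast
    have "\<bar>t\<bar> ^ ?T \<le> C E * us"
      by (rule H[OF E, unfolded H_def, THEN conjunct2, THEN conjunct2, THEN spec, THEN spec,
        THEN spec, THEN spec, THEN spec, THEN mp, THEN mp, THEN mp, THEN mp, THEN mp, THEN mp,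
        THEN mp, THEN mp, THEN mp, THEN mp, OF t_lt us cV oU nb' tV' KV[OF z0K] Fz0 z0n iso'])
    also have "\<dots> \<le> C1 * us" using C_le[OF E] us by (intro mult_right_mono) auto
    also have "\<dots> \<le> C1 * \<bar>zz n\<bar>" using zm(2)[OF zzSt] C1 by (simp add: us_def)
    finally show ?thesis by (simp add: t_def)
  qed
  then show ?thesis using C1 t1 by blast
qed

section \<open>The local statement over the reals\<close>

lemma finite_qf_polys: "finite (qf_polys \<phi>)"
  by (induction \<phi>) auto

lemma qf_sat_cong:
  "(\<And>p. p \<in> qf_polys \<phi> \<Longrightarrow> sgn (mpoly_eval p x) = sgn (mpoly_eval p y)) \<Longrightarrow> qf_sat \<phi> x = qf_sat \<phi> y"
  by (induction \<phi>) (auto simp: sgn_if split: if_splits)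

lemma polyf_mpoly_eval:
  assumes p: "p \<in> polys_le k d" and y: "\<And>j. j < k \<Longrightarrow> polyf m 1 (\<lambda>z. y z j)"
  shows "polyf m d (\<lambda>z. mpoly_eval p (y z))"
  unfolding mpoly_eval_def
proof (intro polyf_sum polyf_scale)
  fix mo assume mo: "mo \<in> Poly_Mapping.keys p"
  have "(\<Sum>j\<in>Poly_Mapping.keys mo. Poly_Mapping.lookup mo j) \<le> total_degree p"
    unfolding total_degree_def using mo by (intro Max_ge) auto
  also have "\<dots> \<le> d" using p by (simp add: polys_le_def)
  finally have le: "(\<Sum>j\<in>Poly_Mapping.keys mo. Poly_Mapping.lookup mo j * 1) \<le> d" by simp
  have "j < k" if "j \<in> Poly_Mapping.keys mo" for j
    using p mo that unfolding polys_le_def vars_in_def by auto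
  then have "polyf m (\<Sum>j\<in>Poly_Mapping.keys mo. Poly_Mapping.lookup mo j * 1)
      (\<lambda>z. \<Prod>j\<in>Poly_Mapping.keys mo. y z j ^ Poly_Mapping.lookup mo j)"
    by (intro polyf_prod polyf_power y) auto
  then show "polyf m d (\<lambda>z. \<Prod>j\<in>Poly_Mapping.keys mo. y z j ^ Poly_Mapping.lookup mo j)"
    using le by (rule polyf_mono)
qed

lemma in_space_trunc: "trunc n z \<in> space n"
  by (simp add: trunc_def Defs.space_def)

lemma trunc_upd: "x \<in> space n \<Longrightarrow> trunc n (x(n := u)) = x"
  by (auto simp: trunc_def Defs.space_def fun_eq_iff)

lemma upd_in_space: "x \<in> space n \<Longrightarrow> x(n := u) \<in> space (Suc n)"
  by (auto simp: Defs.space_def)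

lemma space_Suc_eq: "z \<in> space (Suc n) \<Longrightarrow> z = (trunc n z)(n := z n)"
  by (auto simp: trunc_def Defs.space_def fun_eq_iff not_less_eq_eq Suc_le_eq)

lemma upd_in_graph:
  "x \<in> space n \<Longrightarrow> x(n := u) \<in> graph n A f \<longleftrightarrow> x \<in> A \<and> u = f x"
  by (simp add: Defs.graph_def trunc_upd upd_in_space)

lemma sqdist_commute: "sqdist n x y = sqdist n y x"
  unfolding sqdist_def by (simp add: power2_commute)

lemma sqdist_coordinate: "i < n \<Longrightarrow> (x i - y i)\<^sup>2 \<le> sqdist n x (y :: nat \<Rightarrow> real)"
  unfolding sqdist_def by (intro member_le_sum) auto

lemma continuous_on_sqdist: "continuous_on A (\<lambda>y. sqdist n y (x :: nat \<Rightarrow> real))"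
  unfolding sqdist_def
  by (intro continuous_intros continuous_on_subset[OF continuous_on_product_coordinates]) auto

lemma open_sqdist: "open {y. sqdist n y (x :: nat \<Rightarrow> real) < r}"
  by (intro open_Collect_less continuous_on_sqdist continuous_on_const)

text \<open>Closedness by \<open>sqdist\<close>, which makes sense over any ordered field, is
  compared with the product topology on \<open>nat \<Rightarrow> real\<close>; the vanishing of
  coordinates from \<open>n\<close> on is itself a closed condition.\<close>

lemma closed_in_Rn_imp_closed:
  assumes "closed_in_Rn n (A :: (nat \<Rightarrow> real) set)"
  shows "closed A"
proof -
  have "x \<in> A" if x: "x \<in> closure A" for x
  proof -
    have "closed (\<Inter>i\<in>{n..}. {x :: nat \<Rightarrow> real. x i = 0})"
      by (intro closed_INT ballI closed_Collect_eq continuous_on_const continuous_on_product_coordinates)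
    moreover have "A \<subseteq> (\<Inter>i\<in>{n..}. {x. x i = 0})"
      using assms by (auto simp: closed_in_Rn_def Defs.space_def)
    ultimately have "closure A \<subseteq> (\<Inter>i\<in>{n..}. {x. x i = 0})" by (simp add: closure_minimal)
    then have "x \<in> space n" using x by (auto simp: Defs.space_def)
    moreover have "\<exists>y\<in>A. sqdist n x y < \<delta>\<^sup>2" if "\<delta> > 0" for \<delta>
    proof -
      have "x \<in> {y. sqdist n y x < \<delta>\<^sup>2} \<inter> closure A" using x that by (simp add: sqdist_def)
      then have "{y. sqdist n y x < \<delta>\<^sup>2} \<inter> A \<noteq> {}" using open_Int_closure_eq_empty[OF open_sqdist] by blast
      then show ?thesis by (auto simp: sqdist_commute[of n x])
    qed
    ultimately show ?thesis using assms by (simp add: closed_in_Rn_def)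
  qed
  then show ?thesis by (metis closure_subset closure_closed subsetI subset_antisym closed_closure)
qed

lemma cont_on_Rn_imp_continuous_on:
  assumes "cont_on_Rn n A (f :: (nat \<Rightarrow> real) \<Rightarrow> real)"
  shows "continuous_on A f"
  unfolding continuous_on_def
proof (intro ballI tendstoI)
  fix x and e :: real assume "x \<in> A" "e > 0"
  then obtain \<delta> where \<delta>: "\<delta> > 0" "\<And>y. y \<in> A \<Longrightarrow> sqdist n y x < \<delta>\<^sup>2 \<Longrightarrow> \<bar>f y - f x\<bar> < e"
    using assms unfolding cont_on_Rn_def by blast
  show "\<forall>\<^sub>F y in at x within A. dist (f y) (f x) < e"
    unfolding eventually_at_topological
    by (rule exI[of _ "{y. sqdist n y x < \<delta>\<^sup>2}"]) (use \<delta> open_sqdist in \<open>auto simp: dist_real_def sqdist_def\<close>)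
qed

lemma cont_on_Rn_seqD:
  assumes "cont_on_Rn n A (f :: (nat \<Rightarrow> real) \<Rightarrow> real)" "x \<in> A" "\<And>k. y k \<in> A" "(\<lambda>k. sqdist n (y k) x) \<longlonglongrightarrow> 0"
  shows "(\<lambda>k. f (y k)) \<longlonglongrightarrow> f x"
proof (rule tendstoI)
  fix e :: real assume "e > 0"
  then obtain \<delta> where \<delta>: "\<delta> > 0" "\<And>y. y \<in> A \<Longrightarrow> sqdist n y x < \<delta>\<^sup>2 \<Longrightarrow> \<bar>f y - f x\<bar> < e"
    using assms(1,2) unfolding cont_on_Rn_def by blast
  have "\<forall>\<^sub>F k in sequentially. sqdist n (y k) x < \<delta>\<^sup>2" using assms(4) \<delta> by (intro order_tendstoD) auto
  then show "\<forall>\<^sub>F k in sequentially. dist (f (y k)) (f x) < e"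
    by (rule eventually_mono) (use \<delta> assms(3) in \<open>auto simp: dist_real_def\<close>)
qed

lemma sqdist_nonneg: "0 \<le> sqdist n x (y :: nat \<Rightarrow> real)"
  unfolding sqdist_def by (intro sum_nonneg) auto

lemma cont_on_Rn_seqI:
  assumes "\<And>x y. x \<in> A \<Longrightarrow> (\<And>k. y k \<in> A) \<Longrightarrow> (\<lambda>k. sqdist n (y k) x) \<longlonglongrightarrow> 0 \<Longrightarrow> (\<lambda>k. f (y k)) \<longlonglongrightarrow> f x"
  shows "cont_on_Rn n A (f :: (nat \<Rightarrow> real) \<Rightarrow> real)"
  unfolding cont_on_Rn_def
proof (intro ballI allI impI, rule ccontr)
  fix x and e :: real
  assume x: "x \<in> A" and e: "e > 0" and no: "\<not> (\<exists>\<delta>>0. \<forall>y\<in>A. sqdist n y x < \<delta>\<^sup>2 \<longrightarrow> \<bar>f y - f x\<bar> < e)"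
  define d :: "nat \<Rightarrow> real" where "d = (\<lambda>k. inverse (real (Suc k)))"
  have "\<exists>y. y \<in> A \<and> sqdist n y x < (d k)\<^sup>2 \<and> \<not> \<bar>f y - f x\<bar> < e" for k
  proof -
    have "d k > 0" by (simp add: d_def)
    then show ?thesis using no by blast
  qed
  then have "\<forall>k. \<exists>y. y \<in> A \<and> sqdist n y x < (d k)\<^sup>2 \<and> \<not> \<bar>f y - f x\<bar> < e" by blast
  from choice[OF this] obtain y where y: "\<And>k. y k \<in> A" "\<And>k. sqdist n (y k) x < (d k)\<^sup>2" "\<And>k. \<not> \<bar>f (y k) - f x\<bar> < e"
    by blast
  have "(\<lambda>k. (d k)\<^sup>2) \<longlonglongrightarrow> 0\<^sup>2" unfolding d_def by (intro tendsto_intros LIMSEQ_inverse_real_of_nat)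
  then have "(\<lambda>k. sqdist n (y k) x) \<longlonglongrightarrow> 0"
    by (intro tendsto_sandwich[of "\<lambda>_. 0" "\<lambda>k. sqdist n (y k) x" sequentially "\<lambda>k. (d k)\<^sup>2"])
      (use y(2) sqdist_nonneg in \<open>auto intro!: always_eventually less_imp_le\<close>)
  then have "(\<lambda>k. f (y k)) \<longlonglongrightarrow> f x" using assms x y(1) by blast
  then have "\<forall>\<^sub>F k in sequentially. dist (f (y k)) (f x) < e" using e by (rule tendstoD)
  then show False using y(3) by (auto simp: dist_real_def)
qed

text \<open>The compact set is formed by the points (x, f x, g x) with x in \<open>A\<close> and in
  the unit ball around \<open>x0\<close>. Membership is decided by the signs of the polynomials of
  the three formulas and of the ball.\<close>

lemma local_lojasiewicz:
  fixes A :: "(nat \<Rightarrow> real) set"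
  assumes d: "d \<ge> 2"
    and pA: "qf_polys \<phi>A \<subseteq> polys_le n d" and pf: "qf_polys \<phi>f \<subseteq> polys_le (Suc n) d"
    and pg: "qf_polys \<phi>g \<subseteq> polys_le (Suc n) d"
    and A: "A = {x \<in> space n. qf_sat \<phi>A x}"
    and gf: "graph n A f = {x \<in> space (Suc n). qf_sat \<phi>f x}"
    and gg: "graph n A g = {x \<in> space (Suc n). qf_sat \<phi>g x}"
    and cl: "closed_in_Rn n A" and cf: "cont_on_Rn n A f" and cg: "cont_on_Rn n A g"
    and zero: "\<And>x. x \<in> A \<Longrightarrow> f x = 0 \<Longrightarrow> g x = 0"
    and x0: "x0 \<in> A"
  shows "\<exists>C t0. 0 < C \<and> 0 < t0 \<and> (\<forall>x\<in>A. sqdist n x x0 \<le> 1 \<longrightarrow> g x \<noteq> 0 \<longrightarrow> \<bar>g x\<bar> < t0 \<longrightarrow>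
    \<bar>g x\<bar> ^ elim_t n (2 * d) \<le> C * \<bar>f x\<bar>)"
proof -
  define A1 where "A1 = A \<inter> {x. sqdist n x x0 \<le> 1}"
  define \<Psi> where "\<Psi> = (\<lambda>x. x(n := f x, Suc n := g x))"
  define S where "S = \<Psi> ` A1"
  have A_space: "A \<subseteq> space n" using A by auto
  have "compact A1"
  proof -
    let ?R = "\<lambda>i. \<bar>x0 i\<bar> + 1"
    have "\<bar>x i\<bar> \<le> ?R i" if x: "x \<in> A1" for x i
    proof (cases "i < n")
      case True
      have "(x i - x0 i)\<^sup>2 \<le> 1\<^sup>2" using sqdist_coordinate[OF True, of x x0] x by (simp add: A1_def)
      then have "\<bar>x i - x0 i\<bar> \<le> 1" using abs_le_square_iff[of "x i - x0 i" 1] by simp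
      then show ?thesis by linarith
    next
      case False
      then show ?thesis using x A_space by (auto simp: A1_def Defs.space_def)
    qed
    then have "A1 = {x. \<forall>i. \<bar>x i\<bar> \<le> ?R i} \<inter> (A \<inter> {x. sqdist n x x0 \<le> 1})" by (auto simp: A1_def)
    also have "compact \<dots>"
      by (intro compact_Int_closed compact_box closed_Int closed_in_Rn_imp_closed[OF cl]
        closed_Collect_le continuous_on_sqdist continuous_on_const)
    finally show ?thesis .
  qed
  moreover have "continuous_on A1 \<Psi>"
  proof (rule continuous_on_coordinatewise_then_product)
    fix i
    have "continuous_on A1 f" "continuous_on A1 g"
      using cont_on_Rn_imp_continuous_on[OF cf] cont_on_Rn_imp_continuous_on[OF cg]
      by (auto intro: continuous_on_subset simp: A1_def)
    moreover have "continuous_on A1 (\<lambda>x. x i)" by (rule continuous_on_subset[OF continuous_on_product_coordinates]) simp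
    ultimately show "continuous_on A1 (\<lambda>x. \<Psi> x i)" by (cases "i = n"; cases "i = Suc n") (auto simp: \<Psi>_def)
  qed
  ultimately have compS: "compact S" unfolding S_def using compact_continuous_image by blast
  have S_space: "S \<subseteq> space (n + 2)"
    using A_space by (auto simp: S_def \<Psi>_def A1_def Defs.space_def)
  \<comment> \<open>The formula for the graph of \<open>g\<close> expects the value in position
    \<open>n\<close>, but in \<open>S\<close> it is stored in position \<open>Suc n\<close>.\<close>
  define tg where "tg = (\<lambda>z :: nat \<Rightarrow> real. (trunc n z)(n := z (Suc n)))"
  define \<F> where "\<F> = (\<lambda>p z. mpoly_eval p (trunc n z)) ` qf_polys \<phi>A \<union>
     (\<lambda>p z. mpoly_eval p (trunc (Suc n) z)) ` qf_polys \<phi>f \<union> (\<lambda>p z. mpoly_eval p (tg z)) ` qf_polys \<phi>g \<union>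
     {\<lambda>z. 1 - sqdist n (trunc n z) x0}"
  have fin: "finite \<F>" unfolding \<F>_def by (simp add: finite_qf_polys)
  have var: "polyf (n + 2) 1 (\<lambda>z. z j)" if "j < n + 2" for j using that by (rule polyf_var)
  have poly: "polyf (n + 2) d p" if "p \<in> \<F>" for p
  proof -
    have 1: "polyf (n + 2) d (\<lambda>z. mpoly_eval p (trunc n z))" if "p \<in> qf_polys \<phi>A" for p
      using that pA by (intro polyf_mpoly_eval[of p n]) (auto simp: trunc_def var[simplified])
    have 2: "polyf (n + 2) d (\<lambda>z. mpoly_eval p (trunc (Suc n) z))" if "p \<in> qf_polys \<phi>f" for p
      using that pf by (intro polyf_mpoly_eval[of p "Suc n"]) (auto simp: trunc_def var[simplified])
    have 3: "polyf (n + 2) d (\<lambda>z. mpoly_eval p (tg z))" if "p \<in> qf_polys \<phi>g" for p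
    proof (rule polyf_mpoly_eval[of p "Suc n"])
      show "p \<in> polys_le (Suc n) d" using that pg by auto
      show "polyf (n + 2) 1 (\<lambda>z. tg z j)" if "j < Suc n" for j
        using that var[of j] var[of "Suc n"] by (cases "j = n") (auto simp: tg_def trunc_def)
    qed
    \<comment> \<open>The ball polynomial has degree 2, which is at most \<open>d\<close>.\<close>
    have "polyf (n + 2) (2 * 1) (\<lambda>z. (z i + - x0 i)\<^sup>2)" if "i < n" for i
      by (intro polyf_power polyf_add polyf_const var) (use that in auto)
    then have "polyf (n + 2) d (\<lambda>z. (z i + - x0 i)\<^sup>2)" if "i < n" for i
      using polyf_mono[of "n + 2" "2 * 1" _ d] d that by simp
    then have "polyf (n + 2) d (\<lambda>z. 1 + (- 1) * (\<Sum>i<n. (z i + - x0 i)\<^sup>2))"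
      by (intro polyf_add polyf_const polyf_scale polyf_sum) auto
    moreover have "(\<lambda>z. 1 - sqdist n (trunc n z) x0) = (\<lambda>z. 1 + (- 1) * (\<Sum>i<n. (z i + - x0 i)\<^sup>2))"
      by (auto simp: sqdist_def trunc_def fun_eq_iff)
    ultimately have 4: "polyf (n + 2) d (\<lambda>z. 1 - sqdist n (trunc n z) x0)" by simp
    show ?thesis using that 1 2 3 4 unfolding \<F>_def by blast
  qed
  have inS: "z \<in> S \<longleftrightarrow> trunc n z \<in> A \<and> sqdist n (trunc n z) x0 \<le> 1 \<and> z n = f (trunc n z) \<and> z (Suc n) = g (trunc n z)"
    if z: "z \<in> space (n + 2)" for z
  proof
    assume "z \<in> S"
    then obtain x where x: "x \<in> A1" "z = x(n := f x, Suc n := g x)" by (auto simp: S_def \<Psi>_def)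
    then have "trunc n z = x" using A_space by (auto simp: A1_def trunc_def Defs.space_def fun_eq_iff)
    then show "trunc n z \<in> A \<and> sqdist n (trunc n z) x0 \<le> 1 \<and> z n = f (trunc n z) \<and> z (Suc n) = g (trunc n z)"
      using x by (auto simp: A1_def)
  next
    assume h: "trunc n z \<in> A \<and> sqdist n (trunc n z) x0 \<le> 1 \<and> z n = f (trunc n z) \<and> z (Suc n) = g (trunc n z)"
    have "z = \<Psi> (trunc n z)"
    proof
      fix i
      consider "i < n" | "i = n" | "i = Suc n" | "i \<ge> n + 2" by linarith
      then show "z i = \<Psi> (trunc n z) i"
        by cases (use h z in \<open>auto simp: \<Psi>_def trunc_def Defs.space_def\<close>)
    qed
    then show "z \<in> S" using h unfolding S_def A1_def by blast
  qed
  have signs: "z' \<in> S" if z: "z \<in> S" and z': "z' \<in> space (n + 2)"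
    and sg: "\<And>p. p \<in> \<F> \<Longrightarrow> sgn (p z) = sgn (p z')" for z z'
  proof -
    have zs: "z \<in> space (n + 2)" using z S_space by auto
    note iz = inS[OF zs, THEN iffD1, OF z]
    have sA: "qf_sat \<phi>A (trunc n z) = qf_sat \<phi>A (trunc n z')"
      by (rule qf_sat_cong, rule sg) (auto simp: \<F>_def)
    have sf: "qf_sat \<phi>f (trunc (Suc n) z) = qf_sat \<phi>f (trunc (Suc n) z')"
      by (rule qf_sat_cong, rule sg) (auto simp: \<F>_def)
    have sgg: "qf_sat \<phi>g (tg z) = qf_sat \<phi>g (tg z')"
      by (rule qf_sat_cong, rule sg[of "\<lambda>z. mpoly_eval _ (tg z)"]) (auto simp: \<F>_def)
    have sb: "sgn (1 - sqdist n (trunc n z) x0) = sgn (1 - sqdist n (trunc n z') x0)"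
      by (rule sg) (auto simp: \<F>_def)
    have A': "trunc n z' \<in> A" using iz sA in_space_trunc[of n z'] unfolding A by auto
    have tr: "trunc (Suc n) w = (trunc n w)(n := w n)" for w :: "nat \<Rightarrow> real"
      by (auto simp: trunc_def fun_eq_iff)
    have f_iff: "qf_sat \<phi>f (trunc (Suc n) w) \<longleftrightarrow> trunc n w \<in> A \<and> w n = f (trunc n w)" for w
      using gf upd_in_graph[OF in_space_trunc, of n w "w n" A f] in_space_trunc[of "Suc n" w] unfolding tr by auto
    have g_iff: "qf_sat \<phi>g (tg w) \<longleftrightarrow> trunc n w \<in> A \<and> w (Suc n) = g (trunc n w)" for w
      using gg upd_in_graph[OF in_space_trunc, of n w "w (Suc n)" A g] upd_in_space[OF in_space_trunc, of n w "w (Suc n)"]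
      unfolding tg_def by auto
    have "sqdist n (trunc n z') x0 \<le> 1" using iz sb by (auto simp: sgn_if split: if_splits)
    then show ?thesis unfolding inS[OF z'] using A' iz sf sgg f_iff g_iff by auto
  qed
  have "\<exists>C t0. 0 < C \<and> 0 < t0 \<and> (\<forall>z\<in>S. z (n + 1) \<noteq> 0 \<longrightarrow> \<bar>z (n + 1)\<bar> < t0 \<longrightarrow>
    \<bar>z (n + 1)\<bar> ^ elim_t n (2 * d) \<le> C * \<bar>z n\<bar>)"
  proof (rule compact_lojasiewicz[OF fin poly compS S_space signs])
    fix z assume "z \<in> S" "z n = 0"
    then show "z (n + 1) = 0" using zero by (auto simp: S_def \<Psi>_def A1_def)
  qed
  then obtain C t0 where C: "0 < C" "0 < t0" "\<And>z. z \<in> S \<Longrightarrow> z (n + 1) \<noteq> 0 \<Longrightarrow> \<bar>z (n + 1)\<bar> < t0 \<Longrightarrow>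
    \<bar>z (n + 1)\<bar> ^ elim_t n (2 * d) \<le> C * \<bar>z n\<bar>" by blast
  have "\<bar>g x\<bar> ^ elim_t n (2 * d) \<le> C * \<bar>f x\<bar>" if "x \<in> A" "sqdist n x x0 \<le> 1" "g x \<noteq> 0" "\<bar>g x\<bar> < t0" for x
    using C(3)[of "\<Psi> x"] that by (auto simp: S_def A1_def \<Psi>_def)
  then show ?thesis using C(1,2) by blast
qed

text \<open>Near a zero of \<open>f\<close> the local inequality bounds |g^N / f| by C |g|, because
  \<open>N\<close> exceeds its exponent by at least one; the factor g left over tends to 0.\<close>

lemma quotient_continuous_real:
  fixes A :: "(nat \<Rightarrow> real) set"
  assumes d: "d \<ge> 2"
    and pA: "qf_polys \<phi>A \<subseteq> polys_le n d" and pf: "qf_polys \<phi>f \<subseteq> polys_le (Suc n) d"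
    and pg: "qf_polys \<phi>g \<subseteq> polys_le (Suc n) d"
    and A: "A = {x \<in> space n. qf_sat \<phi>A x}"
    and gf: "graph n A f = {x \<in> space (Suc n). qf_sat \<phi>f x}"
    and gg: "graph n A g = {x \<in> space (Suc n). qf_sat \<phi>g x}"
    and cl: "closed_in_Rn n A" and cf: "cont_on_Rn n A f" and cg: "cont_on_Rn n A g"
    and zero: "\<And>x. x \<in> A \<Longrightarrow> f x = 0 \<Longrightarrow> g x = 0"
    and N: "elim_t n (2 * d) < N"
  shows "cont_on_Rn n A (\<lambda>x. g x ^ N / f x)"
proof (rule cont_on_Rn_seqI)
  fix x y assume x: "x \<in> A" and y: "\<And>k. y k \<in> A" and lim: "(\<lambda>k. sqdist n (y k) x) \<longlonglongrightarrow> 0"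
  have lf: "(\<lambda>k. f (y k)) \<longlonglongrightarrow> f x" using cont_on_Rn_seqD[OF cf x y lim] .
  have lg: "(\<lambda>k. g (y k)) \<longlonglongrightarrow> g x" using cont_on_Rn_seqD[OF cg x y lim] .
  show "(\<lambda>k. g (y k) ^ N / f (y k)) \<longlonglongrightarrow> g x ^ N / f x"
  proof (cases "f x = 0")
    case False
    then show ?thesis by (intro tendsto_intros lf lg)
  next
    case True
    then have gx: "g x = 0" using zero x by blast
    obtain C t0 where C: "0 < C" "0 < t0" "\<And>x'. x' \<in> A \<Longrightarrow> sqdist n x' x \<le> 1 \<Longrightarrow> g x' \<noteq> 0 \<Longrightarrow> \<bar>g x'\<bar> < t0 \<Longrightarrow>
        \<bar>g x'\<bar> ^ elim_t n (2 * d) \<le> C * \<bar>f x'\<bar>"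
      using local_lojasiewicz[OF d pA pf pg A gf gg cl cf cg zero x] by blast
    have lg0: "(\<lambda>k. \<bar>g (y k)\<bar>) \<longlonglongrightarrow> 0" using tendsto_rabs[OF lg] gx by simp
    have "\<forall>\<^sub>F k in sequentially. \<bar>g (y k)\<bar> < min 1 t0" using lg0 C(2) by (intro order_tendstoD) auto
    moreover have "\<forall>\<^sub>F k in sequentially. sqdist n (y k) x < 1" using lim by (intro order_tendstoD) auto
    ultimately have "\<forall>\<^sub>F k in sequentially. norm (g (y k) ^ N / f (y k)) \<le> C * \<bar>g (y k)\<bar>"
    proof eventually_elim
      case (elim k)
      show ?case
      proof (cases "g (y k) = 0 \<or> f (y k) = 0")
        case True
        \<comment> \<open>Either way the quotient is 0: by \<open>N > 0\<close> or by the convention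
          for division by 0.\<close>
        then show ?thesis using C(1) N by (auto simp: power_0_left)
      next
        case False
        let ?g = "\<bar>g (y k)\<bar>" and ?f = "\<bar>f (y k)\<bar>"
        have "?g ^ N \<le> ?g ^ (elim_t n (2 * d) + 1)" using elim N by (intro power_decreasing) auto
        also have "\<dots> = ?g ^ elim_t n (2 * d) * ?g" by simp
        also have "\<dots> \<le> (C * ?f) * ?g" using C(3)[OF y[of k]] elim False by (intro mult_right_mono) auto
        finally have "?g ^ N \<le> (C * ?g) * ?f" by (simp add: algebra_simps)
        then show ?thesis using False by (simp add: abs_divide power_abs divide_le_eq)
      qed
    qed
    moreover have "(\<lambda>k. C * \<bar>g (y k)\<bar>) \<longlonglongrightarrow> 0" using tendsto_mult_right_zero[OF lg0] .
    ultimately have "(\<lambda>k. g (y k) ^ N / f (y k)) \<longlonglongrightarrow> 0" by (rule Lim_null_comparison)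
    then show ?thesis using True by simp
  qed
qed

section \<open>Transfer to real closed fields\<close>

text \<open>The terms of the first order language, seen semantically over two fields. The closure
  rules below rebuild them from their shape, so no formula has to be written down.\<close>

definition pfun :: "((nat \<Rightarrow> 'a::linordered_field) \<Rightarrow> 'a) \<Rightarrow> ((nat \<Rightarrow> 'b::linordered_field) \<Rightarrow> 'b) \<Rightarrow> bool" where
  "pfun F F' \<longleftrightarrow> (\<exists>t. (\<forall>e. F e = ieval t e) \<and> (\<forall>e. F' e = ieval t e))"

lemma pfun_int: "pfun (\<lambda>e. of_int k) (\<lambda>e. of_int k)"
  unfolding pfun_def by (intro exI[of _ "IC k"]) simp

lemma pfun_0: "pfun (\<lambda>e. 0) (\<lambda>e. 0)"
  using pfun_int[of 0] by simp

lemma pfun_1: "pfun (\<lambda>e. 1) (\<lambda>e. 1)"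
  using pfun_int[of 1] by simp

lemma pfun_var: "pfun (\<lambda>e. e i) (\<lambda>e. e i)"
  unfolding pfun_def by (intro exI[of _ "IV i"]) simp

lemma pfun_add: "pfun F F' \<Longrightarrow> pfun G G' \<Longrightarrow> pfun (\<lambda>e. F e + G e) (\<lambda>e. F' e + G' e)"
  unfolding pfun_def by (metis ieval.simps(3))

lemma pfun_mult: "pfun F F' \<Longrightarrow> pfun G G' \<Longrightarrow> pfun (\<lambda>e. F e * G e) (\<lambda>e. F' e * G' e)"
  unfolding pfun_def by (metis ieval.simps(4))

lemma pfun_diff: "pfun F F' \<Longrightarrow> pfun G G' \<Longrightarrow> pfun (\<lambda>e. F e - G e) (\<lambda>e. F' e - G' e)"
  using pfun_add[OF _ pfun_mult[OF pfun_int[of "- 1"]], of F F' G G'] by simp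

lemma pfun_power: "pfun F F' \<Longrightarrow> pfun (\<lambda>e. F e ^ k) (\<lambda>e. F' e ^ k)"
  by (induction k) (auto intro: pfun_1 pfun_mult)

lemma pfun_sum: "(\<And>i. i \<in> I \<Longrightarrow> pfun (F i) (F' i)) \<Longrightarrow> pfun (\<lambda>e. \<Sum>i\<in>I. F i e) (\<lambda>e. \<Sum>i\<in>I. F' i e)"
  by (induction I rule: infinite_finite_induct) (auto intro: pfun_0 pfun_add)

lemma pfun_prod: "(\<And>i. i \<in> I \<Longrightarrow> pfun (F i) (F' i)) \<Longrightarrow> pfun (\<lambda>e. \<Prod>i\<in>I. F i e) (\<lambda>e. \<Prod>i\<in>I. F' i e)"
  by (induction I rule: infinite_finite_induct) (auto intro: pfun_1 pfun_mult)

lemma pfun_if: "pfun F F' \<Longrightarrow> pfun G G' \<Longrightarrow> pfun (\<lambda>e. if b then F e else G e) (\<lambda>e. if b then F' e else G' e)"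
  by (cases b) auto

lemma pfun_upd:
  "pfun F F' \<Longrightarrow> pfun (\<lambda>e. W e j) (\<lambda>e. W' e j) \<Longrightarrow> pfun (\<lambda>e. ((W e)(i := F e)) j) (\<lambda>e. ((W' e)(i := F' e)) j)"
  by (cases "j = i") auto

lemma pfun_sqdist:
  assumes "\<And>i. pfun (\<lambda>e. W e i) (\<lambda>e. W' e i)" "\<And>i. pfun (\<lambda>e. Y e i) (\<lambda>e. Y' e i)"
  shows "pfun (\<lambda>e. sqdist n (W e) (Y e)) (\<lambda>e. sqdist n (W' e) (Y' e))"
  unfolding sqdist_def by (intro pfun_sum pfun_power pfun_diff assms)

lemma det2_less: "pfun F F' \<Longrightarrow> pfun G G' \<Longrightarrow> det2 (\<lambda>e. F e < G e) (\<lambda>e. F' e < G' e)"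
proof -
  assume "pfun F F'" "pfun G G'"
  then have "pfun (\<lambda>e. G e - F e) (\<lambda>e. G' e - F' e)" by (rule pfun_diff[rotated])
  then obtain t where t: "\<And>e. G e - F e = ieval t e" "\<And>e. G' e - F' e = ieval t e"
    unfolding pfun_def by blast
  have "(F e < G e) = (F' e' < G' e')" if "agree {t} e e'" for e e'
  proof -
    have "0 < G e - F e \<longleftrightarrow> 0 < G' e' - F' e'" using that unfolding agree_def sgneq_def t by blast
    then show ?thesis by simp
  qed
  then show ?thesis unfolding det2_def by blast
qed

lemma det2_eq:
  assumes "pfun F F'" "pfun G G'"
  shows "det2 (\<lambda>e. F e = G e) (\<lambda>e. F' e = G' e)"
proof -
  have eq: "x = y \<longleftrightarrow> \<not> x < y \<and> \<not> y < x" for x y :: "'c::linordered_field" by auto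
  show ?thesis unfolding eq by (intro det2_conj det2_not det2_less assms)
qed

fun irename :: "(nat \<Rightarrow> nat) \<Rightarrow> iexp \<Rightarrow> iexp" where
  "irename \<rho> (IC k) = IC k"
| "irename \<rho> (IV i) = IV (\<rho> i)"
| "irename \<rho> (IAdd s t) = IAdd (irename \<rho> s) (irename \<rho> t)"
| "irename \<rho> (IMul s t) = IMul (irename \<rho> s) (irename \<rho> t)"

lemma ieval_irename: "ieval (irename \<rho> t) e = ieval t (\<lambda>i. e (\<rho> i))"
  by (induction t) auto

lemma det2_rename:
  assumes "det2 S S'"
  shows "det2 (\<lambda>e. S (\<lambda>i. e (\<rho> i))) (\<lambda>e. S' (\<lambda>i. e (\<rho> i)))"
proof -
  obtain Q where Q: "finite Q" "\<And>e e'. agree Q e e' \<Longrightarrow> S e = S' e'" using assms unfolding det2_def by blast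
  have "S (\<lambda>i. e (\<rho> i)) = S' (\<lambda>i. e' (\<rho> i))" if "agree (irename \<rho> ` Q) e e'" for e e'
    using that by (intro Q(2)) (auto simp: agree_def ieval_irename)
  then show ?thesis using Q(1) unfolding det2_def by blast
qed

lemma ex_space_0: "(\<exists>x\<in>space 0. P x) \<longleftrightarrow> P (\<lambda>_. 0 :: 'c::zero)"
proof -
  have "space 0 = {\<lambda>_. 0 :: 'c}" by (auto simp: Defs.space_def)
  then show ?thesis by simp
qed

lemma ex_space_Suc: "(\<exists>x\<in>space (Suc n). P x) \<longleftrightarrow> (\<exists>x\<in>space n. \<exists>y. P (x(n := y)))"
  using space_Suc_eq[of _ n] in_space_trunc[of n] upd_in_space[of _ n] by metis

text \<open>A single quantifier binds variable 0, while a point of \<open>space (Suc n)\<close>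
  keeps its last coordinate in variable \<open>n\<close>. The rotation brings that coordinate to the
  front.\<close>

definition rotate_var :: "nat \<Rightarrow> nat \<Rightarrow> nat" where
  "rotate_var n i = (if i < n then Suc i else if i = n then 0 else i)"

lemma rotate_var_env:
  "(\<lambda>i. if i < Suc n then e (rotate_var n i) else 0) = (\<lambda>i. if i < n then e (Suc i) else 0)(n := e 0)"
  "(\<lambda>i. e (rotate_var n (Suc n + i))) = (\<lambda>i. e (Suc (n + i)))"
  by (auto simp: fun_eq_iff rotate_var_def)

context
  fixes T1 :: "'a::linordered_field itself" and T2 :: "'b::linordered_field itself"
  assumes ivt: "poly_ivt TYPE('a)" "poly_ivt TYPE('b)"
begin

lemma det2_ex:
  fixes \<Phi> :: "(nat \<Rightarrow> 'a) \<Rightarrow> 'a \<Rightarrow> bool" and \<Phi>' :: "(nat \<Rightarrow> 'b) \<Rightarrow> 'b \<Rightarrow> bool"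
  assumes "det2 (\<lambda>e. \<Phi> (\<lambda>i. e (Suc i)) (e 0)) (\<lambda>e. \<Phi>' (\<lambda>i. e (Suc i)) (e 0))"
  shows "det2 (\<lambda>e. \<exists>y. \<Phi> e y) (\<lambda>e. \<exists>y. \<Phi>' e y)"
  using det2_ex_head[OF ivt assms] by simp

lemma det2_all:
  fixes \<Phi> :: "(nat \<Rightarrow> 'a) \<Rightarrow> 'a \<Rightarrow> bool" and \<Phi>' :: "(nat \<Rightarrow> 'b) \<Rightarrow> 'b \<Rightarrow> bool"
  assumes "det2 (\<lambda>e. \<Phi> (\<lambda>i. e (Suc i)) (e 0)) (\<lambda>e. \<Phi>' (\<lambda>i. e (Suc i)) (e 0))"
  shows "det2 (\<lambda>e. \<forall>y. \<Phi> e y) (\<lambda>e. \<forall>y. \<Phi>' e y)"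
  using det2_not[OF det2_ex[of "\<lambda>e y. \<not> \<Phi> e y" "\<lambda>e y. \<not> \<Phi>' e y", OF det2_not[OF assms]]] by simp

lemma det2_ex_space:
  fixes \<Phi> :: "(nat \<Rightarrow> 'a) \<Rightarrow> (nat \<Rightarrow> 'a) \<Rightarrow> bool" and \<Phi>' :: "(nat \<Rightarrow> 'b) \<Rightarrow> (nat \<Rightarrow> 'b) \<Rightarrow> bool"
  assumes "det2 (\<lambda>e. \<Phi> (\<lambda>i. e (n + i)) (\<lambda>i. if i < n then e i else 0)) (\<lambda>e. \<Phi>' (\<lambda>i. e (n + i)) (\<lambda>i. if i < n then e i else 0))"
  shows "det2 (\<lambda>e. \<exists>x\<in>space n. \<Phi> e x) (\<lambda>e. \<exists>x\<in>space n. \<Phi>' e x)"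
  using assms
proof (induction n arbitrary: \<Phi> \<Phi>')
  case 0
  then show ?case by (simp add: ex_space_0)
next
  case (Suc n)
  from det2_rename[OF Suc.prems, of "rotate_var n"]
  have "det2 (\<lambda>e. \<Phi> (\<lambda>i. e (Suc (n + i))) ((\<lambda>i. if i < n then e (Suc i) else 0)(n := e 0)))
     (\<lambda>e. \<Phi>' (\<lambda>i. e (Suc (n + i))) ((\<lambda>i. if i < n then e (Suc i) else 0)(n := e 0)))"
    unfolding rotate_var_env .
  then have "det2 (\<lambda>e. \<exists>y. \<Phi> (\<lambda>i. e (n + i)) ((\<lambda>i. if i < n then e i else 0)(n := y)))
     (\<lambda>e. \<exists>y. \<Phi>' (\<lambda>i. e (n + i)) ((\<lambda>i. if i < n then e i else 0)(n := y)))"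
    by (rule det2_ex)
  then show ?case unfolding ex_space_Suc by (rule Suc.IH)
qed

lemma det2_all_space:
  fixes \<Phi> :: "(nat \<Rightarrow> 'a) \<Rightarrow> (nat \<Rightarrow> 'a) \<Rightarrow> bool" and \<Phi>' :: "(nat \<Rightarrow> 'b) \<Rightarrow> (nat \<Rightarrow> 'b) \<Rightarrow> bool"
  assumes "det2 (\<lambda>e. \<Phi> (\<lambda>i. e (n + i)) (\<lambda>i. if i < n then e i else 0)) (\<lambda>e. \<Phi>' (\<lambda>i. e (n + i)) (\<lambda>i. if i < n then e i else 0))"
  shows "det2 (\<lambda>e. \<forall>x\<in>space n. \<Phi> e x) (\<lambda>e. \<forall>x\<in>space n. \<Phi>' e x)"
  using det2_not[OF det2_ex_space[of "\<lambda>e y. \<not> \<Phi> e y" n "\<lambda>e y. \<not> \<Phi>' e y", OF det2_not[OF assms]]] by simp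

end

section \<open>Sentences, and formulas with numbered coefficients\<close>

lemma ieval_zero: "ieval t (\<lambda>_. 0) = of_int (ieval t (\<lambda>_. 0))"
  by (induction t) auto

text \<open>Without free variables the deciding polynomials may be evaluated at 0, where they are
  integers, and an integer has the same sign in every ordered field.\<close>

lemma det2_sentence:
  assumes "det2 (\<lambda>e :: nat \<Rightarrow> 'a::linordered_field. b) (\<lambda>e :: nat \<Rightarrow> 'b::linordered_field. b')"
  shows "b = b'"
proof -
  obtain Q where Q: "\<And>(e :: nat \<Rightarrow> 'a) (e' :: nat \<Rightarrow> 'b). agree Q e e' \<Longrightarrow> b = b'"
    using assms unfolding det2_def by blast
  have "sgneq (ieval q (\<lambda>_. 0) :: 'a) (ieval q (\<lambda>_. 0) :: 'b)" for q
    using sgneq_of_int[of "ieval q (\<lambda>_. 0)", where ?'a = 'a and ?'b = 'b] by (simp only: ieval_zero[symmetric])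
  then show ?thesis using Q[of "\<lambda>_. 0" "\<lambda>_. 0"] by (simp add: agree_def)
qed

text \<open>The coefficients become numbered parameters, so that a formula over one field can be read
  over another one.\<close>

definition inst_poly :: "('p mpoly \<times> (nat \<Rightarrow>\<^sub>0 nat) \<Rightarrow> nat) \<Rightarrow> (nat \<Rightarrow> 'k) \<Rightarrow> 'p::zero mpoly \<Rightarrow> 'k::zero mpoly" where
  "inst_poly idx c p = Poly_Mapping.mapp (\<lambda>m _. c (idx (p, m))) p"

definition inst :: "('p mpoly \<times> (nat \<Rightarrow>\<^sub>0 nat) \<Rightarrow> nat) \<Rightarrow> (nat \<Rightarrow> 'k) \<Rightarrow> 'p::zero mpoly qf_formula \<Rightarrow> 'k::zero mpoly qf_formula" where
  "inst idx c \<phi> = map_qf_formula (inst_poly idx c) \<phi>"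

lemma qf_polys_inst: "qf_polys (inst idx c \<phi>) = inst_poly idx c ` qf_polys \<phi>"
  unfolding inst_def by (induction \<phi>) auto

lemma inst_poly_in_polys_le:
  assumes "p \<in> polys_le n d"
  shows "inst_poly idx c p \<in> polys_le n d"
proof -
  have sub: "Poly_Mapping.keys (inst_poly idx c p) \<subseteq> Poly_Mapping.keys p"
    unfolding inst_poly_def by (rule keys_mapp_subset)
  have "total_degree (inst_poly idx c p) \<le> total_degree p"
    unfolding total_degree_def using sub by (intro Max_mono) auto
  then show ?thesis using assms sub unfolding polys_le_def vars_in_def by auto
qed

lemma mpoly_eval_inst_poly:
  "mpoly_eval (inst_poly idx c p) x =
    (\<Sum>m\<in>Poly_Mapping.keys p. c (idx (p, m)) * (\<Prod>j\<in>Poly_Mapping.keys m. x j ^ Poly_Mapping.lookup m j))"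
  unfolding mpoly_eval_def
proof (rule sum.mono_neutral_cong_left)
  show "Poly_Mapping.keys (inst_poly idx c p) \<subseteq> Poly_Mapping.keys p"
    unfolding inst_poly_def by (rule keys_mapp_subset)
qed (auto simp: inst_poly_def lookup_mapp in_keys_iff)

lemma det2_qf_sat:
  assumes C: "\<And>j. pfun (\<lambda>e. C e j) (\<lambda>e. C' e j)" and W: "\<And>j. pfun (\<lambda>e. W e j) (\<lambda>e. W' e j)"
  shows "det2 (\<lambda>e. qf_sat (inst idx (C e) \<phi>) (W e)) (\<lambda>e. qf_sat (inst idx (C' e) \<phi>) (W' e))"
proof -
  have p: "pfun (\<lambda>e. mpoly_eval (inst_poly idx (C e) p) (W e)) (\<lambda>e. mpoly_eval (inst_poly idx (C' e) p) (W' e))" for p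
    unfolding mpoly_eval_inst_poly by (intro pfun_sum pfun_mult pfun_prod pfun_power C W)
  show ?thesis
    by (induction \<phi>) (auto simp: inst_def intro!: det2_eq det2_less p pfun_0 det2_not det2_conj det2_disj)
qed

definition hrel :: "nat \<Rightarrow> 'a::linordered_field \<Rightarrow> 'a \<Rightarrow> 'a \<Rightarrow> bool" where
  "hrel N u v z \<longleftrightarrow> u = 0 \<and> z = 0 \<or> \<not> u = 0 \<and> z * u = v ^ N"

lemma hrel_iff: "hrel N u v z \<longleftrightarrow> z = v ^ N / u"
  by (cases "u = 0") (auto simp: hrel_def field_simps)

definition closed_fo :: "nat \<Rightarrow> ((nat \<Rightarrow> 'a::linordered_field) \<Rightarrow> bool) \<Rightarrow> bool" where
  "closed_fo n \<alpha> \<longleftrightarrow> (\<forall>x\<in>space n. (\<forall>\<delta>. 0 < \<delta> \<longrightarrow> (\<exists>y\<in>space n. \<alpha> y \<and> sqdist n x y < \<delta> ^ 2)) \<longrightarrow> \<alpha> x)"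

text \<open>A first order sentence cannot quantify over functions, so \<open>\<beta>\<close>
  describes a graph: over \<open>\<alpha>\<close>, total, single-valued, continuous. Absolute values
  are split into two inequalities because only polynomial terms are available.\<close>

definition graph_fo :: "nat \<Rightarrow> ((nat \<Rightarrow> 'a::linordered_field) \<Rightarrow> bool) \<Rightarrow> ((nat \<Rightarrow> 'a) \<Rightarrow> bool) \<Rightarrow> bool" where
  "graph_fo n \<alpha> \<beta> \<longleftrightarrow>
    (\<forall>x\<in>space n. \<forall>u. \<beta> (x(n := u)) \<longrightarrow> \<alpha> x) \<and>
    (\<forall>x\<in>space n. \<alpha> x \<longrightarrow> (\<exists>u. \<beta> (x(n := u)))) \<and>
    (\<forall>x\<in>space n. \<forall>u w. \<beta> (x(n := u)) \<longrightarrow> \<beta> (x(n := w)) \<longrightarrow> u = w) \<and>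
    (\<forall>x\<in>space n. \<forall>u. \<beta> (x(n := u)) \<longrightarrow> (\<forall>e. 0 < e \<longrightarrow> (\<exists>\<delta>. 0 < \<delta> \<and>
       (\<forall>y\<in>space n. \<forall>w. \<beta> (y(n := w)) \<longrightarrow> sqdist n y x < \<delta> ^ 2 \<longrightarrow> w - u < e \<and> u - w < e))))"

definition zero_fo :: "nat \<Rightarrow> ((nat \<Rightarrow> 'a::linordered_field) \<Rightarrow> bool) \<Rightarrow> ((nat \<Rightarrow> 'a) \<Rightarrow> bool) \<Rightarrow> bool" where
  "zero_fo n \<beta> \<gamma> \<longleftrightarrow> (\<forall>x\<in>space n. \<beta> (x(n := 0)) \<longrightarrow> (\<forall>v. \<gamma> (x(n := v)) \<longrightarrow> v = 0))"

definition quotient_fo :: "nat \<Rightarrow> nat \<Rightarrow> ((nat \<Rightarrow> 'a::linordered_field) \<Rightarrow> bool) \<Rightarrow> ((nat \<Rightarrow> 'a) \<Rightarrow> bool) \<Rightarrow> bool" where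
  "quotient_fo n N \<beta> \<gamma> \<longleftrightarrow> (\<forall>x\<in>space n. \<forall>u v z. \<beta> (x(n := u)) \<longrightarrow> \<gamma> (x(n := v)) \<longrightarrow> hrel N u v z \<longrightarrow>
    (\<forall>e. 0 < e \<longrightarrow> (\<exists>\<delta>. 0 < \<delta> \<and> (\<forall>y\<in>space n. \<forall>u' v' z'. \<beta> (y(n := u')) \<longrightarrow> \<gamma> (y(n := v')) \<longrightarrow>
       hrel N u' v' z' \<longrightarrow> sqdist n y x < \<delta> ^ 2 \<longrightarrow> z' - z < e \<and> z - z' < e))))"

text \<open>The coefficients are quantified as a point \<open>c\<close> of \<open>space m\<close>,
  which leaves a sentence without free parameters, ready for \<open>det2_sentence\<close>.\<close>

lemma det2_core:
  fixes \<phi>A \<phi>f \<phi>g :: "'p::zero mpoly qf_formula"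
  assumes ivt: "poly_ivt TYPE('a::linordered_field)" "poly_ivt TYPE('b::linordered_field)"
  shows "det2 (\<lambda>e :: nat \<Rightarrow> 'a. \<forall>c\<in>(space m :: (nat \<Rightarrow> 'a) set). closed_fo n (qf_sat (inst idx c \<phi>A)) \<longrightarrow>
      graph_fo n (qf_sat (inst idx c \<phi>A)) (qf_sat (inst idx c \<phi>f)) \<longrightarrow>
      graph_fo n (qf_sat (inst idx c \<phi>A)) (qf_sat (inst idx c \<phi>g)) \<longrightarrow>
      zero_fo n (qf_sat (inst idx c \<phi>f)) (qf_sat (inst idx c \<phi>g)) \<longrightarrow>
      quotient_fo n N (qf_sat (inst idx c \<phi>f)) (qf_sat (inst idx c \<phi>g)))
    (\<lambda>e :: nat \<Rightarrow> 'b. \<forall>c\<in>(space m :: (nat \<Rightarrow> 'b) set). closed_fo n (qf_sat (inst idx c \<phi>A)) \<longrightarrow>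
      graph_fo n (qf_sat (inst idx c \<phi>A)) (qf_sat (inst idx c \<phi>f)) \<longrightarrow>
      graph_fo n (qf_sat (inst idx c \<phi>A)) (qf_sat (inst idx c \<phi>g)) \<longrightarrow>
      zero_fo n (qf_sat (inst idx c \<phi>f)) (qf_sat (inst idx c \<phi>g)) \<longrightarrow>
      quotient_fo n N (qf_sat (inst idx c \<phi>f)) (qf_sat (inst idx c \<phi>g)))"
  unfolding closed_fo_def graph_fo_def zero_fo_def quotient_fo_def hrel_def
  by (intro det2_all_space[OF ivt] det2_ex_space[OF ivt] det2_all[OF ivt] det2_ex[OF ivt] det2_imp det2_conj det2_disj
    det2_not det2_eq det2_less det2_qf_sat pfun_sqdist pfun_upd pfun_if pfun_0 pfun_power pfun_diff pfun_mult pfun_var)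

section \<open>The meaning of the first order statements\<close>

lemma closed_fo_iff: "closed_fo n \<alpha> \<longleftrightarrow> closed_in_Rn n {x \<in> space n. \<alpha> x}"
  unfolding closed_fo_def closed_in_Rn_def by (auto simp: Bex_def)

lemma graph_fo_imp_function:
  fixes \<alpha> :: "(nat \<Rightarrow> 'a::linordered_field) \<Rightarrow> bool"
  assumes "graph_fo n \<alpha> \<beta>"
  shows "\<exists>f. cont_on_Rn n {x \<in> space n. \<alpha> x} f \<and>
    graph n {x \<in> space n. \<alpha> x} f = {z \<in> space (Suc n). \<beta> z}"
proof -
  let ?A = "{x \<in> space n. \<alpha> x}"
  note g = assms[unfolded graph_fo_def]
  have g1: "\<alpha> x" if "x \<in> space n" "\<beta> (x(n := u))" for x u using g[THEN conjunct1] that by blast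
  have g2: "\<exists>u. \<beta> (x(n := u))" if "x \<in> space n" "\<alpha> x" for x
    using g[THEN conjunct2, THEN conjunct1] that by blast
  have g3: "u = w" if "x \<in> space n" "\<beta> (x(n := u))" "\<beta> (x(n := w))" for x u w
    using g[THEN conjunct2, THEN conjunct2, THEN conjunct1] that by blast
  note g4 = g[THEN conjunct2, THEN conjunct2, THEN conjunct2, rule_format]
  define f where "f = (\<lambda>x. THE u. \<beta> (x(n := u)))"
  have iff: "\<beta> (x(n := u)) \<longleftrightarrow> x \<in> ?A \<and> u = f x" if x: "x \<in> space n" for x u
  proof
    assume b: "\<beta> (x(n := u))"
    have "f x = u" unfolding f_def by (rule the_equality[of "\<lambda>u. \<beta> (x(n := u))", OF b g3[OF x _ b]])
    then show "x \<in> ?A \<and> u = f x" using g1[OF x b] x by simp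
  next
    assume h: "x \<in> ?A \<and> u = f x"
    then obtain w where w: "\<beta> (x(n := w))" using g2[OF x] by blast
    have "f x = w" unfolding f_def by (rule the_equality[of "\<lambda>u. \<beta> (x(n := u))", OF w g3[OF x _ w]])
    then show "\<beta> (x(n := u))" using w h by simp
  qed
  have "cont_on_Rn n ?A f"
    unfolding cont_on_Rn_def
  proof (intro ballI allI impI)
    fix x and e :: 'a assume x: "x \<in> ?A" and e: "e > 0"
    have xs: "x \<in> space n" using x by simp
    have "\<beta> (x(n := f x))" using iff[OF xs] x by simp
    from g4[OF xs this e] obtain \<delta> where \<delta>: "0 < \<delta>" "\<And>y w. y \<in> space n \<Longrightarrow> \<beta> (y(n := w)) \<Longrightarrow> sqdist n y x < \<delta> ^ 2 \<Longrightarrow>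
        w - f x < e \<and> f x - w < e"
      by blast
    have "\<bar>f y - f x\<bar> < e" if "y \<in> ?A" "sqdist n y x < \<delta>\<^sup>2" for y
      using \<delta>(2)[of y "f y"] iff[of y "f y"] that by (simp add: abs_less_iff)
    then show "\<exists>\<delta>>0. \<forall>y\<in>?A. sqdist n y x < \<delta>\<^sup>2 \<longrightarrow> \<bar>f y - f x\<bar> < e" using \<delta>(1) by blast
  qed
  moreover have "graph n ?A f = {z \<in> space (Suc n). \<beta> z}"
  proof -
    have "\<beta> z \<longleftrightarrow> trunc n z \<in> ?A \<and> z n = f (trunc n z)" if "z \<in> space (Suc n)" for z
      using iff[OF in_space_trunc, of z "z n"] space_Suc_eq[OF that] by simp
    then show ?thesis unfolding Defs.graph_def by blast
  qed
  ultimately show ?thesis by blast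
qed

lemma in_graph_iff:
  assumes "graph n {x \<in> space n. \<alpha> x} f = {z \<in> space (Suc n). \<beta> z}" "x \<in> space n"
  shows "\<beta> (x(n := u)) \<longleftrightarrow> \<alpha> x \<and> u = f x"
  using upd_in_graph[OF assms(2), of u "{x \<in> space n. \<alpha> x}" f] upd_in_space[OF assms(2), of u] assms by auto

lemma function_imp_graph_fo:
  assumes g: "graph n {x \<in> space n. \<alpha> x} f = {z \<in> space (Suc n). \<beta> z}"
    and c: "cont_on_Rn n {x \<in> space n. \<alpha> x} f"
  shows "graph_fo n \<alpha> \<beta>"
proof -
  note iff = in_graph_iff[OF g]
  have cont: "\<exists>\<delta>. 0 < \<delta> \<and> (\<forall>y\<in>space n. \<forall>w. \<beta> (y(n := w)) \<longrightarrow> sqdist n y x < \<delta> ^ 2 \<longrightarrow> w - u < e \<and> u - w < e)"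
    if x: "x \<in> space n" "\<beta> (x(n := u))" and e: "0 < e" for x u e
  proof -
    obtain \<delta> where "0 < \<delta>" "\<And>y. y \<in> space n \<Longrightarrow> \<alpha> y \<Longrightarrow> sqdist n y x < \<delta>\<^sup>2 \<Longrightarrow> \<bar>f y - f x\<bar> < e"
      using c x e iff[OF x(1)] unfolding cont_on_Rn_def by blast
    then show ?thesis using iff x by (intro exI[of _ \<delta>]) (auto simp: abs_less_iff)
  qed
  show ?thesis unfolding graph_fo_def
    by (intro conjI ballI allI impI cont) (auto simp: iff)
qed

lemma quotient_fo_iff:
  assumes f: "graph n {x \<in> space n. \<alpha> x} f = {z \<in> space (Suc n). \<beta> z}"
    and g: "graph n {x \<in> space n. \<alpha> x} g = {z \<in> space (Suc n). \<gamma> z}"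
  shows "quotient_fo n N \<beta> \<gamma> \<longleftrightarrow> cont_on_Rn n {x \<in> space n. \<alpha> x} (\<lambda>x. g x ^ N / f x)"
proof -
  let ?h = "\<lambda>x. g x ^ N / f x"
  have "quotient_fo n N \<beta> \<gamma> \<longleftrightarrow> (\<forall>x\<in>space n. \<alpha> x \<longrightarrow> (\<forall>e. 0 < e \<longrightarrow> (\<exists>\<delta>. 0 < \<delta> \<and>
      (\<forall>y\<in>space n. \<alpha> y \<longrightarrow> sqdist n y x < \<delta>\<^sup>2 \<longrightarrow> ?h y - ?h x < e \<and> ?h x - ?h y < e))))"
    unfolding quotient_fo_def hrel_iff by (simp add: in_graph_iff[OF f] in_graph_iff[OF g] cong: conj_cong)
  also have "\<dots> \<longleftrightarrow> cont_on_Rn n {x \<in> space n. \<alpha> x} ?h"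
    unfolding cont_on_Rn_def by (simp add: abs_less_iff Ball_def imp_conjL)
  finally show ?thesis .
qed

lemma zero_fo_iff:
  assumes f: "graph n {x \<in> space n. \<alpha> x} f = {z \<in> space (Suc n). \<beta> z}"
    and g: "graph n {x \<in> space n. \<alpha> x} g = {z \<in> space (Suc n). \<gamma> z}"
  shows "zero_fo n \<beta> \<gamma> \<longleftrightarrow> (\<forall>x\<in>{x \<in> space n. \<alpha> x}. f x = 0 \<longrightarrow> g x = 0)"
  unfolding zero_fo_def using in_graph_iff[OF f] in_graph_iff[OF g] by auto

lemma core_real:
  fixes \<phi>A \<phi>f \<phi>g :: "real mpoly qf_formula"
  assumes d: "d \<ge> 2" and N: "elim_t n (2 * d) < N"
    and p: "qf_polys \<phi>A \<subseteq> polys_le n d" "qf_polys \<phi>f \<subseteq> polys_le (Suc n) d" "qf_polys \<phi>g \<subseteq> polys_le (Suc n) d"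
    and cl: "closed_fo n (qf_sat \<phi>A)" and gf: "graph_fo n (qf_sat \<phi>A) (qf_sat \<phi>f)"
    and gg: "graph_fo n (qf_sat \<phi>A) (qf_sat \<phi>g)" and z: "zero_fo n (qf_sat \<phi>f) (qf_sat \<phi>g)"
  shows "quotient_fo n N (qf_sat \<phi>f) (qf_sat \<phi>g)"
proof -
  let ?A = "{x \<in> space n. qf_sat \<phi>A x}"
  obtain f where f: "cont_on_Rn n ?A f" "graph n ?A f = {z \<in> space (Suc n). qf_sat \<phi>f z}"
    using graph_fo_imp_function[OF gf] by blast
  obtain g where g: "cont_on_Rn n ?A g" "graph n ?A g = {z \<in> space (Suc n). qf_sat \<phi>g z}"
    using graph_fo_imp_function[OF gg] by blast
  have z': "f x = 0 \<Longrightarrow> g x = 0" if "x \<in> ?A" for x using z that unfolding zero_fo_iff[OF f(2) g(2)] by blast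
  have cl': "closed_in_Rn n ?A" using cl by (simp add: closed_fo_iff)
  have "cont_on_Rn n ?A (\<lambda>x. g x ^ N / f x)"
    by (rule quotient_continuous_real[OF d p refl f(2) g(2) cl' f(1) g(1) z' N])
  then show ?thesis by (simp add: quotient_fo_iff[OF f(2) g(2)])
qed

text \<open>Inserting arbitrary real coefficients can only remove monomials, so the degree bounds
  persist and the real case proves the sentence for every real \<open>c\<close> at once. Transfer
  then yields it over the other field.\<close>

lemma core_rcf:
  fixes \<phi>A \<phi>f \<phi>g :: "'p::zero mpoly qf_formula" and c :: "nat \<Rightarrow> 'a::linordered_field"
  assumes ivt: "poly_ivt TYPE('a)" "poly_ivt TYPE(real)" and d: "d \<ge> 2" and N: "elim_t n (2 * d) < N"
    and p: "qf_polys \<phi>A \<subseteq> polys_le n d" "qf_polys \<phi>f \<subseteq> polys_le (Suc n) d" "qf_polys \<phi>g \<subseteq> polys_le (Suc n) d"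
    and c: "c \<in> space m"
    and "closed_fo n (qf_sat (inst idx c \<phi>A))" "graph_fo n (qf_sat (inst idx c \<phi>A)) (qf_sat (inst idx c \<phi>f))"
      "graph_fo n (qf_sat (inst idx c \<phi>A)) (qf_sat (inst idx c \<phi>g))"
      "zero_fo n (qf_sat (inst idx c \<phi>f)) (qf_sat (inst idx c \<phi>g))"
  shows "quotient_fo n N (qf_sat (inst idx c \<phi>f)) (qf_sat (inst idx c \<phi>g))"
proof -
  have "\<forall>c\<in>(space m :: (nat \<Rightarrow> real) set). closed_fo n (qf_sat (inst idx c \<phi>A)) \<longrightarrow>
      graph_fo n (qf_sat (inst idx c \<phi>A)) (qf_sat (inst idx c \<phi>f)) \<longrightarrow>
      graph_fo n (qf_sat (inst idx c \<phi>A)) (qf_sat (inst idx c \<phi>g)) \<longrightarrow>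
      zero_fo n (qf_sat (inst idx c \<phi>f)) (qf_sat (inst idx c \<phi>g)) \<longrightarrow>
      quotient_fo n N (qf_sat (inst idx c \<phi>f)) (qf_sat (inst idx c \<phi>g))"
    using p by (intro ballI impI core_real[OF d N]) (auto simp: qf_polys_inst intro!: inst_poly_in_polys_le)
  then show ?thesis
    using det2_sentence[OF det2_core[OF ivt, of m n idx \<phi>A \<phi>f \<phi>g N]] assms(8-12) by simp
qed

section \<open>Semialgebraicity of the graph of the quotient\<close>

definition mono_eval :: "(nat \<Rightarrow>\<^sub>0 nat) \<Rightarrow> (nat \<Rightarrow> 'a::comm_ring_1) \<Rightarrow> 'a" where
  "mono_eval m x = (\<Prod>j\<in>Poly_Mapping.keys m. x j ^ Poly_Mapping.lookup m j)"

lemma mono_eval_superset: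
  "finite K \<Longrightarrow> Poly_Mapping.keys m \<subseteq> K \<Longrightarrow> mono_eval m x = (\<Prod>j\<in>K. x j ^ Poly_Mapping.lookup m j)"
  unfolding mono_eval_def by (rule prod.mono_neutral_left) (auto simp: in_keys_iff)

lemma mono_eval_add: "mono_eval (m + m') x = mono_eval m x * mono_eval m' x"
proof -
  let ?K = "Poly_Mapping.keys m \<union> Poly_Mapping.keys m'"
  have "mono_eval (m + m') x = (\<Prod>j\<in>?K. x j ^ Poly_Mapping.lookup (m + m') j)"
    using keys_add[of m m'] by (intro mono_eval_superset) auto
  also have "\<dots> = (\<Prod>j\<in>?K. x j ^ Poly_Mapping.lookup m j) * (\<Prod>j\<in>?K. x j ^ Poly_Mapping.lookup m' j)"
    by (simp add: lookup_add power_add prod.distrib)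
  also have "\<dots> = mono_eval m x * mono_eval m' x" by (subst (1 2) mono_eval_superset[of ?K]) auto
  finally show ?thesis .
qed

lemma mpoly_eval_superset:
  "finite K \<Longrightarrow> Poly_Mapping.keys p \<subseteq> K \<Longrightarrow> mpoly_eval p x = (\<Sum>m\<in>K. Poly_Mapping.lookup p m * mono_eval m x)"
  unfolding mpoly_eval_def mono_eval_def by (rule sum.mono_neutral_left) (auto simp: in_keys_iff)

lemma mpoly_eval_add: "mpoly_eval (p + q) x = mpoly_eval p x + mpoly_eval q x"
proof -
  let ?K = "Poly_Mapping.keys p \<union> Poly_Mapping.keys q"
  have "mpoly_eval (p + q) x = (\<Sum>m\<in>?K. Poly_Mapping.lookup (p + q) m * mono_eval m x)"
    using keys_add[of p q] by (intro mpoly_eval_superset) auto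
  also have "\<dots> = (\<Sum>m\<in>?K. Poly_Mapping.lookup p m * mono_eval m x) + (\<Sum>m\<in>?K. Poly_Mapping.lookup q m * mono_eval m x)"
    by (simp add: lookup_add algebra_simps sum.distrib)
  also have "\<dots> = mpoly_eval p x + mpoly_eval q x" by (subst (1 2) mpoly_eval_superset[of ?K]) auto
  finally show ?thesis .
qed

lemma mpoly_eval_0: "mpoly_eval 0 x = 0"
  by (simp add: mpoly_eval_def)

lemma mpoly_eval_sum: "mpoly_eval (\<Sum>i\<in>I. p i) x = (\<Sum>i\<in>I. mpoly_eval (p i) x)"
  by (induction I rule: infinite_finite_induct) (auto simp: mpoly_eval_0 mpoly_eval_add)

lemma mpoly_eval_single: "mpoly_eval (Poly_Mapping.single m a) x = a * mono_eval m x"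
  by (subst mpoly_eval_superset[of "{m}"]) auto

lemma mpoly_as_sum: "(p :: 'a::comm_ring_1 mpoly) = (\<Sum>m\<in>Poly_Mapping.keys p. Poly_Mapping.single m (Poly_Mapping.lookup p m))"
  by (rule poly_mapping_eqI) (auto simp: lookup_sum lookup_single when_def in_keys_iff)

lemma mpoly_eval_mult: "mpoly_eval (p * q) x = mpoly_eval p x * mpoly_eval q x"
proof -
  have "p * q = (\<Sum>m\<in>Poly_Mapping.keys p. \<Sum>m'\<in>Poly_Mapping.keys q.
      Poly_Mapping.single (m + m') (Poly_Mapping.lookup p m * Poly_Mapping.lookup q m'))"
    by (subst mpoly_as_sum[of p], subst mpoly_as_sum[of q]) (simp add: sum_product mult_single)
  then have "mpoly_eval (p * q) x = (\<Sum>m\<in>Poly_Mapping.keys p. \<Sum>m'\<in>Poly_Mapping.keys q.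
      Poly_Mapping.lookup p m * Poly_Mapping.lookup q m' * mono_eval (m + m') x)"
    by (simp add: mpoly_eval_sum mpoly_eval_single)
  also have "\<dots> = (\<Sum>m\<in>Poly_Mapping.keys p. Poly_Mapping.lookup p m * mono_eval m x) *
      (\<Sum>m\<in>Poly_Mapping.keys q. Poly_Mapping.lookup q m * mono_eval m x)"
    unfolding sum_product by (intro sum.cong refl) (simp add: mono_eval_add ac_simps)
  finally show ?thesis by (simp add: mpoly_eval_def mono_eval_def)
qed

text \<open>Variables from \<open>k\<close> on receive the fixed values \<open>c\<close>: an integer
  polynomial with parameters becomes a polynomial over the field.\<close>

fun mpoly_of :: "nat \<Rightarrow> (nat \<Rightarrow> 'a::comm_ring_1) \<Rightarrow> iexp \<Rightarrow> 'a mpoly" where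
  "mpoly_of k c (IC j) = Poly_Mapping.single 0 (of_int j)"
| "mpoly_of k c (IV i) = (if i < k then Poly_Mapping.single (Poly_Mapping.single i 1) 1 else Poly_Mapping.single 0 (c (i - k)))"
| "mpoly_of k c (IAdd s t) = mpoly_of k c s + mpoly_of k c t"
| "mpoly_of k c (IMul s t) = mpoly_of k c s * mpoly_of k c t"

lemma mpoly_eval_mpoly_of: "mpoly_eval (mpoly_of k c t) x = ieval t (\<lambda>i. if i < k then x i else c (i - k))"
  by (induction t)
    (auto simp: mpoly_eval_single mpoly_eval_add mpoly_eval_mult mono_eval_def simp del: single_of_int)

lemma vars_in_mpoly_of: "vars_in (mpoly_of k c t) {..<k}"
proof (induction t)
  case (IAdd s t)
  then show ?case using keys_add[of "mpoly_of k c s" "mpoly_of k c t"] unfolding vars_in_def by auto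
next
  case (IMul s t)
  show ?case unfolding vars_in_def
  proof
    fix m assume "m \<in> Poly_Mapping.keys (mpoly_of k c (IMul s t))"
    then obtain a b where "m = a + b" "a \<in> Poly_Mapping.keys (mpoly_of k c s)" "b \<in> Poly_Mapping.keys (mpoly_of k c t)"
      using keys_mult[of "mpoly_of k c s" "mpoly_of k c t"] by auto
    then show "Poly_Mapping.keys m \<subseteq> {..<k}" using IMul keys_add[of a b] unfolding vars_in_def by blast
  qed
qed (auto simp: vars_in_def simp del: single_of_int)

text \<open>Formulas have no constants, so the truth values are written with the polynomial 0, hence
  \<open>insert 0 Q\<close>. The induction splits on the three signs of one polynomial.\<close>

lemma sign_determined_formula:
  fixes Q :: "'a::linordered_field mpoly set"
  assumes "finite Q" "\<And>x y. (\<And>q. q \<in> Q \<Longrightarrow> sgn (mpoly_eval q x) = sgn (mpoly_eval q y)) \<Longrightarrow> S x = S y"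
  shows "\<exists>\<phi>. qf_polys \<phi> \<subseteq> insert 0 Q \<and> (\<forall>x. qf_sat \<phi> x = S x)"
  using assms
proof (induction Q arbitrary: S rule: finite_induct)
  case empty
  then have "S x = S y" for x y by blast
  then show ?case
    by (cases "S (\<lambda>_. 0)")
      (intro exI[of _ "AEq 0"] exI[of _ "FNot (AEq 0)"], force simp: mpoly_eval_0)+
next
  case (insert q Q)
  \<comment> \<open>The existential quantifier makes \<open>S' s\<close> depend on the signs of
    \<open>Q\<close> alone, while it still agrees with \<open>S\<close> where \<open>q\<close> has
    sign \<open>s\<close>.\<close>
  define S' where "S' = (\<lambda>s x. \<exists>y. (\<forall>p\<in>Q. sgn (mpoly_eval p x) = sgn (mpoly_eval p y)) \<and> sgn (mpoly_eval q y) = s \<and> S y)"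
  have "\<exists>\<phi>. qf_polys \<phi> \<subseteq> insert 0 Q \<and> (\<forall>x. qf_sat \<phi> x = S' s x)" for s
    by (rule insert.IH) (auto simp: S'_def)
  then obtain \<phi> where \<phi>: "\<And>s. qf_polys (\<phi> s) \<subseteq> insert 0 Q" "\<And>s x. qf_sat (\<phi> s) x = S' s x" by metis
  have S': "S' (sgn (mpoly_eval q x)) x = S x" for x
  proof
    assume "S' (sgn (mpoly_eval q x)) x"
    then obtain y where y: "\<forall>p\<in>Q. sgn (mpoly_eval p x) = sgn (mpoly_eval p y)"
      "sgn (mpoly_eval q y) = sgn (mpoly_eval q x)" "S y"
      unfolding S'_def by blast
    have "S x = S y" by (rule insert.prems) (use y in auto)
    then show "S x" using y by simp
  next
    assume "S x"
    then show "S' (sgn (mpoly_eval q x)) x" unfolding S'_def by blast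
  qed
  let ?\<phi> = "FOr (FAnd (AGt q) (\<phi> 1)) (FOr (FAnd (AEq q) (\<phi> 0)) (FAnd (ALt q) (\<phi> (- 1))))"
  have "qf_sat ?\<phi> x = S x" for x
    using S'[of x] by (auto simp: \<phi>(2) sgn_if split: if_splits)
  moreover have "qf_polys ?\<phi> \<subseteq> insert 0 (insert q Q)" using \<phi>(1) by auto
  ultimately show ?case by blast
qed

text \<open>With the same predicate on both sides, \<open>det2\<close> says that finitely many signs
  decide \<open>S\<close>, which is quantifier elimination.\<close>

lemma det2_imp_semialg:
  fixes S :: "(nat \<Rightarrow> 'a::linordered_field) \<Rightarrow> bool" and c :: "nat \<Rightarrow> 'a"
  assumes "det2 S S"
  shows "semialg k {z \<in> space k. S (\<lambda>i. if i < k then z i else c (i - k))}"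
proof -
  obtain Q where Q: "finite Q" "\<And>e e'. agree Q e e' \<Longrightarrow> S e = S e'" using assms unfolding det2_def by blast
  let ?S = "\<lambda>z. S (\<lambda>i. if i < k then z i else c (i - k))"
  have "\<exists>\<phi>. qf_polys \<phi> \<subseteq> insert 0 (mpoly_of k c ` Q) \<and> (\<forall>x. qf_sat \<phi> x = ?S x)"
  proof (rule sign_determined_formula)
    fix x y assume h: "\<And>q. q \<in> mpoly_of k c ` Q \<Longrightarrow> sgn (mpoly_eval q x) = sgn (mpoly_eval q y)"
    have sg: "sgn a = sgn b \<Longrightarrow> sgneq a b" for a b :: 'a
      unfolding sgneq_def by (metis sgn_1_pos sgn_1_neg)
    show "?S x = ?S y"
    proof (rule Q(2), unfold agree_def, intro ballI sg)
      fix q assume "q \<in> Q"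
      then show "sgn (ieval q (\<lambda>i. if i < k then x i else c (i - k))) =
          sgn (ieval q (\<lambda>i. if i < k then y i else c (i - k)))"
        using h[of "mpoly_of k c q"] by (simp add: mpoly_eval_mpoly_of)
    qed
  qed (use Q in auto)
  then obtain \<phi> where \<phi>: "qf_polys \<phi> \<subseteq> insert 0 (mpoly_of k c ` Q)" "\<And>x. qf_sat \<phi> x = ?S x" by blast
  have "vars_in (0 :: 'a mpoly) {..<k}" by (simp add: vars_in_def)
  then show ?thesis unfolding semialg_def P_semialg_def
    by (intro exI[of _ "insert 0 (mpoly_of k c ` Q)"] exI[of _ \<phi>] conjI)
      (use \<phi> Q(1) vars_in_mpoly_of in auto)
qed

text \<open>Layout of the environment: \<open>n\<close> coordinates of x, the value of h at position
  \<open>n\<close>, the coefficients from \<open>Suc n\<close> on. The values \<open>u\<close> and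
  \<open>v\<close> of f and g are the variables to be eliminated.\<close>

lemma det2_quotient_graph:
  fixes \<phi>f \<phi>g :: "'p::zero mpoly qf_formula"
  assumes ivt: "poly_ivt TYPE('a::linordered_field)"
  shows "det2 (\<lambda>e :: nat \<Rightarrow> 'a. \<exists>u v. qf_sat (inst idx (\<lambda>j. e (Suc n + j)) \<phi>f) ((\<lambda>i. if i < n then e i else 0)(n := u)) \<and>
      qf_sat (inst idx (\<lambda>j. e (Suc n + j)) \<phi>g) ((\<lambda>i. if i < n then e i else 0)(n := v)) \<and> hrel N u v (e n))
    (\<lambda>e :: nat \<Rightarrow> 'a. \<exists>u v. qf_sat (inst idx (\<lambda>j. e (Suc n + j)) \<phi>f) ((\<lambda>i. if i < n then e i else 0)(n := u)) \<and>
      qf_sat (inst idx (\<lambda>j. e (Suc n + j)) \<phi>g) ((\<lambda>i. if i < n then e i else 0)(n := v)) \<and> hrel N u v (e n))"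
  unfolding hrel_def
  by (intro det2_ex[OF ivt ivt] det2_conj det2_disj
    det2_not det2_eq det2_less det2_qf_sat pfun_upd pfun_if pfun_0 pfun_power pfun_mult pfun_var)

lemma inst_original:
  fixes \<phi> :: "'a::zero mpoly qf_formula"
  assumes "\<And>p m. p \<in> qf_polys \<phi> \<Longrightarrow> m \<in> Poly_Mapping.keys p \<Longrightarrow> c (idx (p, m)) = Poly_Mapping.lookup p m"
  shows "inst idx c \<phi> = \<phi>"
proof -
  have "inst_poly idx c p = p" if "p \<in> qf_polys \<phi>" for p
    using assms[OF that] by (intro poly_mapping_eqI) (auto simp: inst_poly_def lookup_mapp when_def in_keys_iff)
  then show ?thesis unfolding inst_def by (induction \<phi>) auto
qed

text \<open>The left side is 9 (2 d + 2) (2 d + 1)^n, and 9 (2 d + 2) is below (8 d)^2 for d \<ge>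
  2, so it is already smaller than (8 d)^(n + 2).\<close>

lemma elim_t_less:
  assumes "d \<ge> 2"
  shows "elim_t n (2 * d) < (8 * d) ^ (2 * (n + 7))"
proof -
  have "elim_t n (2 * d) = ((2 * d + 2) * 9) * (2 * d + 1) ^ n" by (simp add: elim_t_def elim_e_def algebra_simps)
  also have "\<dots> \<le> ((2 * d + 2) * 9) * (8 * d) ^ n" using assms by (intro mult_le_mono2 power_mono) auto
  also have "\<dots> < (8 * d) ^ 2 * (8 * d) ^ n"
  proof -
    define s where "s = d * d"
    have "2 * d \<le> s" using assms by (simp add: s_def)
    then have "18 * d + 18 < 64 * s" using assms by linarith
    then have "(2 * d + 2) * 9 < 64 * s" by (simp add: algebra_simps)
    also have "64 * s = (8 * d) ^ 2" by (simp add: power2_eq_square s_def)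
    finally have "(2 * d + 2) * 9 < (8 * d) ^ 2" .
    then show ?thesis using assms by simp
  qed
  also have "\<dots> = (8 * d) ^ (2 + n)" by (rule power_add[symmetric])
  also have "\<dots> \<le> (8 * d) ^ (2 * (n + 7))" using assms by (intro power_increasing) auto
  finally show ?thesis .
qed

lemma power_divisible_by_continuous_semialg:
  fixes P Pf Pg :: "'a::linordered_field mpoly set"
    and A :: "(nat \<Rightarrow> 'a) set"
    and f g :: "(nat \<Rightarrow> 'a) \<Rightarrow> 'a"
    and n d :: nat
  assumes ivt: "poly_ivt TYPE('a)" "poly_ivt TYPE(real)"
    and d: "d \<ge> 2"
    and P: "P \<subseteq> polys_le n d"
    and Pf: "Pf \<subseteq> polys_le (Suc n) d"
    and Pg: "Pg \<subseteq> polys_le (Suc n) d"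
    and cl: "closed_in_Rn n A" and sA: "P_semialg P n A"
    and cf: "cont_on_Rn n A f" and sf: "P_semialg Pf (Suc n) (graph n A f)"
    and cg: "cont_on_Rn n A g" and sg: "P_semialg Pg (Suc n) (graph n A g)"
    and zero: "\<forall>x\<in>A. f x = 0 \<longrightarrow> g x = 0"
    and N: "elim_t n (2 * d) < N"
  shows "\<exists>h. cont_on_Rn n A h \<and> semialg (Suc n) (graph n A h) \<and> (\<forall>x\<in>A. g x ^ N = h x * f x)"
proof -
  obtain \<phi>A where \<phi>A: "qf_polys \<phi>A \<subseteq> P" "A = {x \<in> space n. qf_sat \<phi>A x}"
    using sA unfolding P_semialg_def by blast
  obtain \<phi>f where \<phi>f: "qf_polys \<phi>f \<subseteq> Pf" "graph n A f = {x \<in> space (Suc n). qf_sat \<phi>f x}"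
    using sf unfolding P_semialg_def by blast
  obtain \<phi>g where \<phi>g: "qf_polys \<phi>g \<subseteq> Pg" "graph n A g = {x \<in> space (Suc n). qf_sat \<phi>g x}"
    using sg unfolding P_semialg_def by blast
  have gf: "graph n {x \<in> space n. qf_sat \<phi>A x} f = {x \<in> space (Suc n). qf_sat \<phi>f x}"
    and gg: "graph n {x \<in> space n. qf_sat \<phi>A x} g = {x \<in> space (Suc n). qf_sat \<phi>g x}"
    using \<phi>f(2) \<phi>g(2) \<phi>A(2) by auto
  \<comment> \<open>All coefficient positions in the three formulas. Numbering them turns the
    coefficients into a point \<open>c\<close> that gives back the original formulas as
    instances.\<close>
  define I where "I = Sigma (qf_polys \<phi>A \<union> qf_polys \<phi>f \<union> qf_polys \<phi>g) Poly_Mapping.keys"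
  have "finite I" unfolding I_def by (intro finite_SigmaI) (auto simp: finite_qf_polys)
  obtain idx :: "'a mpoly \<times> (nat \<Rightarrow>\<^sub>0 nat) \<Rightarrow> nat" and m where idx: "inj_on idx I" "idx ` I = {i. i < m}"
    using finite_imp_inj_to_nat_seg[OF \<open>finite I\<close>] by blast
  define c where "c = (\<lambda>j. if j < m then case inv_into I idx j of (p, mo) \<Rightarrow> Poly_Mapping.lookup p mo else 0)"
  have c_space: "c \<in> space m" by (simp add: c_def Defs.space_def)
  have c_idx: "c (idx (p, mo)) = Poly_Mapping.lookup p mo" if "(p, mo) \<in> I" for p mo
  proof -
    have "idx (p, mo) < m" using idx(2) that by blast
    then show ?thesis using idx(1) that by (simp add: c_def)
  qed
  have inst: "inst idx c \<phi>A = \<phi>A" "inst idx c \<phi>f = \<phi>f" "inst idx c \<phi>g = \<phi>g"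
    by (rule inst_original, rule c_idx, simp add: I_def)+
  have "quotient_fo n N (qf_sat (inst idx c \<phi>f)) (qf_sat (inst idx c \<phi>g))"
  proof (rule core_rcf[OF ivt d N _ _ _ c_space])
    show "qf_polys \<phi>A \<subseteq> polys_le n d" "qf_polys \<phi>f \<subseteq> polys_le (Suc n) d" "qf_polys \<phi>g \<subseteq> polys_le (Suc n) d"
      using \<phi>A \<phi>f \<phi>g P Pf Pg by auto
  qed (use cl cf cg zero in \<open>simp_all add: inst closed_fo_iff function_imp_graph_fo[OF gf] function_imp_graph_fo[OF gg]
      zero_fo_iff[OF gf gg] flip: \<phi>A(2)\<close>)
  then have ch: "cont_on_Rn n A (\<lambda>x. g x ^ N / f x)"
    by (simp add: inst quotient_fo_iff[OF gf gg] flip: \<phi>A(2))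
  have "semialg (Suc n) {z \<in> space (Suc n). \<exists>u v.
      qf_sat \<phi>f ((trunc n z)(n := u)) \<and> qf_sat \<phi>g ((trunc n z)(n := v)) \<and> hrel N u v (z n)}"
  proof -
    have "(\<lambda>i. if i < n then (if i < Suc n then z i else c (i - Suc n)) else 0) = trunc n z" for z
      by (auto simp: trunc_def fun_eq_iff)
    then show ?thesis
      using det2_imp_semialg[OF det2_quotient_graph[OF ivt(1), of idx n \<phi>f \<phi>g N], of "Suc n" c] by (simp add: inst)
  qed
  also have "{z \<in> space (Suc n). \<exists>u v. qf_sat \<phi>f ((trunc n z)(n := u)) \<and> qf_sat \<phi>g ((trunc n z)(n := v)) \<and> hrel N u v (z n)} =
      graph n A (\<lambda>x. g x ^ N / f x)"
  proof -
    have "trunc n z \<in> A \<longleftrightarrow> qf_sat \<phi>A (trunc n z)" for z using \<phi>A(2) in_space_trunc[of n z] by auto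
    then show ?thesis
      unfolding Defs.graph_def hrel_iff in_graph_iff[OF gf in_space_trunc] in_graph_iff[OF gg in_space_trunc] by auto
  qed
  finally have "semialg (Suc n) (graph n A (\<lambda>x. g x ^ N / f x))" .
  \<comment> \<open>At zeros of \<open>f\<close> both sides are 0, since \<open>g\<close> vanishes
    there and \<open>N > 0\<close>.\<close>
  moreover have "g x ^ N = g x ^ N / f x * f x" if "x \<in> A" for x
    using zero that N by (cases "f x = 0") (auto simp: power_0_left)
  ultimately show ?thesis using ch by blast
qed

theorem theorem5p8:
  fixes P Pf Pg :: "'a::linordered_field mpoly set"
    and A :: "(nat \<Rightarrow> 'a) set"
    and f g :: "(nat \<Rightarrow> 'a) \<Rightarrow> 'a"
    and n d :: nat
  assumes "real_closed_field TYPE('a)"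
    and "d \<ge> 2"
    and "finite P" "P \<subseteq> polys_le n d"
    and "finite Pf" "Pf \<subseteq> polys_le (Suc n) d"
    and "finite Pg" "Pg \<subseteq> polys_le (Suc n) d"
    and "closed_in_Rn n A" "P_semialg P n A"
    and "cont_on_Rn n A f" "P_semialg Pf (Suc n) (graph n A f)"
    and "cont_on_Rn n A g" "P_semialg Pg (Suc n) (graph n A g)"
    and "\<forall>x\<in>A. f x = 0 \<longrightarrow> g x = 0"
  shows "\<exists>h. cont_on_Rn n A h \<and> semialg (Suc n) (graph n A h) \<and>
             (\<forall>x\<in>A. g x ^ ((8 * d) ^ (2 * (n + 7))) = h x * f x)"
  using power_divisible_by_continuous_semialg[OF rcf_imp_poly_ivt[OF assms(1)] poly_ivt_real assms(2,4,6,8-15)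
    elim_t_less[OF assms(2)]] .

end
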